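(* The $\mathbb{ZP}$-algebra homomorphism $\Psi:\mathcal{A}^{\mathrm{g}} \to \mathcal{A}^{\mathrm{c}}/\mathcal{I}$ defined by $x_{i;t}^{\mathrm{g}} \mapsto [X_{i;t}]$ ($i=1,\dots,n$, $t\in\mathbb{T}_n$) and $p \mapsto [p]$ ($p \in \mathbb{P}$) is an isomorphism. Therefore, the generalized cluster algebra $\mathcal{A}^{\mathrm{g}}$ is isomorphic to a subquotient $\mathcal{A}^{\mathrm{c}}/\mathcal{I}$ (a quotient of the subalgebra $\mathcal{A}^{\mathrm{c}}$) of the ordinary cluster algebra $\mathcal{A}$.
   Context: Notation: $[a]_+=\max(a,0)$. A semifield $(\mathbb{P},\oplus,\cdot)$ is a multiplicative abelian group with a commutative associative addition $\oplus$ over which multiplication distributes; $\mathbb{P}_0=\mathbb{P}\sqcup\{0\}$ with $0\oplus p=p$, $0\cdot p=0$. $\mathbb{ZP}$ is the group ring of $(\mathbb{P},\cdot)$ (an integral domain), $\mathbb{QP}$ its fraction field, $\mathbb{NP}\subset\mathbb{ZP}$ the elements with nonnegative coefficients, and $\pi_{\mathbb{P}_0}:\mathbb{NP}\to\mathbb{P}_0$, $\sum_j a_jp_j\mapsto\bigoplus_j (p_j\oplus\cdots\oplus p_j)$ ($a_j$ terms). Generalized cluster pattern. Fix $n\ge1$, ${\bf r}=(r_1,\dots,r_n)\in\mathbb{Z}_{\ge1}^n$, a semifield $\mathbb{P}$, and a field $\mathcal{F}$ of rational functions in $n$ variables over $\mathbb{QP}$. A generalized seed is $({\bf x},{\bf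 y},{\bf Z},B)$ with ${\bf x}=(x_1,\dots,x_n)$ a free generating set of $\mathcal{F}$, ${\bf y}\in\mathbb{P}^n$, ${\bf Z}=(Z_1(u),\dots,Z_n(u))$ with $Z_i(u)=\sum_{l=0}^{r_i}\hat z_{il}u^l$, $\hat z_{il}\in\mathbb{NP}$, $\hat z_{i0}=\hat z_{ir_i}=1$, and $B=(b_{ij})$ a skew-symmetrizable integer $n\times n$ matrix. Put $\hat y_k=y_k\prod_j x_j^{b_{jk}}$, $Z_k|_{\mathbb{P}_0}(y)=\bigoplus_l\pi_{\mathbb{P}_0}(\hat z_{kl})y^l$. The mutation $\mu_k^{\bf r}$ in direction $k$ gives: $x_k'=x_k^{-1}\bigl(\prod_j x_j^{[-b_{jk}]_+}\bigr)^{r_k}Z_k(\hat y_k)/Z_k|_{\mathbb{P}_0}(y_k)$, $x_i'=x_i$ ($i\ne k$); $y_k'=y_k^{-1}$, $y_i'=y_i(y_k^{[b_{ki}]_+})^{r_k}Z_k|_{\mathbb{P}_0}(y_k)^{-b_{ki}}$ ($i\neq k$); $Z_k'(u)=u^{r_k}Z_k(u^{-1})$, $Z_i'=Z_i$ ($i\ne k$); $b'_{ij}=-b_{ij}$ if $i=k$ or $j=k$, else $b'_{ij}=b_{ij}+r_k(b_{ik}[b_{kj}]_++[-b_{ik}]_+b_{kj})$. $\mathbb{T}_n$ is the $n$-regular tree with edges labeled $1,\dots,n$ (the $n$ edges at each vertex having distinct labels); vertices joined by an edge labeled $k$ are $k$-adjacent; $t_0$ is a fixed vertex. A generalized cluster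 pattern is a family of generalized seeds $\{\Sigma_t\}_{t\in\mathbb{T}_n}$ with $\Sigma_{t'}=\mu_k^{\bf r}(\Sigma_t)$ for all $k$-adjacent $t,t'$; its generalized cluster algebra is the $\mathbb{ZP}$-subalgebra of $\mathcal{F}$ generated by all its $x$-variables. The case ${\bf r}=(1,\dots,1)$, $Z_i(u)=1+u$ is the ordinary case (ordinary seeds $({\bf x},{\bf y},B)$, ordinary mutation $\mu_k$, ordinary cluster pattern, ordinary cluster algebra). Let ${\bf \Sigma}^{\mathrm{g}}=\{({\bf x}^{\mathrm{g}}_t,{\bf y}^{\mathrm{g}}_t,{\bf Z}_t,B_t)\}_{t\in\mathbb{T}_n}$ be any generalized cluster pattern, ${\bf Z}=(Z_i(u)=\sum_l\hat z_{il}u^l)$ the exchange polynomials at $t_0$, $z_{il}=\pi_{\mathbb{P}_0}(\hat z_{il})$, and $\mathcal{A}^{\mathrm{g}}$ its generalized cluster algebra. Extended semifield. Let $\mathcal{D}=\{(i,l)\mid 1\le i\le n,\ 1\le l\le r_i\}$, $\mathcal{N}=|\mathcal{D}|=r_1+\dots+r_n$, ${\bf s}=\{s_{il}\}_{(i,l)\in\mathcal{D}}$ formal variables, and $\overline{\mathbb{P}}=\{f/g\in\mathbb{QP}({\bf s})\mid f,g\in\mathbb{NP}[{\bf s}]\setminus\{0\}\}$, a semifield under addition (denoted $\bar\oplus$) and multiplication of fractions. Let $e_{il}\in\overline{\mathbb{P}}$ be the degree-$l$ elementary symmetric polynomial in $s_{i1},\dots,s_{ir_i}$ with respect to $\bar\oplus$,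 ${\bf e}=\{e_{il}\}_{(i,l)\in\mathcal{D}}$, and $\psi:\mathbb{NP}[{\bf e}]\to\mathbb{P}_0$ the additive and multiplicative homomorphism extending $\pi_{\mathbb{P}_0}$ with $\psi(e_{il})=z_{il}$. Let $\mathbb{S}=\{f/g\in\overline{\mathbb{P}}\mid f,g\in\mathbb{NP}[{\bf e}],\ \psi(f),\psi(g)\ne0\}$, a subsemifield of $\overline{\mathbb{P}}$ containing $\mathbb{P}$ (via $p=p/1$); $\psi$ extends to a semifield homomorphism $\psi:\mathbb{S}\to\mathbb{P}$, $\psi(f/g)=\psi(f)/\psi(g)$. Associated composite pattern. Let $\overline{\mathcal{F}}$ be a field of rational functions in $\mathcal{N}$ variables over $\mathbb{Q}\overline{\mathbb{P}}$ (the fraction field of the group ring $\mathbb{Z}\overline{\mathbb{P}}$). Let $\mathcal{B}_{t_0}$ be the $\mathcal{D}\times\mathcal{D}$ matrix whose $((i,l),(j,m))$ entry is $b_{ij;t_0}$. Take the ordinary seed of rank $\mathcal{N}$ (indexed by $\mathcal{D}$), with coefficients in $\overline{\mathbb{P}}$ and ambient field $\overline{\mathcal{F}}$, given by $\Sigma^{\mathrm{c}}_{t_0}=({\bf x}^{\mathrm{c}}_{t_0},{\bf y}^{\mathrm{c}}_{t_0},\mathcal{B}_{t_0})$ with ${\bf x}^{\mathrm{c}}_{t_0}$ a free generating set of $\overline{\mathcal{F}}$ and $y^{\mathrm{c}}_{il;t_0}=s_{il}y^{\mathrm{g}}_{i;t_0}$. With $\mu_{il}$ the ordinary mutation in direction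 $(i,l)\in\mathcal{D}$, set $\mu^{\mathrm{c}}_k=\mu_{kr_k}\circ\cdots\circ\mu_{k1}$. The composite cluster pattern is the family $\{\Sigma^{\mathrm{c}}_t=({\bf x}^{\mathrm{c}}_t,{\bf y}^{\mathrm{c}}_t,\mathcal{B}_t)\}_{t\in\mathbb{T}_n}$ with $\Sigma^{\mathrm{c}}_{t'}=\mu^{\mathrm{c}}_k(\Sigma^{\mathrm{c}}_t)$ for $k$-adjacent $t,t'$. It is a subcollection of the ordinary cluster pattern ${\bf \Sigma}$ of rank $\mathcal{N}$ with initial seed $\Sigma^{\mathrm{c}}_{t_0}$; let $\mathcal{A}$ be the ordinary cluster algebra of ${\bf \Sigma}$ (a $\mathbb{Z}\overline{\mathbb{P}}$-algebra). Put $X_{i;t}=\prod_{l=1}^{r_i}x^{\mathrm{c}}_{il;t}$ and ${\bf X}=(X_{1;t_0},\dots,X_{n;t_0})$. The algebra $\mathcal{S}$. Let $\hat e_{il}\in\mathbb{Z}\overline{\mathbb{P}}\subset\overline{\mathcal{F}}$ be the degree-$l$ elementary symmetric polynomial in $s_{i1},\dots,s_{ir_i}$ with respect to the addition $+$ of $\mathbb{Z}\overline{\mathbb{P}}$ (elements of $\overline{\mathbb{P}}$ being viewed as basis elements of the group ring), $\hat{\bf e}=\{\hat e_{il}\}$. Let $\hat\psi:\mathbb{ZS}[\hat{\bf e},{\bf X}]\to\mathbb{ZP}[{\bf X}]$ be the $\mathbb{ZP}$-algebra homomorphism extending $\psi:\mathbb{S}\to\mathbb{P}$ with $X_{i;t_0}\mapsto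 X_{i;t_0}$, $\hat e_{il}\mapsto\hat z_{il}$. Let $\mathcal{S}=\{f/g\in\overline{\mathcal{F}}\mid f,g\in\mathbb{ZS}[\hat{\bf e},{\bf X}],\ \hat\psi(g)\neq0\}$, and extend $\hat\psi$ to $\hat\psi:\mathcal{S}\to\mathbb{QP}({\bf X})=\mathrm{Frac}(\mathbb{ZP}[{\bf X}])$ by $\hat\psi(f/g)=\hat\psi(f)/\hat\psi(g)$. Finally $\mathcal{A}^{\mathrm{c}}=\mathbb{ZS}[X_{i;t}\mid i=1,\dots,n,\ t\in\mathbb{T}_n]\subset\mathcal{A}$, which is also contained in $\mathcal{S}$, and $\mathcal{I}=\mathrm{Ker}\,\hat\psi\cap\mathcal{A}^{\mathrm{c}}$; $[\cdot]$ denotes the class in $\mathcal{A}^{\mathrm{c}}/\mathcal{I}$. *)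

theory Defs
  imports
    "HOL-Algebra.Algebraic_Closure_Type"
    "HOL-Algebra.Generated_Rings"
    "HOL-Library.Poly_Mapping"
begin

(* the polynomial variable of HOL-Algebra; frees the name X *)
no_notation Polynomials.var (\<open>X\<index>\<close>)

section \<open>Semifields\<close>

text \<open>The semifield addition is written \<^term>\<open>(+)\<close>; there is no zero element.\<close>

class semifield = comm_semiring + comm_monoid_mult + inverse +
  assumes semifield_left_inverse: "inverse a * a = 1"
    and semifield_divide: "a / b = a * inverse b"

datatype 'a with_zero = Zero | El (un_El: 'a)

instantiation with_zero :: (semifield) comm_semiring_1
begin

definition "0 = Zero"
definition "1 = El 1"

fun plus_with_zero :: "'a with_zero \<Rightarrow> 'a with_zero \<Rightarrow> 'a with_zero" where
  "Zero + b = b"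
| "El a + Zero = El a"
| "El a + El b = El (a + b)"

fun times_with_zero :: "'a with_zero \<Rightarrow> 'a with_zero \<Rightarrow> 'a with_zero" where
  "Zero * b = Zero"
| "El a * Zero = Zero"
| "El a * El b = El (a * b)"

instance
proof
  fix a b c :: "'a with_zero"
  show "a + b + c = a + (b + c)"
    by (cases a; cases b; cases c) (simp_all add: add.assoc)
  show "a + b = b + a"
    by (cases a; cases b) (simp_all add: add.commute)
  show "0 + a = a"
    by (simp add: zero_with_zero_def)
  show "a * b * c = a * (b * c)"
    by (cases a; cases b; cases c) (simp_all add: mult.assoc)
  show "a * b = b * a"
    by (cases a; cases b) (simp_all add: mult.commute)
  show "1 * a = a"
    by (cases a) (simp_all add: one_with_zero_def)
  show "(a + b) * c = a * c + b * c"
    by (cases a; cases b; cases c) (simp_all add: distrib_right)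
  show "0 * a = 0" "a * 0 = 0"
    by (cases a; simp add: zero_with_zero_def)+
  show "(0::'a with_zero) \<noteq> 1"
    by (simp add: zero_with_zero_def one_with_zero_def)
qed

end

subsection \<open>Semifields are torsion-free, hence orderable as groups\<close>

lemma semifield_right_inverse: "a * inverse a = (1 :: 'a :: semifield)"
  by (subst mult.commute) (rule semifield_left_inverse)

lemma semifield_mult_cancel: "a * c = b * c \<longleftrightarrow> a = (b :: 'a :: semifield)"
  by (metis mult.assoc mult.right_neutral semifield_right_inverse)

lemma semifield_inverse_unique: "a * b = 1 \<Longrightarrow> inverse a = (b :: 'a :: semifield)"
  by (metis semifield_mult_cancel semifield_left_inverse mult.commute)

lemma semifield_inverse_inverse [simp]: "inverse (inverse a) = (a :: 'a :: semifield)"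
  by (rule semifield_inverse_unique) (rule semifield_left_inverse)

lemma semifield_inverse_mult: "inverse (a * b) = inverse a * inverse (b :: 'a :: semifield)"
  by (rule semifield_inverse_unique)
    (metis mult.assoc mult.commute mult.left_neutral semifield_right_inverse)

lemma semifield_inverse_one [simp]: "inverse 1 = (1 :: 'a :: semifield)"
  by (rule semifield_inverse_unique) simp

primrec geo_sum :: "'a :: semifield \<Rightarrow> nat \<Rightarrow> 'a" where
  "geo_sum p 0 = 1"
| "geo_sum p (Suc n) = 1 + p * geo_sum p n"

lemma geo_sum_Suc: "geo_sum p (Suc n) = geo_sum p n + p ^ Suc n"
proof (induction n)
  case (Suc n)
  have "geo_sum p (Suc (Suc n)) = 1 + p * (geo_sum p n + p ^ Suc n)"
    using Suc by simp
  also have "\<dots> = (1 + p * geo_sum p n) + p ^ Suc (Suc n)"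
    by (simp add: distrib_left add.assoc)
  finally show ?case by simp
qed simp

lemma semifield_torsion_free:
  fixes p :: "'a :: semifield"
  assumes "p ^ m = 1" "m > 0"
  shows "p = 1"
proof (cases "m = 1")
  case False
  then obtain n where m: "m = Suc (Suc n)"
    using assms(2) by (metis One_nat_def not0_implies_Suc less_numeral_extra(3))
  have "p * geo_sum p (Suc n) = p * geo_sum p n + p * p ^ Suc n"
    by (simp only: geo_sum_Suc distrib_left)
  also have "p * p ^ Suc n = 1"
    using assms(1) m by simp
  finally have "p * geo_sum p (Suc n) = 1 * geo_sum p (Suc n)"
    by (simp add: add.commute)
  then show ?thesis by (simp only: semifield_mult_cancel)
qed (use assms in simp)

definition group_cone :: "'a :: semifield set \<Rightarrow> bool" where
  "group_cone C \<longleftrightarrow> 1 \<in> C \<and> (\<forall>a\<in>C. \<forall>b\<in>C. a * b \<in> C) \<and>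
     (\<forall>a. a \<in> C \<longrightarrow> inverse a \<in> C \<longrightarrow> a = 1)"

lemma group_cone_power: "group_cone C \<Longrightarrow> a \<in> C \<Longrightarrow> a ^ n \<in> C"
  by (induction n) (auto simp: group_cone_def)

lemma group_cone_extend:
  fixes M :: "'a :: semifield set"
  assumes M: "group_cone M" and g: "g \<notin> M" and max: "\<And>C. group_cone C \<Longrightarrow> M \<subseteq> C \<Longrightarrow> C = M"
  shows "\<exists>k>0. inverse g ^ k \<in> M"
proof -
  define C where "C = {c * g ^ n | c n. c \<in> M}"
  have one: "1 \<in> M" and mult: "\<And>a b. a \<in> M \<Longrightarrow> b \<in> M \<Longrightarrow> a * b \<in> M"
    and anti: "\<And>a. a \<in> M \<Longrightarrow> inverse a \<in> M \<Longrightarrow> a = 1"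
    using M by (auto simp: group_cone_def)
  have MC: "M \<subseteq> C"
    unfolding C_def by (auto, metis mult_1_right power_0)
  have "1 * g ^ 1 \<in> C"
    unfolding C_def using one by blast
  then have "C \<noteq> M" using g by auto
  with max MC have "\<not> group_cone C" by blast
  moreover have "1 \<in> C" using one MC by auto
  moreover have "a * b \<in> C" if "a \<in> C" "b \<in> C" for a b
  proof -
    from that obtain c n d m where "a = c * g ^ n" "b = d * g ^ m" "c \<in> M" "d \<in> M"
      by (auto simp: C_def)
    then have "a * b = (c * d) * g ^ (n + m)" "c * d \<in> M"
      by (simp_all add: power_add mult mult_ac)
    then show ?thesis unfolding C_def by blast
  qed
  ultimately obtain a where a: "a \<in> C" "inverse a \<in> C" "a \<noteq> 1"
    by (auto simp: group_cone_def)
  then obtain c n d m where *: "a = c * g ^ n" "inverse a = d * g ^ m" "c \<in> M" "d \<in> M"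
    by (auto simp: C_def)
  have "(c * d) * g ^ (n + m) = a * inverse a"
    unfolding * (2) by (simp add: * (1) power_add mult_ac)
  then have eq: "(c * d) * g ^ (n + m) = 1"
    by (simp add: semifield_right_inverse)
  have "n + m \<noteq> 0"
  proof
    assume "n + m = 0"
    then have "a \<in> M" "inverse a \<in> M" using * by auto
    with anti a show False by blast
  qed
  moreover have "inverse g ^ (n + m) = c * d"
  proof -
    have "inverse g ^ (n + m) * g ^ (n + m) = 1"
      by (simp flip: power_mult_distrib add: semifield_left_inverse)
    with eq show ?thesis by (metis semifield_mult_cancel)
  qed
  ultimately show ?thesis
    using mult * by (intro exI[of _ "n + m"]) auto
qed

lemma group_cone_total_exists:
  "\<exists>C :: 'a :: semifield set. group_cone C \<and> (\<forall>a. a \<in> C \<or> inverse a \<in> C)"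
proof -
  have "\<exists>M\<in>Collect group_cone. \<forall>X\<in>Collect group_cone. M \<subseteq> X \<longrightarrow> X = (M :: 'a set)"
  proof (rule subset_Zorn_nonempty)
    show "Collect group_cone \<noteq> ({} :: 'a set set)"
      by (auto simp: group_cone_def intro!: exI[of _ "{1}"])
  next
    fix \<C> :: "'a set set"
    assume ne: "\<C> \<noteq> {}" and ch: "subset.chain (Collect group_cone) \<C>"
    have cone: "group_cone X" if "X \<in> \<C>" for X
      using ch that by (auto simp: subset_chain_def)
    have both: "\<exists>X\<in>\<C>. a \<in> X \<and> b \<in> X" if "a \<in> \<Union>\<C>" "b \<in> \<Union>\<C>" for a b
      using ch that unfolding subset_chain_def by blast
    have "group_cone (\<Union>\<C>)"
      unfolding group_cone_def
    proof (intro conjI ballI allI impI)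
      show "1 \<in> \<Union>\<C>" using ne cone by (auto simp: group_cone_def)
      show "a * b \<in> \<Union>\<C>" if "a \<in> \<Union>\<C>" "b \<in> \<Union>\<C>" for a b
        using both[OF that] cone by (auto simp: group_cone_def)
      show "a = 1" if "a \<in> \<Union>\<C>" "inverse a \<in> \<Union>\<C>" for a
        using both[OF that] cone by (auto simp: group_cone_def)
    qed
    then show "\<Union>\<C> \<in> Collect group_cone" by simp
  qed
  then obtain M :: "'a set" where M: "group_cone M"
    and max: "\<And>C. group_cone C \<Longrightarrow> M \<subseteq> C \<Longrightarrow> C = M"
    by auto
  have "g \<in> M \<or> inverse g \<in> M" for g
  proof (rule ccontr)
    assume "\<not> ?thesis"
    then have g: "g \<notin> M" "inverse g \<notin> M" by auto
    obtain k where k: "k > 0" "inverse g ^ k \<in> M"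
      using group_cone_extend[OF M g(1) max] by blast
    obtain l where l: "l > 0" "g ^ l \<in> M"
      using group_cone_extend[OF M g(2) max] by auto
    have "(inverse g ^ k) ^ l \<in> M" "(g ^ l) ^ k \<in> M"
      using k l M by (auto intro: group_cone_power)
    moreover have "inverse ((g ^ l) ^ k) = (inverse g ^ k) ^ l"
      by (rule semifield_inverse_unique)
        (simp flip: power_mult power_mult_distrib add: mult.commute semifield_right_inverse)
    ultimately have "(g ^ l) ^ k = 1"
      using M unfolding group_cone_def by metis
    then have "g ^ (l * k) = 1" by (simp add: power_mult)
    then have "g = 1" by (rule semifield_torsion_free) (use k l in simp)
    with g M show False by (auto simp: group_cone_def)
  qed
  with M show ?thesis by blast
qed

section \<open>The group ring of a semifield\<close>

text \<open>\<^typ>\<open>('a \<Rightarrow>\<^sub>0 int)\<close> carries the convolution product for an additively written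
  monoid, so multiplicative monoids are rewritten additively.\<close>

datatype 'a additive = Additive (of_additive: 'a)

instantiation additive :: (comm_monoid_mult) comm_monoid_add
begin

definition "0 = Additive 1"
definition "a + b = Additive (of_additive a * of_additive b)"

instance
  by standard (simp_all add: zero_additive_def plus_additive_def mult_ac)

end

text \<open>An arbitrary choice of a compatible linear order. It only serves to obtain, from the
  library, that the group ring is an integral domain.\<close>

definition chosen_cone :: "'a :: semifield set" where
  "chosen_cone = (SOME C. group_cone C \<and> (\<forall>a. a \<in> C \<or> inverse a \<in> C))"

instantiation additive :: (semifield) "{ordered_cancel_comm_monoid_add, linorder}"
begin

definition minus_additive :: "'a additive \<Rightarrow> 'a additive \<Rightarrow> 'a additive" where
  "a - b = Additive (of_additive a * inverse (of_additive b))"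

definition less_eq_additive :: "'a additive \<Rightarrow> 'a additive \<Rightarrow> bool" where
  "a \<le> b \<longleftrightarrow> of_additive b * inverse (of_additive a) \<in> chosen_cone"

definition less_additive :: "'a additive \<Rightarrow> 'a additive \<Rightarrow> bool" where
  "a < b \<longleftrightarrow> a \<le> b \<and> \<not> (b :: 'a additive) \<le> a"

instance
proof
  have C: "group_cone (chosen_cone :: 'a set)"
    "\<And>a :: 'a. a \<in> chosen_cone \<or> inverse a \<in> chosen_cone"
    using someI_ex[OF group_cone_total_exists[where 'a = 'a]] by (auto simp: chosen_cone_def)
  note simps = less_eq_additive_def plus_additive_def minus_additive_def zero_additive_def
  fix a b c :: "'a additive"
  have inv: "inverse (of_additive b * inverse (of_additive a)) =
    of_additive a * inverse (of_additive b)" for a b :: "'a additive"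
    by (simp add: semifield_inverse_mult mult.commute)
  show "a < b \<longleftrightarrow> a \<le> b \<and> \<not> b \<le> a"
    by (rule less_additive_def)
  show "a \<le> a"
    using C by (simp add: simps group_cone_def semifield_right_inverse)
  show "a \<le> c" if "a \<le> b" "b \<le> c"
  proof -
    have "(of_additive c * inverse (of_additive b)) * (of_additive b * inverse (of_additive a))
        = of_additive c * inverse (of_additive a)"
      by (metis mult.assoc mult.left_neutral semifield_left_inverse)
    with that C show ?thesis unfolding simps group_cone_def by metis
  qed
  show "a = b" if "a \<le> b" "b \<le> a"
  proof -
    have "of_additive b * inverse (of_additive a) = 1"
      using that C inv[of b a] unfolding simps group_cone_def by metis
    then have "of_additive a = of_additive b"
      by (metis semifield_inverse_unique semifield_inverse_inverse mult.commute)
    then show ?thesis by (cases a; cases b) simp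
  qed
  show "a \<le> b \<or> b \<le> a"
    using C(2) inv[of b a] unfolding simps by metis
  show "c + a \<le> c + b" if "a \<le> b"
  proof -
    have "(of_additive c * of_additive b) * inverse (of_additive c * of_additive a) =
      of_additive b * inverse (of_additive a) * (of_additive c * inverse (of_additive c))"
      by (simp add: semifield_inverse_mult mult_ac)
    with that show ?thesis by (simp add: simps semifield_right_inverse)
  qed
  show "a + b - a = b"
  proof -
    have "of_additive a * of_additive b * inverse (of_additive a) =
      of_additive b * (of_additive a * inverse (of_additive a))"
      by (simp add: mult_ac)
    then show ?thesis by (simp add: simps semifield_right_inverse)
  qed
  show "a - b - c = a - (b + c)"
    by (simp add: simps semifield_inverse_mult mult_ac)
qed

end

type_synonym 'p zp = "'p additive \<Rightarrow>\<^sub>0 int"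
type_synonym 'p qp = "'p zp fract"

definition gel :: "'p \<Rightarrow> 'p zp" where
  "gel p = frag_of (Additive p)"

definition NP :: "'p zp set" where
  "NP = {a. \<forall>p. 0 \<le> Poly_Mapping.lookup a p}"

definition \<pi>\<^sub>0 :: "'p :: semifield zp \<Rightarrow> 'p with_zero" where
  "\<pi>\<^sub>0 a = (\<Sum>p\<in>Poly_Mapping.keys a. of_nat (nat (Poly_Mapping.lookup a p)) * El (of_additive p))"

definition group_ring_on :: "'p set \<Rightarrow> 'p zp set" where
  "group_ring_on C = {a. of_additive ` Poly_Mapping.keys a \<subseteq> C}"

definition group_ring_map :: "('p \<Rightarrow> 'q) \<Rightarrow> 'p zp \<Rightarrow> 'q zp" where
  "group_ring_map h = frag_extend (\<lambda>p. gel (h (of_additive p)))"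

section \<open>The extended semifield\<close>

text \<open>Since \<^typ>\<open>'p zp\<close> is a domain, the field of rational functions over its fraction field
  is the fraction field of the polynomial ring over \<^typ>\<open>'p zp\<close>.\<close>

type_synonym ('p, 'v) zp_poly = "('v \<Rightarrow>\<^sub>0 nat) \<Rightarrow>\<^sub>0 'p zp"

definition pconst :: "'p zp \<Rightarrow> ('p, 'v) zp_poly" where
  "pconst a = Poly_Mapping.single 0 a"

definition pvar :: "'v \<Rightarrow> ('p :: semifield, 'v) zp_poly" where
  "pvar v = Poly_Mapping.single (Poly_Mapping.single v 1) 1"

definition NP_poly :: "('p, 'v) zp_poly set" where
  "NP_poly = {f. \<forall>m. Poly_Mapping.lookup f m \<in> NP}"

lemma Sum_any_nonneg: "(\<And>x. 0 \<le> f x) \<Longrightarrow> 0 \<le> (Sum_any f :: int)"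
  by (simp add: Sum_any.expand_set sum_nonneg)

lemma NP_zero: "0 \<in> NP"
  by (simp add: NP_def)

lemma NP_add: "a \<in> NP \<Longrightarrow> b \<in> NP \<Longrightarrow> a + b \<in> NP"
  by (simp add: NP_def lookup_add)

lemma NP_mult: "a \<in> NP \<Longrightarrow> b \<in> NP \<Longrightarrow> a * b \<in> (NP :: 'p :: semifield zp set)"
  by (auto simp: NP_def lookup_mult when_def intro!: Sum_any_nonneg mult_nonneg_nonneg)

lemma NP_sum: "(\<And>x. f x \<in> NP) \<Longrightarrow> sum f A \<in> NP"
  by (induction A rule: infinite_finite_induct) (simp_all add: NP_zero NP_add)

lemma NP_Sum_any: "(\<And>x. f x \<in> NP) \<Longrightarrow> Sum_any f \<in> NP"
  by (simp add: Sum_any.expand_set NP_sum)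

lemma NP_add_eq_0: "a \<in> NP \<Longrightarrow> b \<in> NP \<Longrightarrow> a + b = 0 \<Longrightarrow> a = 0"
  by (rule poly_mapping_eqI)
    (metis (mono_tags, lifting) NP_def add_nonneg_eq_0_iff lookup_add lookup_zero mem_Collect_eq)

lemma NP_poly_add: "f \<in> NP_poly \<Longrightarrow> g \<in> NP_poly \<Longrightarrow> f + g \<in> NP_poly"
  by (simp add: NP_poly_def lookup_add NP_add)

lemma NP_poly_mult:
  "f \<in> NP_poly \<Longrightarrow> g \<in> NP_poly \<Longrightarrow> f * g \<in> (NP_poly :: ('p :: semifield, 'v) zp_poly set)"
  by (auto simp: NP_poly_def lookup_mult when_def NP_zero intro!: NP_Sum_any NP_mult)

lemma NP_poly_add_eq_0: "f \<in> NP_poly \<Longrightarrow> g \<in> NP_poly \<Longrightarrow> f + g = 0 \<Longrightarrow> f = 0"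
  by (rule poly_mapping_eqI)
    (metis (mono_tags, lifting) NP_poly_def NP_add_eq_0 lookup_add lookup_zero mem_Collect_eq)

lemma one_NP_poly: "1 \<in> (NP_poly :: ('p :: semifield, 'v) zp_poly set)"
  by (auto simp: NP_poly_def NP_def lookup_one when_def)

definition NP_frac :: "('p :: semifield, 'v :: linorder) zp_poly fract set" where
  "NP_frac = {Fract f g | f g. f \<in> NP_poly - {0} \<and> g \<in> NP_poly - {0}}"

lemma NP_fracI:
  "f \<in> NP_poly \<Longrightarrow> f \<noteq> 0 \<Longrightarrow> g \<in> NP_poly \<Longrightarrow> g \<noteq> 0 \<Longrightarrow> Fract f g \<in> NP_frac"
  by (auto simp: NP_frac_def)

lemma NP_fracE:
  assumes "q \<in> NP_frac"
  obtains f g where "q = Fract f g" "f \<in> NP_poly" "f \<noteq> 0" "g \<in> NP_poly" "g \<noteq> 0"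
  using assms by (auto simp: NP_frac_def)

lemma one_NP_frac: "1 \<in> NP_frac"
  unfolding One_fract_def by (rule NP_fracI) (simp_all add: one_NP_poly)

typedef (overloaded) ('p, 'v) pbar = "NP_frac :: ('p :: semifield, 'v :: linorder) zp_poly fract set"
  using one_NP_frac by blast

setup_lifting type_definition_pbar

instantiation pbar :: (semifield, linorder) semifield
begin

lift_definition one_pbar :: "('a, 'b) pbar" is 1
  by (rule one_NP_frac)

lift_definition plus_pbar :: "('a, 'b) pbar \<Rightarrow> ('a, 'b) pbar \<Rightarrow> ('a, 'b) pbar" is "(+)"
proof (elim NP_fracE)
  fix x y :: "('a, 'b) zp_poly fract" and f g f' g'
  assume *: "x = Fract f g" "y = Fract f' g'" "f \<in> NP_poly" "f \<noteq> 0" "g \<in> NP_poly" "g \<noteq> 0"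
    "f' \<in> NP_poly" "f' \<noteq> 0" "g' \<in> NP_poly" "g' \<noteq> 0"
  have "f * g' + f' * g \<noteq> 0"
    using * NP_poly_add_eq_0[of "f * g'" "f' * g"] by (auto simp: NP_poly_mult)
  moreover have "x + y = Fract (f * g' + f' * g) (g * g')" using * by simp
  ultimately show "x + y \<in> NP_frac"
    using * by (auto intro!: NP_fracI NP_poly_add NP_poly_mult)
qed

lift_definition times_pbar :: "('a, 'b) pbar \<Rightarrow> ('a, 'b) pbar \<Rightarrow> ('a, 'b) pbar" is "(*)"
  by (elim NP_fracE) (auto intro!: NP_fracI NP_poly_mult)

lift_definition inverse_pbar :: "('a, 'b) pbar \<Rightarrow> ('a, 'b) pbar" is inverse
  by (elim NP_fracE) (auto intro!: NP_fracI)

definition divide_pbar :: "('a, 'b) pbar \<Rightarrow> ('a, 'b) pbar \<Rightarrow> ('a, 'b) pbar" where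
  "a div b = a * inverse (b :: ('a, 'b) pbar)"

instance
proof
  fix a b c :: "('a, 'b) pbar"
  show "a + b + c = a + (b + c)" by transfer (rule add.assoc)
  show "a + b = b + a" by transfer (rule add.commute)
  show "a * b * c = a * (b * c)" by transfer (rule mult.assoc)
  show "a * b = b * a" by transfer (rule mult.commute)
  show "1 * a = a" by transfer (rule mult_1_left)
  show "(a + b) * c = a * c + b * c" by transfer (rule distrib_right)
  show "inverse a * a = 1"
    by transfer (auto elim!: NP_fracE simp: One_fract_def eq_fract mult.commute)
  show "a div b = a * inverse b" by (rule divide_pbar_def)
qed

end

lift_definition pbar_of :: "'p :: semifield \<Rightarrow> ('p, 'v :: linorder) pbar" is
  "\<lambda>p. Fract (pconst (gel p)) 1"
proof (rule NP_fracI)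
  show "pconst (gel p) \<in> (NP_poly :: ('p, 'v) zp_poly set)" for p :: 'p
    by (auto simp: pconst_def gel_def NP_poly_def NP_def lookup_single when_def)
  show "pconst (gel p) \<noteq> (0 :: ('p, 'v) zp_poly)" for p :: 'p
    by (metis pconst_def gel_def frag_of_nonzero lookup_single_eq lookup_zero)
qed (simp_all add: one_NP_poly)

lift_definition svar :: "'v \<Rightarrow> ('p :: semifield, 'v :: linorder) pbar" is
  "\<lambda>v. Fract (pvar v) 1"
proof (rule NP_fracI)
  show "pvar v \<in> (NP_poly :: ('p, 'v) zp_poly set)" for v :: 'v
    by (auto simp: pvar_def NP_poly_def NP_def lookup_single lookup_one when_def)
  show "pvar v \<noteq> (0 :: ('p, 'v) zp_poly)" for v :: 'v
    by (metis pvar_def one_neq_zero lookup_single_eq lookup_zero)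
qed (simp_all add: one_NP_poly)

section \<open>Generalized cluster patterns\<close>

record ('i, 'p, 'f) seed =
  xs :: "'i \<Rightarrow> 'f"
  ys :: "'i \<Rightarrow> 'p"
  Zs :: "'i \<Rightarrow> 'p zp poly"
  Bm :: "'i \<Rightarrow> 'i \<Rightarrow> int"

text \<open>The ambient field is a field \<^typ>\<open>'f\<close> together with a ring homomorphism
  \<open>\<iota> :: 'p qp \<Rightarrow> 'f\<close>, i.e.\ a field extension of \<open>\<rat>\<P>\<close>; that it is a field of
  rational functions in \<open>CARD('i)\<close> variables is part of \<open>free_generating\<close>.\<close>

definition zp_in :: "('p :: semifield qp \<Rightarrow> 'f :: field) \<Rightarrow> 'p zp \<Rightarrow> 'f" where
  "zp_in \<iota> a = \<iota> (Fract a 1)"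

definition poly_eval ::
  "('c :: zero \<Rightarrow> 'f :: field) \<Rightarrow> ('i \<Rightarrow> 'f) \<Rightarrow> (('i \<Rightarrow>\<^sub>0 nat) \<Rightarrow>\<^sub>0 'c) \<Rightarrow> 'f" where
  "poly_eval h x P = (\<Sum>m\<in>Poly_Mapping.keys P. h (Poly_Mapping.lookup P m) *
     (\<Prod>i\<in>Poly_Mapping.keys m. x i ^ Poly_Mapping.lookup m i))"

definition free_generating :: "('p :: semifield qp \<Rightarrow> 'f :: field) \<Rightarrow> ('i \<Rightarrow> 'f) \<Rightarrow> bool" where
  "free_generating \<iota> x \<longleftrightarrow>
     (\<forall>P. poly_eval \<iota> x P = 0 \<longrightarrow> P = 0) \<and>
     (\<forall>a. \<exists>P Q. Q \<noteq> 0 \<and> a = poly_eval \<iota> x P / poly_eval \<iota> x Q)"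

definition skew_symmetrizable :: "('i \<Rightarrow> 'i \<Rightarrow> int) \<Rightarrow> bool" where
  "skew_symmetrizable B \<longleftrightarrow>
     (\<exists>d :: 'i \<Rightarrow> int. (\<forall>i. d i > 0) \<and> (\<forall>i j. d i * B i j = - (d j * B j i)))"

definition gen_seed ::
  "('p :: semifield qp \<Rightarrow> 'f :: field) \<Rightarrow> ('i \<Rightarrow> nat) \<Rightarrow> ('i, 'p, 'f) seed \<Rightarrow> bool" where
  "gen_seed \<iota> r \<Sigma> \<longleftrightarrow>
     free_generating \<iota> (xs \<Sigma>) \<and>
     (\<forall>i. Polynomial.degree (Zs \<Sigma> i) \<le> r i \<and> (\<forall>l. Polynomial.coeff (Zs \<Sigma> i) l \<in> NP) \<and>
        Polynomial.coeff (Zs \<Sigma> i) 0 = 1 \<and> Polynomial.coeff (Zs \<Sigma> i) (r i) = 1) \<and>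
     skew_symmetrizable (Bm \<Sigma>)"

definition eval_P0 :: "'p :: semifield zp poly \<Rightarrow> 'p \<Rightarrow> 'p with_zero" where
  "eval_P0 Z y = (\<Sum>l\<le>Polynomial.degree Z. \<pi>\<^sub>0 (Polynomial.coeff Z l) * El (y ^ l))"

text \<open>For an integer \<open>a\<close>, the natural number \<^term>\<open>nat a\<close> is \<open>[a]\<^sub>+\<close>.
  As \<open>Z\<^sub>k\<close> has degree \<open>r\<^sub>k\<close> and constant term \<open>1\<close>, \<^const>\<open>reflect_poly\<close> is
  \<open>u\<^sup>r Z\<^sub>k(u\<^sup>-\<^sup>1)\<close> with \<open>r = r\<^sub>k\<close>; and \<open>eval_P0 Z\<^sub>k y\<close> is nonzero.\<close>

definition gen_mutation ::
  "('p :: semifield qp \<Rightarrow> 'f :: field) \<Rightarrow> ('i :: finite \<Rightarrow> nat) \<Rightarrow> 'i \<Rightarrow>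
     ('i, 'p, 'f) seed \<Rightarrow> ('i, 'p, 'f) seed" where
  "gen_mutation \<iota> r k \<Sigma> =
     (let x = xs \<Sigma>; y = ys \<Sigma>; Z = Zs \<Sigma>; b = Bm \<Sigma>;
          yhat = zp_in \<iota> (gel (y k)) * (\<Prod>j\<in>UNIV. x j powi b j k);
          zk = un_El (eval_P0 (Z k) (y k))
      in \<lparr> xs = (\<lambda>i. if i = k
              then inverse (x k) * (\<Prod>j\<in>UNIV. x j ^ nat (- b j k)) ^ r k
                     * Polynomial.poly (map_poly (zp_in \<iota>) (Z k)) yhat / zp_in \<iota> (gel zk)
              else x i),
           ys = (\<lambda>i. if i = k then inverse (y k)
              else y i * (y k ^ nat (b k i)) ^ r k * zk powi (- b k i)),
           Zs = (\<lambda>i. if i = k then reflect_poly (Z k) else Z i),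
           Bm = (\<lambda>i j. if i = k \<or> j = k then - b i j
              else b i j + int (r k) * (b i k * max (b k j) 0 + max (- b i k) 0 * b k j)) \<rparr>)"

text \<open>The tree \<open>\<T>\<^sub>n\<close>: the Cayley graph of the free product of \<open>n\<close> copies of \<open>\<int>/2\<close>, whose
  vertices are the words without equal adjacent letters.\<close>

definition tree :: "'i list set" where
  "tree = {w. distinct_adj w}"

definition adjacent :: "'i \<Rightarrow> 'i list \<Rightarrow> 'i list \<Rightarrow> bool" where
  "adjacent k t t' \<longleftrightarrow> t \<in> tree \<and> t' \<in> tree \<and> (t' = k # t \<or> t = k # t')"

definition gen_cluster_pattern ::
  "('p :: semifield qp \<Rightarrow> 'f :: field) \<Rightarrow> ('i :: finite \<Rightarrow> nat) \<Rightarrow>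
     ('i list \<Rightarrow> ('i, 'p, 'f) seed) \<Rightarrow> bool" where
  "gen_cluster_pattern \<iota> r \<Sigma> \<longleftrightarrow>
     (\<forall>t\<in>tree. gen_seed \<iota> r (\<Sigma> t)) \<and>
     (\<forall>k t t'. adjacent k t t' \<longrightarrow> \<Sigma> t' = gen_mutation \<iota> r k (\<Sigma> t))"

abbreviation type_subring :: "'f :: field set \<Rightarrow> 'f ring" where
  "type_subring A \<equiv> ring_of_type_algebra\<lparr>carrier := A\<rparr>"

definition cluster_algebra ::
  "('p :: semifield qp \<Rightarrow> 'f :: field) \<Rightarrow> ('i list \<Rightarrow> ('i, 'p, 'f) seed) \<Rightarrow> 'f set" where
  "cluster_algebra \<iota> \<Sigma> =
     generate_ring ring_of_type_algebra (range (zp_in \<iota>) \<union> {xs (\<Sigma> t) i | t i. t \<in> tree})"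

definition ordinary_seed :: "('p :: semifield qp \<Rightarrow> 'f :: field) \<Rightarrow> ('i, 'p, 'f) seed \<Rightarrow> bool" where
  "ordinary_seed \<iota> \<Sigma> \<longleftrightarrow> gen_seed \<iota> (\<lambda>_. 1) \<Sigma> \<and> (\<forall>i. Zs \<Sigma> i = [:1, 1:])"

abbreviation mutation ::
  "('p :: semifield qp \<Rightarrow> 'f :: field) \<Rightarrow> 'i :: finite \<Rightarrow>
     ('i, 'p, 'f) seed \<Rightarrow> ('i, 'p, 'f) seed" where
  "mutation \<iota> \<equiv> gen_mutation \<iota> (\<lambda>_. 1)"

definition cluster_pattern ::
  "('p :: semifield qp \<Rightarrow> 'f :: field) \<Rightarrow> ('i :: finite list \<Rightarrow> ('i, 'p, 'f) seed) \<Rightarrow> bool" where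
  "cluster_pattern \<iota> \<Sigma> \<longleftrightarrow>
     (\<forall>t\<in>tree. ordinary_seed \<iota> (\<Sigma> t)) \<and>
     (\<forall>k t t'. adjacent k t t' \<longrightarrow> \<Sigma> t' = mutation \<iota> k (\<Sigma> t))"

section \<open>The composite pattern\<close>

text \<open>\<open>\<D>\<close> is identified with a finite index type \<^typ>\<open>'d\<close> by a bijection \<open>\<delta>\<close> from the set
  \<open>index_pairs r\<close>, so that \<open>s\<^sub>i\<^sub>l\<close> is \<^term>\<open>svar (\<delta> (i, l))\<close>. The linear order on \<^typ>\<open>'d\<close>
  is arbitrary; it only provides the integral domain instance for polynomials.\<close>

definition index_pairs :: "('n \<Rightarrow> nat) \<Rightarrow> ('n \<times> nat) set" where
  "index_pairs r = {(i, l). 1 \<le> l \<and> l \<le> r i}"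

definition composite_mutation ::
  "('p :: semifield qp \<Rightarrow> 'f :: field) \<Rightarrow> ('n \<Rightarrow> nat) \<Rightarrow> ('n \<times> nat \<Rightarrow> 'd :: finite) \<Rightarrow> 'n \<Rightarrow>
     ('d, 'p, 'f) seed \<Rightarrow> ('d, 'p, 'f) seed" where
  "composite_mutation \<iota> r \<delta> k = fold (\<lambda>l. mutation \<iota> (\<delta> (k, l))) [1..<Suc (r k)]"

definition composite_pattern ::
  "(('p :: semifield, 'd :: {finite, linorder}) pbar qp \<Rightarrow> 'g :: field) \<Rightarrow>
   ('n \<Rightarrow> nat) \<Rightarrow> ('n \<times> nat \<Rightarrow> 'd) \<Rightarrow> ('n, 'p, 'f) seed \<Rightarrow> 'n list \<Rightarrow>
   ('n list \<Rightarrow> ('d, ('p, 'd) pbar, 'g) seed) \<Rightarrow> bool" where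
  "composite_pattern \<kappa> r \<delta> \<Sigma>0 t0 \<Sigma> \<longleftrightarrow>
     ordinary_seed \<kappa> (\<Sigma> t0) \<and>
     (\<forall>(i, l)\<in>index_pairs r. ys (\<Sigma> t0) (\<delta> (i, l)) = svar (\<delta> (i, l)) * pbar_of (ys \<Sigma>0 i)) \<and>
     (\<forall>(i, l)\<in>index_pairs r. \<forall>(j, m)\<in>index_pairs r.
        Bm (\<Sigma> t0) (\<delta> (i, l)) (\<delta> (j, m)) = Bm \<Sigma>0 i j) \<and>
     (\<forall>k t t'. adjacent k t t' \<longrightarrow> \<Sigma> t' = composite_mutation \<kappa> r \<delta> k (\<Sigma> t))"

definition Xprod ::
  "('n \<Rightarrow> nat) \<Rightarrow> ('n \<times> nat \<Rightarrow> 'd) \<Rightarrow> ('d, 'q, 'g :: field) seed \<Rightarrow> 'n \<Rightarrow> 'g" where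
  "Xprod r \<delta> \<Sigma> i = (\<Prod>l\<in>{1..r i}. xs \<Sigma> (\<delta> (i, l)))"

definition elem_sym :: "nat \<Rightarrow> (nat \<Rightarrow> 'a) \<Rightarrow> nat \<Rightarrow> 'a :: comm_ring_1" where
  "elem_sym r s l = (\<Sum>A | A \<subseteq> {1..r} \<and> card A = l. \<Prod>m\<in>A. s m)"

text \<open>The addition of \<^typ>\<open>('p, 'd) pbar\<close> is that of rational functions, so \<open>e\<^sub>i\<^sub>l\<close> is an
  ordinary polynomial in the \<open>s\<^sub>i\<^sub>m\<close>. In \<open>ehat\<close>, on the contrary, the sum is that of the
  group ring, the \<open>s\<^sub>i\<^sub>m\<close> being basis elements.\<close>

definition esym ::
  "('n \<Rightarrow> nat) \<Rightarrow> ('n \<times> nat \<Rightarrow> 'd) \<Rightarrow> 'n \<Rightarrow> nat \<Rightarrow> ('p :: semifield, 'd :: linorder) zp_poly" where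
  "esym r \<delta> i l = elem_sym (r i) (\<lambda>m. pvar (\<delta> (i, m))) l"

definition ehat ::
  "('n \<Rightarrow> nat) \<Rightarrow> ('n \<times> nat \<Rightarrow> 'd) \<Rightarrow> 'n \<Rightarrow> nat \<Rightarrow> ('p :: semifield, 'd :: linorder) pbar zp" where
  "ehat r \<delta> i l = elem_sym (r i) (\<lambda>m. gel (svar (\<delta> (i, m)))) l"

inductive_set NPe ::
  "('n \<Rightarrow> nat) \<Rightarrow> ('n \<times> nat \<Rightarrow> 'd) \<Rightarrow> ('p :: semifield, 'd :: linorder) zp_poly set"
  for r \<delta> where
    const: "a \<in> NP \<Longrightarrow> pconst a \<in> NPe r \<delta>"
  | esym: "(i, l) \<in> index_pairs r \<Longrightarrow> esym r \<delta> i l \<in> NPe r \<delta>"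
  | add: "f \<in> NPe r \<delta> \<Longrightarrow> g \<in> NPe r \<delta> \<Longrightarrow> f + g \<in> NPe r \<delta>"
  | mult: "f \<in> NPe r \<delta> \<Longrightarrow> g \<in> NPe r \<delta> \<Longrightarrow> f * g \<in> NPe r \<delta>"

text \<open>In the following, \<open>Z\<close> are the exchange polynomials at the initial vertex. The
  homomorphisms chosen by \<^const>\<open>Eps\<close> are determined on their domains, as these are generated
  by the elements whose images are prescribed.\<close>

definition psi_poly ::
  "('n \<Rightarrow> nat) \<Rightarrow> ('n \<times> nat \<Rightarrow> 'd) \<Rightarrow> ('n \<Rightarrow> 'p zp poly) \<Rightarrow>
     ('p :: semifield, 'd :: linorder) zp_poly \<Rightarrow> 'p with_zero" where
  "psi_poly r \<delta> Z = (SOME \<psi>.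
     (\<forall>a\<in>NP. \<psi> (pconst a) = \<pi>\<^sub>0 a) \<and>
     (\<forall>(i, l)\<in>index_pairs r. \<psi> (esym r \<delta> i l) = \<pi>\<^sub>0 (Polynomial.coeff (Z i) l)) \<and>
     (\<forall>f\<in>NPe r \<delta>. \<forall>g\<in>NPe r \<delta>. \<psi> (f + g) = \<psi> f + \<psi> g \<and> \<psi> (f * g) = \<psi> f * \<psi> g))"

definition Ssf ::
  "('n \<Rightarrow> nat) \<Rightarrow> ('n \<times> nat \<Rightarrow> 'd) \<Rightarrow> ('n \<Rightarrow> 'p zp poly) \<Rightarrow>
     ('p :: semifield, 'd :: linorder) pbar set" where
  "Ssf r \<delta> Z = {q. \<exists>f\<in>NPe r \<delta>. \<exists>g\<in>NPe r \<delta>.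
     psi_poly r \<delta> Z f \<noteq> 0 \<and> psi_poly r \<delta> Z g \<noteq> 0 \<and> Rep_pbar q = Fract f g}"

definition psi ::
  "('n \<Rightarrow> nat) \<Rightarrow> ('n \<times> nat \<Rightarrow> 'd) \<Rightarrow> ('n \<Rightarrow> 'p zp poly) \<Rightarrow>
     ('p :: semifield, 'd :: linorder) pbar \<Rightarrow> 'p" where
  "psi r \<delta> Z q = (THE p. \<exists>f\<in>NPe r \<delta>. \<exists>g\<in>NPe r \<delta>.
     psi_poly r \<delta> Z f \<noteq> 0 \<and> psi_poly r \<delta> Z g \<noteq> 0 \<and> Rep_pbar q = Fract f g \<and>
     p = un_El (psi_poly r \<delta> Z f) / un_El (psi_poly r \<delta> Z g))"

section \<open>The algebra on which the specialization is defined\<close>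

text \<open>Here \<open>X\<close> are the elements \<open>X\<^sub>i\<close> at the initial vertex. The polynomial ring \<open>\<int>\<P>[X]\<close> and
  its fraction field are realized inside the ambient field of the composite pattern, into which
  \<open>\<P>\<close> embeds via \<^const>\<open>pbar_of\<close>.\<close>

definition ZSeX ::
  "(('p :: semifield, 'd :: linorder) pbar qp \<Rightarrow> 'g :: field) \<Rightarrow> ('n \<Rightarrow> nat) \<Rightarrow>
     ('n \<times> nat \<Rightarrow> 'd) \<Rightarrow> ('n \<Rightarrow> 'p zp poly) \<Rightarrow> ('n \<Rightarrow> 'g) \<Rightarrow> 'g set" where
  "ZSeX \<kappa> r \<delta> Z X = generate_ring ring_of_type_algebra
     (zp_in \<kappa> ` group_ring_on (Ssf r \<delta> Z) \<union>
      {zp_in \<kappa> (ehat r \<delta> i l) | i l. (i, l) \<in> index_pairs r} \<union> range X)"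

definition ZPX ::
  "(('p :: semifield, 'd :: linorder) pbar qp \<Rightarrow> 'g :: field) \<Rightarrow> ('n \<Rightarrow> 'g) \<Rightarrow> 'g set" where
  "ZPX \<kappa> X = generate_ring ring_of_type_algebra
     (zp_in \<kappa> ` group_ring_on (range pbar_of) \<union> range X)"

definition psihat_ring ::
  "(('p :: semifield, 'd :: linorder) pbar qp \<Rightarrow> 'g :: field) \<Rightarrow> ('n \<Rightarrow> nat) \<Rightarrow>
     ('n \<times> nat \<Rightarrow> 'd) \<Rightarrow> ('n \<Rightarrow> 'p zp poly) \<Rightarrow> ('n \<Rightarrow> 'g) \<Rightarrow> 'g \<Rightarrow> 'g" where
  "psihat_ring \<kappa> r \<delta> Z X = (SOME h.
     h \<in> ring_hom (type_subring (ZSeX \<kappa> r \<delta> Z X)) (type_subring (ZPX \<kappa> X)) \<and>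
     (\<forall>q\<in>Ssf r \<delta> Z. h (zp_in \<kappa> (gel q)) = zp_in \<kappa> (gel (pbar_of (psi r \<delta> Z q)))) \<and>
     (\<forall>(i, l)\<in>index_pairs r. h (zp_in \<kappa> (ehat r \<delta> i l)) =
        zp_in \<kappa> (group_ring_map pbar_of (Polynomial.coeff (Z i) l))) \<and>
     (\<forall>i. h (X i) = X i))"

definition Scal ::
  "(('p :: semifield, 'd :: linorder) pbar qp \<Rightarrow> 'g :: field) \<Rightarrow> ('n \<Rightarrow> nat) \<Rightarrow>
     ('n \<times> nat \<Rightarrow> 'd) \<Rightarrow> ('n \<Rightarrow> 'p zp poly) \<Rightarrow> ('n \<Rightarrow> 'g) \<Rightarrow> 'g set" where
  "Scal \<kappa> r \<delta> Z X = {f / g | f g. f \<in> ZSeX \<kappa> r \<delta> Z X \<and> g \<in> ZSeX \<kappa> r \<delta> Z X \<and>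
     psihat_ring \<kappa> r \<delta> Z X g \<noteq> 0}"

definition psihat ::
  "(('p :: semifield, 'd :: linorder) pbar qp \<Rightarrow> 'g :: field) \<Rightarrow> ('n \<Rightarrow> nat) \<Rightarrow>
     ('n \<times> nat \<Rightarrow> 'd) \<Rightarrow> ('n \<Rightarrow> 'p zp poly) \<Rightarrow> ('n \<Rightarrow> 'g) \<Rightarrow> 'g \<Rightarrow> 'g" where
  "psihat \<kappa> r \<delta> Z X a = (THE b. \<exists>f\<in>ZSeX \<kappa> r \<delta> Z X. \<exists>g\<in>ZSeX \<kappa> r \<delta> Z X.
     psihat_ring \<kappa> r \<delta> Z X g \<noteq> 0 \<and> a = f / g \<and>
     b = psihat_ring \<kappa> r \<delta> Z X f / psihat_ring \<kappa> r \<delta> Z X g)"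

definition Acomp ::
  "(('p :: semifield, 'd :: linorder) pbar qp \<Rightarrow> 'g :: field) \<Rightarrow> ('n \<Rightarrow> nat) \<Rightarrow>
     ('n \<times> nat \<Rightarrow> 'd) \<Rightarrow> ('n \<Rightarrow> 'p zp poly) \<Rightarrow>
     ('n list \<Rightarrow> ('d, ('p, 'd) pbar, 'g) seed) \<Rightarrow> 'g set" where
  "Acomp \<kappa> r \<delta> Z \<Sigma> = generate_ring ring_of_type_algebra
     (zp_in \<kappa> ` group_ring_on (Ssf r \<delta> Z) \<union> {Xprod r \<delta> (\<Sigma> t) i | t i. t \<in> tree})"

definition Iker ::
  "(('p :: semifield, 'd :: linorder) pbar qp \<Rightarrow> 'g :: field) \<Rightarrow> ('n \<Rightarrow> nat) \<Rightarrow>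
     ('n \<times> nat \<Rightarrow> 'd) \<Rightarrow> ('n \<Rightarrow> 'p zp poly) \<Rightarrow> 'n list \<Rightarrow>
     ('n list \<Rightarrow> ('d, ('p, 'd) pbar, 'g) seed) \<Rightarrow> 'g set" where
  "Iker \<kappa> r \<delta> Z t0 \<Sigma> =
     a_kernel (type_subring (Scal \<kappa> r \<delta> Z (Xprod r \<delta> (\<Sigma> t0)))) ring_of_type_algebra
       (psihat \<kappa> r \<delta> Z (Xprod r \<delta> (\<Sigma> t0))) \<inter> Acomp \<kappa> r \<delta> Z \<Sigma>"

end

theory Submission
  imports Defs
begin

text \<open>
  The exchange relation of the composite pattern in the block \<open>k\<close> multiplies out to one containing
  \<open>\<Prod>\<^sub>l (1 + s\<^sub>k\<^sub>l u)\<close>, whose coefficients are the elementary symmetric polynomials in the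
  \<open>s\<^sub>k\<^sub>l\<close>. Sending these to the coefficients of \<open>Z\<^sub>k\<close> turns it into the generalized exchange
  relation, so by induction along the tree the specialization maps \<open>X\<^sub>i\<^sub>;\<^sub>t\<close> to \<open>x\<^sup>g\<^sub>i\<^sub>;\<^sub>t\<close>
  (up to an embedding of the ambient fields), and the first isomorphism theorem applies.

  That the two specializations exist is shown by choosing actual roots. Over an algebraically closed
  field the elementary symmetric polynomials take arbitrary values, hence are algebraically
  independent, which yields \<open>\<psi>\<close>. For the homomorphism on the group ring, factor
  \<open>Z\<^sub>i(u) = \<Prod>\<^sub>l (1 + \<rho>\<^sub>i\<^sub>l u)\<close> over an algebraic closure; \<open>\<psi>\<close> and
  \<open>s\<^sub>i\<^sub>l \<mapsto> \<rho>\<^sub>i\<^sub>l\<close> are compatible, so they define a character on a subgroup of the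
  extended semifield, which extends to the whole group because the multiplicative group of an
  algebraically closed field is divisible.
\<close>

section \<open>Evaluation of formal sums\<close>

text \<open>The homomorphisms in the statement are introduced by choice and description operators on
  rings given by generators, so nothing is known about them until a candidate is exhibited.
  Prescribing values on generators does not suffice, because the relations among ZS, the
  \<open>ehat\<close> and the X are not known explicitly. The way out is to define maps on larger
  objects with no relations to check: a character of the whole group \<open>pbar\<close> extends
  linearly to its group ring and then, the cluster variables being free, to polynomials in them. It
  takes values in an algebraic closure, but on the generators that matter they lie in the base
  field, and the ring operations preserve this. Compatibility of the roots with \<psi> rests on the
  leading coefficients of the Z being 1: the top elementary symmetric polynomial of each block is
  sent to 1 both by \<psi> and by the roots. A single s need not lie in the domain of \<psi>, so
  coefficients can be compared only after splitting off their s-factor or multiplying over a block.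
  As a mutation inverts the s of its block, the induction also has to carry a parity and the
  reversed exchange polynomials.\<close>

definition pm_eval :: "('b::zero \<Rightarrow> 'c) \<Rightarrow> ('k \<Rightarrow> 'c) \<Rightarrow> ('k \<Rightarrow>\<^sub>0 'b) \<Rightarrow> 'c :: comm_semiring_1" where
  "pm_eval h \<chi> P = (\<Sum>m\<in>Poly_Mapping.keys P. h (Poly_Mapping.lookup P m) * \<chi> m)"

text \<open>A notion for semirings, since the values may lie in a semifield with zero, where
  negatives do not exist.\<close>

definition semiring_map :: "('a::comm_semiring_1 \<Rightarrow> 'b::comm_semiring_1) \<Rightarrow> bool" where
  "semiring_map h \<longleftrightarrow> h 0 = 0 \<and> h 1 = 1 \<and> (\<forall>a b. h (a + b) = h a + h b) \<and> (\<forall>a b. h (a * b) = h a * h b)"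

definition monoid_map :: "('a::comm_monoid_add \<Rightarrow> 'b::comm_semiring_1) \<Rightarrow> bool" where
  "monoid_map \<chi> \<longleftrightarrow> \<chi> 0 = 1 \<and> (\<forall>a b. \<chi> (a + b) = \<chi> a * \<chi> b)"

lemma semiring_mapD:
  assumes "semiring_map h"
  shows "h 0 = 0" "h 1 = 1" "h (a + b) = h a + h b" "h (a * b) = h a * h b"
  using assms by (auto simp: semiring_map_def)

lemma semiring_map_sum: "semiring_map h \<Longrightarrow> h (sum f A) = (\<Sum>a\<in>A. h (f a))"
  by (induction A rule: infinite_finite_induct) (auto simp: semiring_map_def)

lemma semiring_map_prod: "semiring_map h \<Longrightarrow> h (prod f A) = (\<Prod>a\<in>A. h (f a))"
  by (induction A rule: infinite_finite_induct) (auto simp: semiring_map_def)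

lemma semiring_map_power: "semiring_map h \<Longrightarrow> h (a ^ n) = h a ^ n"
  by (induction n) (auto simp: semiring_map_def)

lemma semiring_map_uminus:
  fixes h :: "'a::comm_ring_1 \<Rightarrow> 'b::comm_ring_1"
  shows "semiring_map h \<Longrightarrow> h (- a) = - h a"
  using semiring_mapD(1)[of h] semiring_mapD(3)[of h a "- a"] by (simp add: add_eq_0_iff)

lemma semiring_map_diff:
  fixes h :: "'a::comm_ring_1 \<Rightarrow> 'b::comm_ring_1"
  shows "semiring_map h \<Longrightarrow> h (a - b) = h a - h b"
  by (simp only: diff_conv_add_uminus semiring_mapD semiring_map_uminus)

lemma semiring_map_inj:
  fixes h :: "'a::comm_ring_1 \<Rightarrow> 'b::comm_ring_1"
  assumes "semiring_map h" "\<And>a. h a = 0 \<Longrightarrow> a = 0" "h a = h b"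
  shows "a = b"
  using assms by (metis semiring_map_diff right_minus_eq)

lemma semiring_map_comp: "semiring_map g \<Longrightarrow> semiring_map h \<Longrightarrow> semiring_map (\<lambda>a. g (h a))"
  by (simp add: semiring_map_def)

lemma semiring_map_of_nat: "semiring_map (of_nat :: nat \<Rightarrow> 'a::comm_semiring_1)"
  by (simp add: semiring_map_def)

lemma semiring_map_of_int: "semiring_map (of_int :: int \<Rightarrow> 'a::comm_ring_1)"
  by (simp add: semiring_map_def)

lemma semiring_map_int:
  fixes h :: "'a::comm_ring_1 \<Rightarrow> 'b::comm_ring_1"
  assumes h: "semiring_map h" shows "h (of_int n) = of_int n"
  by (induction n rule: int_induct[of _ 0]) (simp_all add: semiring_mapD[OF h] semiring_map_diff[OF h])

lemma semiring_map_field_eq_0: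
  fixes h :: "'a::field \<Rightarrow> 'b::field"
  assumes h: "semiring_map h" shows "h a = 0 \<longleftrightarrow> a = 0"
proof
  assume "h a = 0"
  show "a = 0"
  proof (rule ccontr)
    assume "a \<noteq> 0"
    then have "h (a * inverse a) = 1" using h by (simp add: semiring_mapD)
    with \<open>h a = 0\<close> h show False by (simp add: semiring_mapD)
  qed
qed (use h in \<open>simp add: semiring_mapD\<close>)

lemma semiring_map_inverse:
  fixes h :: "'a::field \<Rightarrow> 'b::field"
  assumes h: "semiring_map h" shows "h (inverse a) = inverse (h a)"
proof (cases "a = 0")
  case False
  then have "h a * h (inverse a) = 1"
    using h by (metis semiring_mapD(2) semiring_mapD(4) right_inverse)
  then show ?thesis by (metis inverse_unique)
qed (use h in \<open>simp add: semiring_mapD\<close>)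

lemma semiring_map_divide:
  fixes h :: "'a::field \<Rightarrow> 'b::field"
  assumes h: "semiring_map h" shows "h (a / b) = h a / h b"
  using h by (simp add: divide_inverse semiring_mapD semiring_map_inverse)

lemma semiring_map_power_int:
  fixes h :: "'a::field \<Rightarrow> 'b::field"
  assumes h: "semiring_map h" shows "h (a powi n) = h a powi n"
  using h by (simp add: power_int_def semiring_map_power semiring_map_inverse)

lemma ring_hom_type_algebra_iff:
  "h \<in> ring_hom ring_of_type_algebra ring_of_type_algebra \<longleftrightarrow>
     (\<forall>a b. h (a + b) = h a + h b) \<and> (\<forall>a b. h (a * b) = h a * h b) \<and> h 1 = 1"
  by (auto simp: ring_hom_def ring_of_type_algebra_def)

lemma ring_hom_type_algebraD:
  fixes h :: "'a::comm_ring_1 \<Rightarrow> 'b::comm_ring_1"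
  assumes "h \<in> ring_hom ring_of_type_algebra ring_of_type_algebra"
  shows "semiring_map h"
proof -
  have "h 0 + h 0 = h (0 + 0)" using assms unfolding ring_hom_type_algebra_iff by metis
  then have "h 0 = 0" by simp
  with assms show ?thesis unfolding ring_hom_type_algebra_iff semiring_map_def by blast
qed

lemma pm_eval_superset:
  assumes "h 0 = 0" "finite A" "Poly_Mapping.keys P \<subseteq> A"
  shows "pm_eval h \<chi> P = (\<Sum>m\<in>A. h (Poly_Mapping.lookup P m) * \<chi> m)"
  unfolding pm_eval_def
  by (rule sum.mono_neutral_left) (use assms in \<open>auto simp: in_keys_iff\<close>)

lemma pm_eval_add:
  assumes "h 0 = 0" "\<And>a b. h (a + b) = h a + h b"
  shows "pm_eval h \<chi> (P + Q) = pm_eval h \<chi> P + pm_eval h \<chi> Q"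
proof -
  let ?A = "Poly_Mapping.keys P \<union> Poly_Mapping.keys Q"
  have "pm_eval h \<chi> R = (\<Sum>m\<in>?A. h (Poly_Mapping.lookup R m) * \<chi> m)"
    if "R \<in> {P, Q, P + Q}" for R
    using that keys_add[of P Q] by (intro pm_eval_superset) (auto simp: assms)
  then show ?thesis
    by (simp add: lookup_add assms distrib_right sum.distrib)
qed

lemma pm_eval_0 [simp]: "pm_eval h \<chi> 0 = 0"
  by (simp add: pm_eval_def)

lemma pm_eval_single: "h 0 = 0 \<Longrightarrow> pm_eval h \<chi> (Poly_Mapping.single m a) = h a * \<chi> m"
  by (cases "a = 0") (simp_all add: pm_eval_def)

text \<open>A finite formal sum is the sum of its terms, so biadditive identities such as
  multiplicativity of an evaluation reduce to single terms.\<close>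

lemma poly_mapping_add_induct:
  assumes "\<And>m a. Q (Poly_Mapping.single m a)" "\<And>f g. Q f \<Longrightarrow> Q g \<Longrightarrow> Q (f + g)"
  shows "Q (f :: 'a \<Rightarrow>\<^sub>0 'b::comm_monoid_add)"
proof -
  have "f = (\<Sum>m\<in>Poly_Mapping.keys f. Poly_Mapping.single m (Poly_Mapping.lookup f m))"
    by (rule poly_mapping_eqI) (auto simp: lookup_sum lookup_single when_def sum.delta in_keys_iff)
  moreover have "Q 0" using assms(1)[of _ 0] by simp
  then have "Q (\<Sum>m\<in>A. Poly_Mapping.single m (Poly_Mapping.lookup f m))" for A
    by (induction A rule: infinite_finite_induct) (auto intro: assms)
  ultimately show ?thesis by metis
qed

lemma pm_eval_mult:
  assumes h: "semiring_map h" and \<chi>: "monoid_map \<chi>"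
  shows "pm_eval h \<chi> (P * Q) = pm_eval h \<chi> P * pm_eval h \<chi> Q"
proof -
  note a = pm_eval_add[OF semiring_mapD(1,3)[OF h]]
  note s = pm_eval_single[of h, OF semiring_mapD(1)[OF h]]
  show ?thesis
  proof (induction P rule: poly_mapping_add_induct)
    case (1 m b)
    show ?case
    proof (induction Q rule: poly_mapping_add_induct)
      case (1 n c)
      show ?case using h \<chi> by (simp add: mult_single s semiring_map_def monoid_map_def mult_ac)
    next
      case (2 f g)
      then show ?case by (simp add: distrib_left a)
    qed
  next
    case (2 f g)
    then show ?case by (simp add: distrib_right a)
  qed
qed

lemma semiring_map_pm_eval:
  assumes h: "semiring_map h" and \<chi>: "monoid_map \<chi>"
  shows "semiring_map (pm_eval h \<chi>)"
proof -
  have "pm_eval h \<chi> 1 = 1"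
    using pm_eval_single[of h \<chi> 0 1] h \<chi> by (simp add: semiring_map_def monoid_map_def)
  then show ?thesis
    using pm_eval_mult[OF h \<chi>] pm_eval_add[of h \<chi>, OF semiring_mapD(1,3)[OF h]]
    unfolding semiring_map_def by simp
qed

lemma semiring_map_comp_pm_eval:
  "semiring_map g \<Longrightarrow> g (pm_eval h \<chi> P) = pm_eval (\<lambda>a. g (h a)) (\<lambda>m. g (\<chi> m)) P"
  by (simp add: pm_eval_def semiring_map_sum semiring_mapD)

definition monomial_eval :: "('i \<Rightarrow> 'c) \<Rightarrow> ('i \<Rightarrow>\<^sub>0 nat) \<Rightarrow> 'c :: comm_semiring_1" where
  "monomial_eval x m = (\<Prod>i\<in>Poly_Mapping.keys m. x i ^ Poly_Mapping.lookup m i)"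

lemma poly_eval_eq_pm_eval: "poly_eval h x = pm_eval h (monomial_eval x)"
  by (simp add: fun_eq_iff poly_eval_def pm_eval_def monomial_eval_def)

lemma monomial_eval_finite:
  "monomial_eval x m = (\<Prod>i\<in>UNIV. x i ^ Poly_Mapping.lookup m i)" for x :: "'i::finite \<Rightarrow> _"
  unfolding monomial_eval_def by (rule prod.mono_neutral_left) (auto simp: in_keys_iff)

lemma monoid_map_monomial_eval: "monoid_map (monomial_eval (x :: 'i::finite \<Rightarrow> _))"
  by (simp add: monoid_map_def monomial_eval_finite lookup_add power_add prod.distrib)

lemma monomial_eval_single [simp]:
  "monomial_eval x (Poly_Mapping.single i n) = x i ^ n"
  by (cases "n = 0") (simp_all add: monomial_eval_def)

lemma semiring_map_monomial_eval:
  "semiring_map g \<Longrightarrow> g (monomial_eval x m) = monomial_eval (\<lambda>i. g (x i)) m"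
  by (simp add: monomial_eval_def semiring_map_prod semiring_map_power)

lemma monomial_eval_eq_0:
  fixes x :: "'i::finite \<Rightarrow> 'k::field"
  shows "\<forall>i. x i \<noteq> 0 \<Longrightarrow> monomial_eval x m \<noteq> 0"
  by (simp add: monomial_eval_finite)

text \<open>Dedekind's argument for the independence of characters.\<close>

lemma monomials_independent:
  fixes t :: "'k::field" and a :: "('i::finite \<Rightarrow>\<^sub>0 nat) \<Rightarrow> 'k"
  assumes t: "t \<noteq> 0" "\<And>m n :: nat. t ^ m = t ^ n \<Longrightarrow> m = n"
  shows "finite M \<Longrightarrow> (\<And>x. \<forall>i. x i \<noteq> 0 \<Longrightarrow> (\<Sum>m\<in>M. a m * monomial_eval x m) = 0) \<Longrightarrow>
    m \<in> M \<Longrightarrow> a m = 0"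
proof (induction M arbitrary: a m rule: finite_induct)
  case empty
  then show ?case by simp
next
  case (insert n M)
  have zero: "a m = 0" if "m \<in> M" for m
  proof -
    have "m \<noteq> n" using that insert.hyps by auto
    then obtain i where i: "Poly_Mapping.lookup m i \<noteq> Poly_Mapping.lookup n i"
      by (metis poly_mapping_eqI)
    \<comment> \<open>At \<open>y\<close> the monomial \<open>k\<close> takes the value
      \<open>t\<close> to the power of its exponent at \<open>i\<close>, which separates
      \<open>m\<close> from \<open>n\<close>.\<close>
    define y where "y = (\<lambda>j. if j = i then t else 1)"
    have y: "\<forall>i. y i \<noteq> 0" using t by (simp add: y_def)
    have ev: "monomial_eval y k = t ^ Poly_Mapping.lookup k i" for k
      by (simp add: monomial_eval_finite y_def if_distrib[of "\<lambda>u. u ^ _"] prod.delta cong: if_cong)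
    \<comment> \<open>Subtracting \<open>monomial_eval y n\<close> times the relation at
      \<open>x\<close> from the relation at the pointwise product of \<open>x\<close> and
      \<open>y\<close> kills the term of \<open>n\<close>. What is left is a relation on
      \<open>M\<close>.\<close>
    have "a m * (monomial_eval y m - monomial_eval y n) = 0"
    proof (rule insert.IH[where a = "\<lambda>k. a k * (monomial_eval y k - monomial_eval y n)"])
      fix x :: "'i \<Rightarrow> 'k" assume x: "\<forall>i. x i \<noteq> 0"
      have xy: "monomial_eval (\<lambda>i. x i * y i) k = monomial_eval x k * monomial_eval y k" for k
        by (simp add: monomial_eval_finite power_mult_distrib prod.distrib)
      have "(\<Sum>k\<in>insert n M. a k * monomial_eval (\<lambda>i. x i * y i) k) = 0"
        using x y by (intro insert.prems) auto
      moreover have "(\<Sum>k\<in>insert n M. a k * monomial_eval x k * monomial_eval y n) = 0"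
        using insert.prems(1)[OF x] by (simp only: mult_zero_left flip: sum_distrib_right)
      ultimately have "(\<Sum>k\<in>insert n M. a k * (monomial_eval y k - monomial_eval y n) * monomial_eval x k) = 0"
        by (simp only: xy sum_distrib_right right_diff_distrib left_diff_distrib sum_subtractf mult_ac diff_0_right)
      then show "(\<Sum>k\<in>M. a k * (monomial_eval y k - monomial_eval y n) * monomial_eval x k) = 0"
        using insert.hyps by simp
    qed (use that in simp)
    then show ?thesis using ev i t by auto
  qed
  have "(\<Sum>k\<in>insert n M. a k * monomial_eval (\<lambda>_. 1) k) = 0"
    by (intro insert.prems) auto
  then have "a n = 0"
    using insert.hyps zero by (simp add: monomial_eval_finite)
  with zero insert.prems(2) show ?case by auto
qed

section \<open>Elementary symmetric polynomials\<close>

text \<open>Expand the product over subsets of \<open>{1..r}\<close> and group them by cardinality.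
  The homogeneous form in \<open>u\<close> and \<open>v\<close> gives the numerator that appears
  when a fraction is substituted into \<Prod>(1 + s u) and denominators are cleared.\<close>

lemma prod_add_elem_sym:
  fixes s :: "nat \<Rightarrow> 'a::comm_ring_1"
  shows "(\<Prod>l\<in>{1..r}. v + s l * u) = (\<Sum>l\<le>r. elem_sym r s l * u ^ l * v ^ (r - l))"
proof -
  have "(\<Prod>l\<in>{1..r}. v + s l * u) = (\<Sum>A\<in>Pow {1..r}. (\<Prod>l\<in>A. s l * u) * (\<Prod>l\<in>{1..r} - A. v))"
    by (subst add.commute, subst prod_add) simp_all
  also have "\<dots> = (\<Sum>A\<in>Pow {1..r}. (\<Prod>l\<in>A. s l) * u ^ card A * v ^ (r - card A))"
    by (intro sum.cong) (auto simp: prod.distrib card_Diff_subset finite_subset)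
  also have "\<dots> = (\<Sum>l\<in>{..r}. \<Sum>A\<in>{A\<in>Pow {1..r}. card A = l}. (\<Prod>l\<in>A. s l) * u ^ card A * v ^ (r - card A))"
    by (intro sum.group[symmetric]) (auto intro: card_mono[of "{1..r}", simplified])
  also have "\<dots> = (\<Sum>l\<le>r. elem_sym r s l * u ^ l * v ^ (r - l))"
    by (intro sum.cong) (auto simp: elem_sym_def sum_distrib_right intro!: sum.cong)
  finally show ?thesis .
qed

corollary prod_1_add_elem_sym:
  fixes s :: "nat \<Rightarrow> 'a::comm_ring_1"
  shows "(\<Prod>l\<in>{1..r}. 1 + s l * u) = (\<Sum>l\<le>r. elem_sym r s l * u ^ l)"
  using prod_add_elem_sym[of 1 s u r] by simp

lemma semiring_map_elem_sym:
  "semiring_map h \<Longrightarrow> h (elem_sym r s l) = elem_sym r (\<lambda>m. h (s m)) l"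
  by (simp add: elem_sym_def semiring_map_sum semiring_map_prod)

text \<open>Vieta's formulas for a product normalized by its constant term: the generating function
  is applied inside the polynomial ring, with the indeterminate for \<open>u\<close>.\<close>

lemma coeff_prod_elem_sym:
  fixes s :: "nat \<Rightarrow> 'a::comm_ring_1"
  assumes "l \<le> r"
  shows "Polynomial.coeff (\<Prod>l\<in>{1..r}. [:1, s l:]) l = elem_sym r s l"
proof -
  have "(\<Prod>l\<in>{1..r}. [:1, s l:]) = (\<Prod>l\<in>{1..r}. 1 + [:s l:] * [:0, 1:])"
    by (simp add: one_pCons)
  also have "\<dots> = (\<Sum>l\<le>r. elem_sym r (\<lambda>l. [:s l:]) l * [:0, 1:] ^ l)"
    by (rule prod_1_add_elem_sym)
  also have "\<dots> = (\<Sum>l\<le>r. Polynomial.monom (elem_sym r s l) l)"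
  proof (rule sum.cong[OF refl])
    fix l
    have "elem_sym r (\<lambda>l. [:s l:]) l = [:elem_sym r s l:]"
      using semiring_map_elem_sym[of "\<lambda>a. [:a:]" r s l] by (simp add: semiring_map_def one_pCons mult_ac)
    then show "elem_sym r (\<lambda>l. [:s l:]) l * [:0, 1:] ^ l = Polynomial.monom (elem_sym r s l) l"
      by (simp add: monom_altdef)
  qed
  finally show ?thesis using assms by (simp add: coeff_sum)
qed

lemma elem_sym_0 [simp]: "elem_sym r s 0 = 1"
proof -
  have "{A. A \<subseteq> {1..r} \<and> card A = 0} = {{}}"
    by (auto dest: finite_subset)
  then show ?thesis by (simp add: elem_sym_def)
qed

lemma elem_sym_top: "elem_sym r s r = (\<Prod>l\<in>{1..r}. s l)"
proof -
  have "{A. A \<subseteq> {1..r} \<and> card A = r} = {{1..r}}"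
    using card_subset_eq[of "{1..r}"] by auto
  then show ?thesis by (simp add: elem_sym_def)
qed

text \<open>Reordering the factors leaves \<Prod>(1 + s u) unchanged, hence also its coefficients;
  beyond degree \<open>r\<close> both sums are empty.\<close>

lemma elem_sym_permute:
  assumes "bij_betw \<tau> {1..r} {1..r}"
  shows "elem_sym r (\<lambda>m. s (\<tau> m)) l = elem_sym r s l"
proof (cases "l \<le> r")
  case True
  have "(\<Prod>l\<in>{1..r}. [:1, s (\<tau> l):]) = (\<Prod>l\<in>{1..r}. [:1, s l:])"
    by (rule prod.reindex_bij_betw[OF assms])
  then show ?thesis using coeff_prod_elem_sym[OF True] by metis
next
  case False
  then have "{A. A \<subseteq> {1..r} \<and> card A = l} = {}"
    by (auto dest: card_mono[rotated])
  then show ?thesis unfolding elem_sym_def by (simp only: sum.empty)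
qed

text \<open>Normalizing the constant term rather than the leading coefficient lets the degree fall
  below \<open>r\<close>: each missing factor is the trivial one with \<open>\<rho> l = 0\<close>.
  Roots are nonzero because the constant term is 1.\<close>

lemma poly_splits_at_zero:
  fixes p :: "'k::alg_closed_field poly"
  assumes "Polynomial.coeff p 0 = 1" "Polynomial.degree p \<le> r"
  shows "\<exists>\<rho>. p = (\<Prod>l\<in>{1..r}. [:1, \<rho> l:])"
  using assms
proof (induction r arbitrary: p)
  case 0
  then show ?case by (auto simp: one_pCons elim!: degree_eq_zeroE)
next
  case (Suc r)
  show ?case
  proof (cases "Polynomial.degree p = 0")
    case True
    then have "p = 1"
      using Suc.prems by (auto simp: one_pCons elim!: degree_eq_zeroE)
    then have "p = (\<Prod>l\<in>{1..Suc r}. [:1, 0:])"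
      by (simp add: one_pCons[symmetric])
    then show ?thesis by (intro exI[of _ "\<lambda>_. 0"])
  next
    case False
    then obtain a where a: "poly p a = 0" using alg_closed_imp_poly_has_root[of p] by auto
    have "a \<noteq> 0" using a Suc.prems by (auto simp: poly_0_coeff_0)
    obtain q where q: "p = [:-a, 1:] * q" using a by (metis poly_eq_0_iff_dvd dvdE)
    \<comment> \<open>Rescaling replaces the factor u - a by 1 - u/a, so that the cofactor has
      constant term 1 again and the induction hypothesis applies.\<close>
    define q' where "q' = Polynomial.smult (-a) q"
    have pq: "p = [:1, - inverse a:] * q'"
      unfolding q q'_def using \<open>a \<noteq> 0\<close> by (simp add: smult_add_right)
    have "Polynomial.coeff q' 0 = 1" using Suc.prems(1) unfolding pq by (simp add: coeff_mult)
    moreover have "Polynomial.degree q' \<le> r"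
    proof -
      have "q' \<noteq> 0" using calculation by auto
      then have "Polynomial.degree p = 1 + Polynomial.degree q'"
        unfolding pq using \<open>a \<noteq> 0\<close> by (subst degree_mult_eq) auto
      with Suc.prems show ?thesis by simp
    qed
    ultimately obtain \<rho> where \<rho>: "q' = (\<Prod>l\<in>{1..r}. [:1, \<rho> l:])" using Suc.IH by blast
    have "p = (\<Prod>l\<in>{1..Suc r}. [:1, (\<rho>(Suc r := - inverse a)) l:])"
      unfolding pq \<rho> by (simp add: prod.cl_ivl_Suc mult.commute)
    then show ?thesis by blast
  qed
qed

text \<open>Split the polynomial with constant term 1 and further coefficients \<open>c\<close>.
  Only the degree 0 coefficient is forced.\<close>

lemma elem_sym_surj:
  fixes c :: "nat \<Rightarrow> 'k::alg_closed_field"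
  shows "\<exists>\<sigma>. \<forall>l\<in>{1..r}. elem_sym r \<sigma> l = c l"
proof -
  define p where "p = Poly (map (\<lambda>l. if l = 0 then 1 else c l) [0..<Suc r])"
  have cf: "Polynomial.coeff p l = (if l = 0 then 1 else if l \<le> r then c l else 0)" for l
    unfolding p_def by (simp add: nth_default_def del: upt_Suc)
  have "Polynomial.degree p \<le> r" by (rule degree_le) (simp add: cf)
  then obtain \<rho> where "p = (\<Prod>l\<in>{1..r}. [:1, \<rho> l:])" using poly_splits_at_zero[of p r] cf by auto
  then have "elem_sym r \<rho> l = c l" if "l \<in> {1..r}" for l
    using coeff_prod_elem_sym[of l r \<rho>] cf[of l] that by simp
  then show ?thesis by blast
qed

section \<open>The homomorphism on polynomials in the elementary symmetric polynomials\<close>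

definition nat_embed :: "('a::comm_monoid_add \<Rightarrow>\<^sub>0 nat) \<Rightarrow> ('a \<Rightarrow>\<^sub>0 int)" where
  "nat_embed = pm_eval of_nat frag_of"

lemma semiring_map_nat_embed: "semiring_map nat_embed"
  unfolding nat_embed_def
  by (rule semiring_map_pm_eval[OF semiring_map_of_nat])
    (simp add: monoid_map_def mult_single single_one)

lemma lookup_nat_embed: "Poly_Mapping.lookup (nat_embed P) k = int (Poly_Mapping.lookup P k)"
proof -
  have "of_nat n * frag_of m = Poly_Mapping.single m (int n)" for n and m :: 'a
    by (simp add: mult_single flip: single_of_nat)
  then show ?thesis
    by (auto simp: nat_embed_def pm_eval_def lookup_sum lookup_single when_def sum.delta in_keys_iff)
qed

lemma nat_embed_inject: "nat_embed P = nat_embed Q \<Longrightarrow> P = Q"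
  by (metis lookup_nat_embed of_nat_eq_iff poly_mapping_eqI)

lemma NP_iff_nat_embed: "a \<in> NP \<longleftrightarrow> a \<in> range nat_embed"
proof
  assume a: "a \<in> NP"
  have "a = nat_embed (Poly_Mapping.map nat a)"
    using a by (intro poly_mapping_eqI) (auto simp: lookup_nat_embed NP_def map.rep_eq when_def)
  then show "a \<in> range nat_embed" by blast
qed (auto simp: NP_def lookup_nat_embed)

text \<open>\<open>\<pi>\<^sub>0\<close> cuts off negative coefficients by \<open>nat\<close> and so
  is not additive on all of \<open>zp\<close>; read on natural coefficients it is a total semiring
  homomorphism.\<close>

definition nat_pi :: "('p::semifield additive \<Rightarrow>\<^sub>0 nat) \<Rightarrow> 'p with_zero" where
  "nat_pi = pm_eval of_nat (\<lambda>a. El (of_additive a))"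

lemma semiring_map_nat_pi: "semiring_map nat_pi"
  unfolding nat_pi_def
  by (rule semiring_map_pm_eval[OF semiring_map_of_nat])
    (simp add: monoid_map_def zero_additive_def plus_additive_def one_with_zero_def)

lemma pi0_nat_embed: "\<pi>\<^sub>0 (nat_embed P) = nat_pi P"
proof -
  have "Poly_Mapping.keys (nat_embed P) = Poly_Mapping.keys P"
    by (auto simp: in_keys_iff lookup_nat_embed)
  then show ?thesis by (simp add: \<pi>\<^sub>0_def nat_pi_def pm_eval_def lookup_nat_embed)
qed

lemma pi0_0 [simp]: "\<pi>\<^sub>0 0 = 0"
  by (simp add: \<pi>\<^sub>0_def)

lemma pi0_1 [simp]: "\<pi>\<^sub>0 1 = 1"
  by (metis pi0_nat_embed semiring_mapD(2) semiring_map_nat_embed semiring_map_nat_pi)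

lemma pi0_gel [simp]: "\<pi>\<^sub>0 (gel p) = El p"
  by (simp add: \<pi>\<^sub>0_def gel_def)

lemma El_eq_0 [simp]: "El p \<noteq> 0" "0 \<noteq> El p"
  by (simp_all add: zero_with_zero_def)

lemma El_1: "El 1 = 1"
  by (simp add: one_with_zero_def)

lemma El_power: "El (p ^ n) = El p ^ n"
  by (induction n) (simp_all add: El_1 flip: times_with_zero.simps(3))

lemma El_un_El: "a \<noteq> 0 \<Longrightarrow> El (un_El a) = a"
  by (cases a) (simp_all add: zero_with_zero_def)

lemma with_zero_mult_eq_0: "a * b = 0 \<longleftrightarrow> a = 0 \<or> b = (0 :: 'a::semifield with_zero)"
  by (cases a; cases b) (simp_all add: zero_with_zero_def)

lemma with_zero_add_eq_0: "a + b = 0 \<longleftrightarrow> a = 0 \<and> b = (0 :: 'a::semifield with_zero)"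
  by (cases a; cases b) (simp_all add: zero_with_zero_def)

lemma with_zero_power_eq_0: "a \<noteq> 0 \<Longrightarrow> a ^ n \<noteq> (0 :: 'a::semifield with_zero)"
  by (induction n) (simp_all add: with_zero_mult_eq_0)

lemma un_El_mult: "a \<noteq> 0 \<Longrightarrow> b \<noteq> 0 \<Longrightarrow> un_El (a * b) = un_El a * un_El b"
  by (cases a; cases b) (simp_all add: zero_with_zero_def)

lemma un_El_1 [simp]: "un_El 1 = 1"
  by (simp add: one_with_zero_def)

lemma semiring_map_pconst: "semiring_map (pconst :: 'p::semifield zp \<Rightarrow> ('p, 'v) zp_poly)"
  by (simp add: semiring_map_def pconst_def single_add mult_single)

lemma semiring_map_Fract: "semiring_map (\<lambda>a. Fract a 1)"
  by (simp add: semiring_map_def Zero_fract_def One_fract_def)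

lemma semiring_map_to_ac: "semiring_map to_ac"
  by (simp add: semiring_map_def)

lemma elem_sym_cong: "(\<And>m. m \<in> {1..r} \<Longrightarrow> s m = s' m) \<Longrightarrow> elem_sym r s l = elem_sym r s' l"
  unfolding elem_sym_def by (intro sum.cong refl prod.cong) auto

section \<open>Blocks of variables; independence and symmetry of the e_il\<close>

locale index_data =
  fixes r :: "'n::finite \<Rightarrow> nat" and \<delta> :: "'n \<times> nat \<Rightarrow> 'd::{finite, linorder}"
  assumes \<delta>: "bij_betw \<delta> (index_pairs r) UNIV"
begin

definition unindex :: "'d \<Rightarrow> 'n \<times> nat" where
  "unindex = inv_into (index_pairs r) \<delta>"

lemma unindex_\<delta> [simp]: "\<lbrakk>1 \<le> l; l \<le> r i\<rbrakk> \<Longrightarrow> unindex (\<delta> (i, l)) = (i, l)"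
  using bij_betw_inv_into_left[OF \<delta>, of "(i, l)"] by (simp add: unindex_def index_pairs_def)

lemma \<delta>_eq_iff [simp]:
  "\<lbrakk>1 \<le> l; l \<le> r i; 1 \<le> m; m \<le> r j\<rbrakk> \<Longrightarrow> \<delta> (i, l) = \<delta> (j, m) \<longleftrightarrow> i = j \<and> l = m"
  by (metis unindex_\<delta> prod.inject)

lemma \<delta>_unindex: "\<delta> (unindex d) = d"
  using bij_betw_inv_into_right[OF \<delta>] by (simp add: unindex_def)

lemma unindex_in: "unindex d \<in> index_pairs r"
  using bij_betw_inv_into[OF \<delta>] unfolding unindex_def by (rule bij_betw_apply) simp

lemma \<delta>_cases:
  obtains i l where "d = \<delta> (i, l)" "1 \<le> l" "l \<le> r i"
  using \<delta>_unindex[of d] unindex_in[of d] by (metis (mono_tags, lifting) case_prod_conv index_pairs_def mem_Collect_eq surj_pair)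

lemma prod_\<delta>: "(\<Prod>d\<in>UNIV. f d) = (\<Prod>i\<in>UNIV. \<Prod>l\<in>{1..r i}. f (\<delta> (i, l)))"
proof -
  have *: "index_pairs r = (SIGMA i:UNIV. {1..r i})"
    by (auto simp: index_pairs_def)
  have "(\<Prod>d\<in>UNIV. f d) = (\<Prod>p\<in>index_pairs r. f (\<delta> p))"
    by (rule prod.reindex_bij_betw[OF \<delta>, symmetric])
  also have "\<dots> = (\<Prod>i\<in>UNIV. \<Prod>l\<in>{1..r i}. f (\<delta> (i, l)))"
    unfolding * by (subst prod.Sigma) (auto simp: split_def)
  finally show ?thesis .
qed

definition esym_at :: "'d \<Rightarrow> ('p::semifield, 'd) zp_poly" where
  "esym_at d = (case unindex d of (i, l) \<Rightarrow> esym r \<delta> i l)"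

text \<open>The formal coefficients are natural rather than integer combinations, because a semifield
  with zero has no additive inverses; so evaluation at the prescribed values is a total semiring
  homomorphism.\<close>

definition esym_eval ::
  "(('d \<Rightarrow>\<^sub>0 nat) \<Rightarrow>\<^sub>0 ('p::semifield additive \<Rightarrow>\<^sub>0 nat)) \<Rightarrow> ('p, 'd) zp_poly" where
  "esym_eval = pm_eval (\<lambda>a. pconst (nat_embed a)) (monomial_eval esym_at)"

lemma semiring_map_esym_eval: "semiring_map esym_eval"
  unfolding esym_eval_def
  by (intro semiring_map_pm_eval monoid_map_monomial_eval
      semiring_map_comp[OF semiring_map_pconst semiring_map_nat_embed])

lemma semiring_map_to_ac_Fract: "semiring_map (\<lambda>a. to_ac (Fract a 1))"
  by (intro semiring_map_comp[OF semiring_map_to_ac semiring_map_Fract])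

text \<open>Elementary symmetric polynomials take arbitrary values over an algebraically closed
  field, so the variables can be sent to a point where every \<open>esym_at d\<close> becomes
  \<open>c d\<close>. An equality of values of \<open>esym_eval\<close> therefore persists at every
  point \<open>c\<close>.\<close>

lemma esym_eval_specialize:
  fixes c :: "'d \<Rightarrow> 'p::semifield qp alg_closure"
  shows "\<exists>h. \<forall>F. h (esym_eval F) =
    pm_eval (\<lambda>a. to_ac (Fract (nat_embed a) 1)) (monomial_eval c) F"
proof -
  let ?\<phi> = "\<lambda>a :: 'p zp. to_ac (Fract a 1)"
  have "\<forall>i. \<exists>\<sigma>. \<forall>l\<in>{1..r i}. elem_sym (r i) \<sigma> l = c (\<delta> (i, l))"
    by (intro allI elem_sym_surj)
  then obtain \<sigma> where \<sigma>: "\<And>i l. l \<in> {1..r i} \<Longrightarrow> elem_sym (r i) (\<sigma> i) l = c (\<delta> (i, l))"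
    by metis
  define s where "s d = (case unindex d of (i, l) \<Rightarrow> \<sigma> i l)" for d
  define h where "h = pm_eval ?\<phi> (monomial_eval s)"
  have h: "semiring_map h"
    unfolding h_def by (intro semiring_map_pm_eval monoid_map_monomial_eval semiring_map_to_ac_Fract)
  have hc: "h (pconst a) = ?\<phi> a" for a
    unfolding h_def pconst_def
    by (subst pm_eval_single) (simp_all only: semiring_mapD[OF semiring_map_to_ac_Fract], simp add: monomial_eval_def)
  have hv: "h (pvar d) = s d" for d
    unfolding h_def pvar_def
    by (subst pm_eval_single) (simp_all only: semiring_mapD[OF semiring_map_to_ac_Fract], simp)
  have "h (esym_at d) = c d" for d
  proof -
    obtain i l where d: "d = \<delta> (i, l)" "1 \<le> l" "l \<le> r i" by (rule \<delta>_cases)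
    have "h (esym_at d) = elem_sym (r i) (\<lambda>m. s (\<delta> (i, m))) l"
      using d by (simp add: esym_at_def esym_def semiring_map_elem_sym[OF h] hv)
    also have "\<dots> = elem_sym (r i) (\<sigma> i) l"
      by (rule elem_sym_cong) (simp add: s_def)
    finally show ?thesis using \<sigma> d by simp
  qed
  then have "h (esym_eval F) = pm_eval (\<lambda>a. ?\<phi> (nat_embed a)) (monomial_eval c) F" for F
    unfolding esym_eval_def
    by (simp add: semiring_map_comp_pm_eval[OF h] hc semiring_map_monomial_eval[OF h])
  then show ?thesis by blast
qed

text \<open>This is the algebraic independence of the e_il: two formal expressions with the same
  value agree as functions on a field of characteristic 0, and distinct monomials are independent
  there.\<close>

lemma esym_eval_inject:
  fixes F G :: "('d \<Rightarrow>\<^sub>0 nat) \<Rightarrow>\<^sub>0 ('p::semifield additive \<Rightarrow>\<^sub>0 nat)"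
  assumes "esym_eval F = esym_eval G"
  shows "F = G"
proof (rule poly_mapping_eqI)
  fix m
  let ?\<psi> = "\<lambda>a :: 'p additive \<Rightarrow>\<^sub>0 nat. to_ac (Fract (nat_embed a) 1)"
  let ?A = "Poly_Mapping.keys F \<union> Poly_Mapping.keys G"
  have \<psi>0: "?\<psi> 0 = 0"
    by (simp add: semiring_mapD[OF semiring_map_nat_embed] Zero_fract_def[symmetric])
  have "?\<psi> (Poly_Mapping.lookup F m) - ?\<psi> (Poly_Mapping.lookup G m) = 0" if "m \<in> ?A"
  proof (rule monomials_independent[where M = "?A" and a = "\<lambda>m. ?\<psi> (Poly_Mapping.lookup F m) - ?\<psi> (Poly_Mapping.lookup G m)"])
    fix c :: "'d \<Rightarrow> 'p qp alg_closure"
    obtain h where "\<And>F. h (esym_eval F) = pm_eval ?\<psi> (monomial_eval c) F"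
      using esym_eval_specialize by metis
    with assms have "pm_eval ?\<psi> (monomial_eval c) F = pm_eval ?\<psi> (monomial_eval c) G" by metis
    then show "(\<Sum>m\<in>?A. (?\<psi> (Poly_Mapping.lookup F m) - ?\<psi> (Poly_Mapping.lookup G m)) * monomial_eval c m) = 0"
      by (simp add: pm_eval_superset[of ?\<psi> ?A, OF \<psi>0] left_diff_distrib sum_subtractf)
  next
    fix m n :: nat
    \<comment> \<open>The powers of 2 are distinct in characteristic 0, so 2 can serve as the
      separating scalar.\<close>
    let ?t = "to_ac (Fract 2 1) :: 'p qp alg_closure"
    show "?t \<noteq> 0" by (simp add: Zero_fract_def eq_fract)
    assume "?t ^ m = ?t ^ n"
    then have "Fract (2 ^ m) 1 = (Fract (2 ^ n) 1 :: 'p qp)"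
      by (simp flip: to_ac_power add: semiring_map_power[OF semiring_map_Fract])
    then have "(of_nat (2 ^ m) :: 'p zp) = of_nat (2 ^ n)"
      by (simp add: eq_fract)
    then show "m = n" by (simp only: of_nat_eq_iff) simp
  qed (use that in auto)
  then show "Poly_Mapping.lookup F m = Poly_Mapping.lookup G m"
    by (cases "m \<in> ?A") (auto simp: eq_fract in_keys_iff intro: nat_embed_inject)
qed

lemma NPe_subset: "f \<in> NPe r \<delta> \<Longrightarrow> f \<in> range (esym_eval :: _ \<Rightarrow> ('p::semifield, 'd) zp_poly)"
proof (induction rule: NPe.induct)
  case (const a)
  then obtain P where P: "a = nat_embed P" by (auto simp: NP_iff_nat_embed)
  have "esym_eval (Poly_Mapping.single 0 P) = pconst a"
    unfolding esym_eval_def P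
    by (subst pm_eval_single)
      (simp_all add: monomial_eval_def semiring_mapD[OF semiring_map_nat_embed] semiring_mapD[OF semiring_map_pconst])
  then show ?case by (metis rangeI)
next
  case (esym i l)
  have "esym_eval (Poly_Mapping.single (Poly_Mapping.single (\<delta> (i, l)) 1) 1) = (esym r \<delta> i l :: ('p, 'd) zp_poly)"
    unfolding esym_eval_def using esym
    by (subst pm_eval_single)
      (simp_all add: semiring_mapD[OF semiring_map_nat_embed] semiring_mapD[OF semiring_map_pconst] esym_at_def index_pairs_def)
  then show ?case by (metis rangeI)
next
  case (add f g)
  then show ?case using semiring_mapD(3)[OF semiring_map_esym_eval] by (metis (no_types, lifting) rangeE rangeI)
next
  case (mult f g)
  then show ?case using semiring_mapD(4)[OF semiring_map_esym_eval] by (metis (no_types, lifting) rangeE rangeI)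
qed

text \<open>\<open>psi_poly\<close> is a mere choice, so a candidate is needed: read an element as
  its unique formal expression in the e_il and evaluate that at the prescribed values
  \<open>z\<close>, with \<open>nat_pi\<close> on the coefficients.\<close>

lemma psi_poly_spec:
  fixes Z :: "'n \<Rightarrow> 'p::semifield zp poly"
  shows "a \<in> NP \<Longrightarrow> psi_poly r \<delta> Z (pconst a) = \<pi>\<^sub>0 a"
    "(i, l) \<in> index_pairs r \<Longrightarrow> psi_poly r \<delta> Z (esym r \<delta> i l) = \<pi>\<^sub>0 (Polynomial.coeff (Z i) l)"
    "f \<in> NPe r \<delta> \<Longrightarrow> g \<in> NPe r \<delta> \<Longrightarrow> psi_poly r \<delta> Z (f + g) = psi_poly r \<delta> Z f + psi_poly r \<delta> Z g"
    "f \<in> NPe r \<delta> \<Longrightarrow> g \<in> NPe r \<delta> \<Longrightarrow> psi_poly r \<delta> Z (f * g) = psi_poly r \<delta> Z f * psi_poly r \<delta> Z g"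
proof -
  define z where "z d = (case unindex d of (i, l) \<Rightarrow> \<pi>\<^sub>0 (Polynomial.coeff (Z i) l))" for d
  define ev where "ev = pm_eval nat_pi (monomial_eval z)"
  have ev: "semiring_map ev"
    unfolding ev_def by (intro semiring_map_pm_eval monoid_map_monomial_eval semiring_map_nat_pi)
  define \<psi> where "\<psi> f = ev (inv_into UNIV esym_eval f)" for f
  have \<psi>: "\<psi> (esym_eval F) = ev F" for F
    unfolding \<psi>_def by (subst inv_f_f) (auto intro: injI esym_eval_inject)
  let ?P = "\<lambda>\<psi>. (\<forall>a\<in>NP. \<psi> (pconst a) = \<pi>\<^sub>0 a) \<and>
     (\<forall>(i, l)\<in>index_pairs r. \<psi> (esym r \<delta> i l) = \<pi>\<^sub>0 (Polynomial.coeff (Z i) l)) \<and>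
     (\<forall>f\<in>NPe r \<delta>. \<forall>g\<in>NPe r \<delta>. \<psi> (f + g) = \<psi> f + \<psi> g \<and> \<psi> (f * g) = \<psi> f * \<psi> g)"
  have "?P \<psi>"
  proof (intro conjI ballI)
    fix a :: "'p zp" assume "a \<in> NP"
    then obtain P where P: "a = nat_embed P" by (auto simp: NP_iff_nat_embed)
    have "esym_eval (Poly_Mapping.single 0 P) = pconst a"
      unfolding esym_eval_def P
      by (subst pm_eval_single)
        (simp_all add: monomial_eval_def semiring_mapD[OF semiring_map_nat_embed] semiring_mapD[OF semiring_map_pconst])
    moreover have "ev (Poly_Mapping.single 0 P) = \<pi>\<^sub>0 a"
      unfolding ev_def P pi0_nat_embed
      by (subst pm_eval_single) (simp_all add: monomial_eval_def semiring_mapD[OF semiring_map_nat_pi])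
    ultimately show "\<psi> (pconst a) = \<pi>\<^sub>0 a" by (metis \<psi>)
  next
    fix p assume "p \<in> index_pairs r"
    then obtain i l where il: "p = (i, l)" "1 \<le> l" "l \<le> r i" by (auto simp: index_pairs_def)
    let ?m = "Poly_Mapping.single (Poly_Mapping.single (\<delta> (i, l)) 1) 1"
    have "esym_eval ?m = (esym r \<delta> i l :: ('p, 'd) zp_poly)"
      unfolding esym_eval_def using il
      by (subst pm_eval_single)
        (simp_all add: semiring_mapD[OF semiring_map_nat_embed] semiring_mapD[OF semiring_map_pconst] esym_at_def)
    moreover have "ev ?m = \<pi>\<^sub>0 (Polynomial.coeff (Z i) l)"
      unfolding ev_def using il
      by (subst pm_eval_single) (simp_all add: semiring_mapD[OF semiring_map_nat_pi] z_def)
    ultimately show "case p of (i, l) \<Rightarrow> \<psi> (esym r \<delta> i l) = \<pi>\<^sub>0 (Polynomial.coeff (Z i) l)"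
      using il by (simp flip: \<psi>)
  next
    fix f g :: "('p, 'd) zp_poly" assume "f \<in> NPe r \<delta>" "g \<in> NPe r \<delta>"
    then obtain F G where FG: "f = esym_eval F" "g = esym_eval G" using NPe_subset by blast
    show "\<psi> (f + g) = \<psi> f + \<psi> g" "\<psi> (f * g) = \<psi> f * \<psi> g"
      unfolding FG by (simp_all add: \<psi> semiring_mapD[OF ev] flip: semiring_mapD[OF semiring_map_esym_eval])
  qed
  then have "?P (psi_poly r \<delta> Z)" unfolding psi_poly_def by (rule someI[where P = ?P])
  then show "a \<in> NP \<Longrightarrow> psi_poly r \<delta> Z (pconst a) = \<pi>\<^sub>0 a"
    "(i, l) \<in> index_pairs r \<Longrightarrow> psi_poly r \<delta> Z (esym r \<delta> i l) = \<pi>\<^sub>0 (Polynomial.coeff (Z i) l)"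
    "f \<in> NPe r \<delta> \<Longrightarrow> g \<in> NPe r \<delta> \<Longrightarrow> psi_poly r \<delta> Z (f + g) = psi_poly r \<delta> Z f + psi_poly r \<delta> Z g"
    "f \<in> NPe r \<delta> \<Longrightarrow> g \<in> NPe r \<delta> \<Longrightarrow> psi_poly r \<delta> Z (f * g) = psi_poly r \<delta> Z f * psi_poly r \<delta> Z g"
    by auto
qed

text \<open>The generators of \<open>NPe\<close> are symmetric in each block separately, and
  permuting variables is a ring homomorphism. This invariance limits which quotients of monomials
  can be quotients of elements of \<open>NPe\<close>.\<close>

lemma transpose_same_block:
  assumes "l \<in> {1..r i}" "m \<in> {1..r i}" "f \<in> NPe r \<delta>"
  shows "pm_eval pconst (monomial_eval (\<lambda>d. pvar (transpose (\<delta> (i, l)) (\<delta> (i, m)) d))) f =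
    (f :: ('p::semifield, 'd) zp_poly)"
  using assms(3)
proof (induction rule: NPe.induct)
  let ?\<tau> = "transpose (\<delta> (i, l)) (\<delta> (i, m))"
  let ?h = "pm_eval pconst (monomial_eval (\<lambda>d. pvar (?\<tau> d))) :: ('p, 'd) zp_poly \<Rightarrow> ('p, 'd) zp_poly"
  have h: "semiring_map ?h"
    by (intro semiring_map_pm_eval monoid_map_monomial_eval semiring_map_pconst)
  {
    case (const a)
    then show ?case
      by (subst (2) pconst_def, subst pm_eval_single)
        (simp_all add: monomial_eval_def semiring_mapD[OF semiring_map_pconst])
  next
    case (esym j k)
    have hv: "?h (pvar d) = pvar (?\<tau> d)" for d
      unfolding pvar_def[of d]
      by (subst pm_eval_single) (simp_all add: semiring_mapD[OF semiring_map_pconst])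
    have "?h (esym r \<delta> j k) = elem_sym (r j) (\<lambda>m. pvar (?\<tau> (\<delta> (j, m)))) k"
      unfolding esym_def by (simp add: semiring_map_elem_sym[OF h] hv)
    also have "\<dots> = esym r \<delta> j k"
    proof (cases "j = i")
      case True
      have "elem_sym (r j) (\<lambda>m. pvar (?\<tau> (\<delta> (j, m)))) k =
        elem_sym (r j) (\<lambda>k. pvar (\<delta> (j, transpose l m k))) k"
      proof (rule elem_sym_cong)
        fix k assume "k \<in> {1..r j}"
        then have "?\<tau> (\<delta> (j, k)) = \<delta> (j, transpose l m k)"
          using True assms(1,2) by (auto simp: transpose_def)
        then show "pvar (?\<tau> (\<delta> (j, k))) = pvar (\<delta> (j, transpose l m k))" by simp
      qed
      also have "\<dots> = esym r \<delta> j k"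
        unfolding esym_def
        by (rule elem_sym_permute[where s = "\<lambda>k. pvar (\<delta> (j, k))"]) (use True assms in \<open>auto intro!: bij_betw_byWitness[where f' = "transpose l m"] simp: transpose_def\<close>)
      finally show ?thesis .
    next
      case False
      show ?thesis unfolding esym_def
      proof (rule elem_sym_cong)
        fix k assume "k \<in> {1..r j}"
        then have "\<delta> (j, k) \<noteq> \<delta> (i, l)" "\<delta> (j, k) \<noteq> \<delta> (i, m)"
          using False assms(1,2) by auto
        then show "pvar (?\<tau> (\<delta> (j, k))) = pvar (\<delta> (j, k))" by simp
      qed
    qed
    finally show ?case .
  next
    case (add f g)
    then show ?case by (simp add: semiring_mapD[OF h])
  next
    case (mult f g)
    then show ?case by (simp add: semiring_mapD[OF h])
  }
qed

lemma monomial_eval_pvar: "monomial_eval pvar m = (Poly_Mapping.single m 1 :: ('p::semifield, 'v::finite) zp_poly)"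
proof -
  have pw: "pvar v ^ n = (Poly_Mapping.single (Poly_Mapping.single v n) 1 :: ('p, 'v) zp_poly)" for v n
    by (induction n) (simp_all add: pvar_def mult_single single_add[symmetric])
  have "(\<Prod>v\<in>A. (Poly_Mapping.single (f v) 1 :: ('p, 'v) zp_poly)) = Poly_Mapping.single (sum f A) 1" for f A
    by (induction A rule: infinite_finite_induct) (simp_all add: mult_single)
  then have "monomial_eval pvar m = (Poly_Mapping.single (\<Sum>v\<in>UNIV. Poly_Mapping.single v (Poly_Mapping.lookup m v)) 1 :: ('p, 'v) zp_poly)"
    by (simp add: monomial_eval_finite pw)
  also have "(\<Sum>v\<in>UNIV. Poly_Mapping.single v (Poly_Mapping.lookup m v)) = m"
    by (rule poly_mapping_eqI) (simp add: lookup_sum lookup_single when_def sum.delta)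
  finally show ?thesis .
qed

text \<open>Apply the transposition of the two variables to \<open>eq\<close> and multiply crosswise
  with \<open>eq\<close> itself. The invariant \<open>f\<close> and \<open>g\<close> cancel, and an
  identity of monomials remains in which exponents can be compared.\<close>

lemma symmetric_monomial_quotient:
  fixes f g :: "('p::semifield, 'd) zp_poly"
  assumes f: "f \<in> NPe r \<delta>" "f \<noteq> 0" and g: "g \<in> NPe r \<delta>" "g \<noteq> 0"
    and eq: "f * monomial_eval pvar a = g * monomial_eval pvar b"
    and lm: "l \<in> {1..r i}" "m \<in> {1..r i}"
  shows "int (Poly_Mapping.lookup a (\<delta> (i, l))) - int (Poly_Mapping.lookup b (\<delta> (i, l))) =
    int (Poly_Mapping.lookup a (\<delta> (i, m))) - int (Poly_Mapping.lookup b (\<delta> (i, m)))"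
proof -
  let ?\<tau> = "transpose (\<delta> (i, l)) (\<delta> (i, m))"
  let ?h = "pm_eval pconst (monomial_eval (\<lambda>d. pvar (?\<tau> d))) :: ('p, 'd) zp_poly \<Rightarrow> ('p, 'd) zp_poly"
  have h: "semiring_map ?h"
    by (intro semiring_map_pm_eval monoid_map_monomial_eval semiring_map_pconst)
  have hv: "?h (pvar d) = pvar (?\<tau> d)" for d
    unfolding pvar_def[of d]
    by (subst pm_eval_single) (simp_all add: semiring_mapD[OF semiring_map_pconst])
  define T where "T c = Poly_Mapping.map_key ?\<tau> c" for c :: "'d \<Rightarrow>\<^sub>0 nat"
  have "inj ?\<tau>" by (rule bij_is_inj) (rule bij_transpose)
  then have T: "Poly_Mapping.lookup (T c) d = Poly_Mapping.lookup c (?\<tau> d)" for c d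
    unfolding T_def by (simp add: map_key.rep_eq)
  have hm: "?h (monomial_eval pvar c) = monomial_eval pvar (T c)" for c
  proof -
    have "?h (monomial_eval pvar c) = (\<Prod>d\<in>UNIV. pvar (?\<tau> d) ^ Poly_Mapping.lookup c d)"
      by (simp add: semiring_map_monomial_eval[OF h] hv) (simp add: monomial_eval_finite)
    also have "\<dots> = (\<Prod>d\<in>UNIV. pvar (?\<tau> (?\<tau> d)) ^ Poly_Mapping.lookup c (?\<tau> d))"
      by (rule prod.reindex_bij_betw[symmetric, of ?\<tau>]) (auto intro: bij_betw_byWitness[where f' = ?\<tau>])
    finally show ?thesis by (simp add: monomial_eval_finite T)
  qed
  have "?h (f * monomial_eval pvar a) = ?h (g * monomial_eval pvar b)" using eq by simp
  then have eq': "f * monomial_eval pvar (T a) = g * monomial_eval pvar (T b)"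
    using transpose_same_block[OF lm f(1)] transpose_same_block[OF lm g(1)]
    by (simp only: semiring_mapD[OF h] hm)
  have "(f * g) * (monomial_eval pvar a * monomial_eval pvar (T b)) =
      (f * monomial_eval pvar a) * (g * monomial_eval pvar (T b))"
    by (simp only: mult_ac)
  also have "\<dots> = (f * g) * (monomial_eval pvar b * monomial_eval pvar (T a))"
    unfolding eq eq'[symmetric] by (simp only: mult_ac)
  finally have "monomial_eval pvar a * monomial_eval pvar (T b) =
      (monomial_eval pvar b * monomial_eval pvar (T a) :: ('p, 'd) zp_poly)"
    using f g by simp
  then have "(Poly_Mapping.single (a + T b) 1 :: ('p, 'd) zp_poly) = Poly_Mapping.single (b + T a) 1"
    by (simp add: monomial_eval_pvar mult_single)
  then have "a + T b = b + T a"
    by (metis lookup_single_eq lookup_single_not_eq one_neq_zero)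
  then have "Poly_Mapping.lookup (a + T b) (\<delta> (i, l)) = Poly_Mapping.lookup (b + T a) (\<delta> (i, l))"
    by simp
  then show ?thesis by (simp add: lookup_add T)
qed

end

section \<open>The semifield of symmetric fractions\<close>

lemma semifield_frac_eq: "a / b = c / d \<longleftrightarrow> a * d = c * (b :: 'a::semifield)"
proof -
  have "a * inverse b = c * inverse d \<longleftrightarrow> a * inverse b * (b * d) = c * inverse d * (b * d)"
    by (simp only: semifield_mult_cancel)
  also have "a * inverse b * (b * d) = a * d * (inverse b * b)"
    by (simp only: mult_ac)
  also have "c * inverse d * (b * d) = c * b * (inverse d * d)"
    by (simp only: mult_ac)
  finally show ?thesis by (simp add: semifield_divide semifield_left_inverse)
qed

lemma semifield_cancel_left: "inverse a * (a * b) = (b :: 'a::semifield)"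
  by (simp add: semifield_left_inverse flip: mult.assoc)

lemma power_prod: "prod f A ^ n = (\<Prod>x\<in>A. f x ^ n :: 'a::comm_monoid_mult)"
  by (induction A rule: infinite_finite_induct) (simp_all add: power_mult_distrib)

lemma Rep_pbar_prod: "Rep_pbar (prod f A) = (\<Prod>a\<in>A. Rep_pbar (f a))"
  by (induction A rule: infinite_finite_induct) (simp_all add: one_pbar.rep_eq times_pbar.rep_eq)

lemma Rep_pbar_power: "Rep_pbar (a ^ n) = Rep_pbar a ^ n"
  by (induction n) (simp_all add: one_pbar.rep_eq times_pbar.rep_eq)

lemma Fract_power: "Fract a b ^ n = Fract (a ^ n) (b ^ n)"
  by (induction n) (simp_all add: One_fract_def)

lemma prod_Fract: "(\<Prod>x\<in>A. Fract (f x) (g x)) = Fract (\<Prod>x\<in>A. f x) (\<Prod>x\<in>A. g x)"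
  by (induction A rule: infinite_finite_induct) (simp_all add: One_fract_def)

locale exchange_data = index_data r \<delta>
  for r :: "'n::finite \<Rightarrow> nat" and \<delta> :: "'n \<times> nat \<Rightarrow> 'd::{finite, linorder}" +
  fixes Z :: "'n \<Rightarrow> 'p::semifield zp poly"
  assumes r_pos: "1 \<le> r i"
    and Z_degree: "Polynomial.degree (Z i) \<le> r i"
    and Z_NP: "Polynomial.coeff (Z i) l \<in> NP"
    and Z_bot: "Polynomial.coeff (Z i) 0 = 1"
    and Z_top: "Polynomial.coeff (Z i) (r i) = 1"
begin

abbreviation "\<psi>p \<equiv> psi_poly r \<delta> Z"

text \<open>The graph of \<psi> on S. It carries membership in S and the value together, so closure
  properties need no appeal to the description operator in \<open>psi\<close>.\<close>

definition specializes :: "('p, 'd) pbar \<Rightarrow> 'p \<Rightarrow> bool" where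
  "specializes q p \<longleftrightarrow> (\<exists>f\<in>NPe r \<delta>. \<exists>g\<in>NPe r \<delta>. \<psi>p f \<noteq> 0 \<and> \<psi>p g \<noteq> 0 \<and>
     Rep_pbar q = Fract f g \<and> p = un_El (\<psi>p f) / un_El (\<psi>p g))"

lemma specializesI:
  "\<lbrakk>f \<in> NPe r \<delta>; g \<in> NPe r \<delta>; \<psi>p f \<noteq> 0; \<psi>p g \<noteq> 0; Rep_pbar q = Fract f g;
    p = un_El (\<psi>p f) / un_El (\<psi>p g)\<rbrakk> \<Longrightarrow> specializes q p"
  unfolding specializes_def by blast

lemma specializesE:
  assumes "specializes q p"
  obtains f g where "f \<in> NPe r \<delta>" "g \<in> NPe r \<delta>" "\<psi>p f \<noteq> 0" "\<psi>p g \<noteq> 0"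
    "Rep_pbar q = Fract f g" "p = un_El (\<psi>p f) / un_El (\<psi>p g)"
  using assms unfolding specializes_def by blast

lemma Z_degree_eq: "Polynomial.degree (Z i) = r i"
  using Z_degree[of i] le_degree[of "Z i" "r i"] by (simp add: Z_top)

lemma one_NP: "1 \<in> (NP :: 'a::semifield zp set)"
  by (auto simp: NP_def lookup_one when_def)

lemma zero_NPe: "0 \<in> NPe r \<delta>" and one_NPe: "1 \<in> NPe r \<delta>"
  using NPe.const[OF NP_zero, of r \<delta>] NPe.const[OF one_NP, of r \<delta>]
  by (simp_all add: semiring_mapD[OF semiring_map_pconst])

lemma \<psi>p_0: "\<psi>p 0 = 0" and \<psi>p_1: "\<psi>p 1 = 1"
  using psi_poly_spec(1)[OF NP_zero, of Z] psi_poly_spec(1)[OF one_NP, of Z]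
  by (simp_all add: semiring_mapD[OF semiring_map_pconst])

lemma \<psi>p_nonzero: "\<psi>p f \<noteq> 0 \<Longrightarrow> f \<noteq> 0"
  by (auto simp: \<psi>p_0)

text \<open>Equal fractions cross-multiply to an identity inside \<open>NPe\<close>, to which
  \<open>\<psi>p\<close> applies; its values there are nonzero, so they can be divided in the
  semifield.\<close>

lemma specializes_unique:
  assumes "specializes q p" "specializes q p'" shows "p = p'"
proof -
  obtain f g where f: "f \<in> NPe r \<delta>" "g \<in> NPe r \<delta>" "\<psi>p f \<noteq> 0" "\<psi>p g \<noteq> 0"
    "Rep_pbar q = Fract f g" "p = un_El (\<psi>p f) / un_El (\<psi>p g)"
    using assms(1) by (rule specializesE)
  obtain f' g' where f': "f' \<in> NPe r \<delta>" "g' \<in> NPe r \<delta>" "\<psi>p f' \<noteq> 0" "\<psi>p g' \<noteq> 0"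
    "Rep_pbar q = Fract f' g'" "p' = un_El (\<psi>p f') / un_El (\<psi>p g')"
    using assms(2) by (rule specializesE)
  have "Fract f g = Fract f' g'" using f(5) f'(5) by simp
  then have "f * g' = f' * g"
    using f f' by (simp add: eq_fract \<psi>p_nonzero)
  then have "\<psi>p f * \<psi>p g' = \<psi>p f' * \<psi>p g"
    using f f' by (metis psi_poly_spec(4))
  then have "un_El (\<psi>p f) * un_El (\<psi>p g') = un_El (\<psi>p f') * un_El (\<psi>p g)"
    using f f' by (simp flip: un_El_mult)
  then show ?thesis using f f' by (simp add: semifield_frac_eq)
qed

lemma Ssf_iff: "q \<in> Ssf r \<delta> Z \<longleftrightarrow> (\<exists>p. specializes q p)"
  unfolding Ssf_def specializes_def by blast

lemma psi_eq: "specializes q p \<Longrightarrow> psi r \<delta> Z q = p"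
  unfolding psi_def specializes_def[symmetric] by (rule the_equality) (auto intro: specializes_unique)

lemma specializes_psi: "q \<in> Ssf r \<delta> Z \<Longrightarrow> specializes q (psi r \<delta> Z q)"
  using psi_eq by (auto simp: Ssf_iff)

lemma specializes_mult:
  assumes "specializes q p" "specializes q' p'" shows "specializes (q * q') (p * p')"
proof -
  obtain f g where f: "f \<in> NPe r \<delta>" "g \<in> NPe r \<delta>" "\<psi>p f \<noteq> 0" "\<psi>p g \<noteq> 0"
    "Rep_pbar q = Fract f g" "p = un_El (\<psi>p f) / un_El (\<psi>p g)"
    using assms(1) by (rule specializesE)
  obtain f' g' where f': "f' \<in> NPe r \<delta>" "g' \<in> NPe r \<delta>" "\<psi>p f' \<noteq> 0" "\<psi>p g' \<noteq> 0"
    "Rep_pbar q' = Fract f' g'" "p' = un_El (\<psi>p f') / un_El (\<psi>p g')"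
    using assms(2) by (rule specializesE)
  show ?thesis
    by (rule specializesI[where f = "f * f'" and g = "g * g'"])
      (use f f' in \<open>simp_all add: NPe.mult psi_poly_spec(4) with_zero_mult_eq_0 times_pbar.rep_eq
        un_El_mult semifield_divide semifield_inverse_mult mult_ac\<close>)
qed

lemma specializes_inverse:
  assumes "specializes q p" shows "specializes (inverse q) (inverse p)"
proof -
  obtain f g where f: "f \<in> NPe r \<delta>" "g \<in> NPe r \<delta>" "\<psi>p f \<noteq> 0" "\<psi>p g \<noteq> 0"
    "Rep_pbar q = Fract f g" "p = un_El (\<psi>p f) / un_El (\<psi>p g)"
    using assms(1) by (rule specializesE)
  show ?thesis
    by (rule specializesI[where f = g and g = f])
      (use f in \<open>simp_all add: inverse_pbar.rep_eq semifield_divide semifield_inverse_mult mult_ac\<close>)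
qed

lemma gel_NP: "gel p \<in> NP"
  by (auto simp: NP_def gel_def lookup_single when_def)

lemma specializes_pbar_of: "specializes (pbar_of p) p"
  by (rule specializesI[where f = "pconst (gel p)" and g = 1])
    (simp_all add: NPe.const gel_NP one_NPe psi_poly_spec(1) \<psi>p_1 pbar_of.rep_eq semifield_divide)

lemma specializes_1: "specializes 1 1"
  by (rule specializesI[where f = 1 and g = 1])
    (simp_all add: one_NPe \<psi>p_1 one_pbar.rep_eq One_fract_def semifield_divide)

lemma specializes_prod:
  "(\<And>a. a \<in> A \<Longrightarrow> specializes (q a) (p a)) \<Longrightarrow> specializes (prod q A) (prod p A)"
  by (induction A rule: infinite_finite_induct) (auto intro: specializes_1 specializes_mult)

lemma specializes_power: "specializes q p \<Longrightarrow> specializes (q ^ n) (p ^ n)"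
  by (induction n) (auto intro: specializes_1 specializes_mult)

lemma specializes_power_int: "specializes q p \<Longrightarrow> specializes (q powi n) (p powi n)"
  by (simp add: power_int_def specializes_power specializes_inverse)

text \<open>The product over a block is the top elementary symmetric polynomial, whose image is the
  leading coefficient of \<open>Z i\<close>. The normalization \<open>Z_top\<close> enters
  here.\<close>

lemma specializes_svar_prod: "specializes (\<Prod>l\<in>{1..r i}. svar (\<delta> (i, l))) 1"
proof (rule specializesI[where f = "esym r \<delta> i (r i)" and g = 1])
  have in_pairs: "(i, r i) \<in> index_pairs r" using r_pos by (simp add: index_pairs_def)
  then show "esym r \<delta> i (r i) \<in> NPe r \<delta>" by (rule NPe.esym)
  have "\<psi>p (esym r \<delta> i (r i)) = 1"
    using psi_poly_spec(2)[OF in_pairs, of Z] by (simp add: Z_top)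
  then show "\<psi>p (esym r \<delta> i (r i)) \<noteq> 0" "1 = un_El (\<psi>p (esym r \<delta> i (r i))) / un_El (\<psi>p 1)"
    by (simp_all add: semifield_divide \<psi>p_1)
  show "Rep_pbar (\<Prod>l\<in>{1..r i}. svar (\<delta> (i, l))) = Fract (esym r \<delta> i (r i)) 1"
    by (simp add: Rep_pbar_prod svar.rep_eq prod_Fract esym_def elem_sym_top)
qed (simp_all add: one_NPe \<psi>p_1)

lemma NPe_power: "f \<in> NPe r \<delta> \<Longrightarrow> f ^ n \<in> NPe r \<delta>"
  by (induction n) (simp_all add: one_NPe NPe.mult)

lemma \<psi>p_power: "f \<in> NPe r \<delta> \<Longrightarrow> \<psi>p (f ^ n) = \<psi>p f ^ n"
  by (induction n) (simp_all add: \<psi>p_1 psi_poly_spec(4) NPe_power)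

lemma NPe_sum_\<psi>p:
  assumes "\<And>a. a \<in> A \<Longrightarrow> f a \<in> NPe r \<delta>"
  shows "sum f A \<in> NPe r \<delta> \<and> \<psi>p (sum f A) = (\<Sum>a\<in>A. \<psi>p (f a))"
  using assms
  by (induction A rule: infinite_finite_induct)
    (simp_all add: zero_NPe \<psi>p_0 NPe.add psi_poly_spec(3))

lemma \<psi>p_esym: "l \<le> r i \<Longrightarrow> esym r \<delta> i l \<in> NPe r \<delta> \<and> \<psi>p (esym r \<delta> i l) = \<pi>\<^sub>0 (Polynomial.coeff (Z i) l)"
proof (cases "l = 0")
  case False
  moreover assume "l \<le> r i"
  ultimately have "(i, l) \<in> index_pairs r" by (simp add: index_pairs_def)
  then show ?thesis by (simp add: NPe.esym psi_poly_spec(2))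
qed (simp add: esym_def one_NPe \<psi>p_1 Z_bot)

lemma eval_P0_eq: "eval_P0 (Z i) y = (\<Sum>l\<le>r i. \<pi>\<^sub>0 (Polynomial.coeff (Z i) l) * El y ^ l)"
  by (simp add: eval_P0_def Z_degree_eq El_power)

text \<open>The constant term contributes 1 and sums in a semifield with zero cannot cancel. Hence
  \<open>un_El\<close> is never applied to zero in the mutation rule.\<close>

lemma eval_P0_nonzero: "eval_P0 (Z i) y \<noteq> 0"
proof -
  have "{..r i} = insert 0 {1..r i}" by auto
  then show ?thesis by (simp add: eval_P0_eq Z_bot with_zero_add_eq_0)
qed

text \<open>For a = f/g the single factors are not symmetric, but over the denominator
  \<open>g ^ r i\<close> the product has numerator \<Sum> e_l f^l g^(r-l), which lies in
  \<open>NPe\<close>.\<close>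

lemma specializes_factor:
  assumes "specializes a p"
  shows "specializes (\<Prod>l\<in>{1..r i}. 1 + svar (\<delta> (i, l)) * a) (un_El (eval_P0 (Z i) p))"
proof -
  obtain f g where f: "f \<in> NPe r \<delta>" "g \<in> NPe r \<delta>" "\<psi>p f \<noteq> 0" "\<psi>p g \<noteq> 0"
    "Rep_pbar a = Fract f g" "p = un_El (\<psi>p f) / un_El (\<psi>p g)"
    using assms by (rule specializesE)
  have g0: "g \<noteq> 0" using f by (simp add: \<psi>p_nonzero)
  define N where "N = (\<Sum>l\<le>r i. esym r \<delta> i l * f ^ l * g ^ (r i - l))"
  have N: "N \<in> NPe r \<delta> \<and> \<psi>p N = (\<Sum>l\<le>r i. \<psi>p (esym r \<delta> i l * f ^ l * g ^ (r i - l)))"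
    unfolding N_def by (rule NPe_sum_\<psi>p) (use \<psi>p_esym f in \<open>auto intro!: NPe.mult NPe_power\<close>)
  have "El p * \<psi>p g = El (un_El (\<psi>p f) * (inverse (un_El (\<psi>p g)) * un_El (\<psi>p g)))"
    using f(4) by (metis El_un_El times_with_zero.simps(3) f(6) semifield_divide mult.assoc)
  then have pg: "El p * \<psi>p g = \<psi>p f"
    using f(3) by (simp add: semifield_left_inverse El_un_El)
  \<comment> \<open>Since \<open>El p * \<psi>p g = \<psi>p f\<close>, every summand contains the
    same factor \<open>\<psi>p g ^ r i\<close>, the image of the denominator.\<close>
  have "\<psi>p N = (\<Sum>l\<le>r i. \<pi>\<^sub>0 (Polynomial.coeff (Z i) l) * El p ^ l * \<psi>p g ^ r i)"
  proof -
    have "\<psi>p (esym r \<delta> i l * f ^ l * g ^ (r i - l)) = \<pi>\<^sub>0 (Polynomial.coeff (Z i) l) * El p ^ l * \<psi>p g ^ r i"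
      if "l \<le> r i" for l
    proof -
      have "\<psi>p (esym r \<delta> i l * f ^ l * g ^ (r i - l)) =
          \<pi>\<^sub>0 (Polynomial.coeff (Z i) l) * (El p * \<psi>p g) ^ l * \<psi>p g ^ (r i - l)"
        using f(1,2) by (simp add: psi_poly_spec(4) NPe.mult NPe_power \<psi>p_power pg \<psi>p_esym[OF that])
      also have "\<dots> = \<pi>\<^sub>0 (Polynomial.coeff (Z i) l) * El p ^ l * (\<psi>p g ^ l * \<psi>p g ^ (r i - l))"
        by (simp only: power_mult_distrib mult_ac)
      finally show ?thesis using that by (simp flip: power_add)
    qed
    then show ?thesis using N by simp
  qed
  then have \<psi>N: "\<psi>p N = eval_P0 (Z i) p * \<psi>p g ^ r i"
    by (simp add: eval_P0_eq sum_distrib_right)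
  have "Rep_pbar (\<Prod>l\<in>{1..r i}. 1 + svar (\<delta> (i, l)) * a) =
      (\<Prod>l\<in>{1..r i}. Fract (g + pvar (\<delta> (i, l)) * f) g)"
    using g0 by (simp add: Rep_pbar_prod plus_pbar.rep_eq one_pbar.rep_eq times_pbar.rep_eq svar.rep_eq
        f(5) One_fract_def)
  also have "\<dots> = Fract N (g ^ r i)"
    by (simp only: prod_Fract N_def esym_def prod_add_elem_sym[where s = "\<lambda>l. pvar (\<delta> (i, l))"]
        prod_constant card_atLeastAtMost) simp
  finally have Rep: "Rep_pbar (\<Prod>l\<in>{1..r i}. 1 + svar (\<delta> (i, l)) * a) = Fract N (g ^ r i)" .
  have gr: "\<psi>p g ^ r i \<noteq> 0" using f by (simp add: with_zero_power_eq_0)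
  show ?thesis
  proof (rule specializesI[OF _ _ _ _ Rep])
    show "un_El (eval_P0 (Z i) p) = un_El (\<psi>p N) / un_El (\<psi>p (g ^ r i))"
      using f gr eval_P0_nonzero
      by (simp add: \<psi>N \<psi>p_power un_El_mult semifield_divide mult.assoc semifield_right_inverse)
  qed (use conjunct1[OF N] f(1-4) gr eval_P0_nonzero in
      \<open>simp_all add: \<psi>N \<psi>p_power NPe_power with_zero_mult_eq_0\<close>)
qed

end

section \<open>Extending characters\<close>

text \<open>The graph of a character on a subgroup. Given closure under products and inverses, the
  last clause amounts to single-valuedness; with graphs, extension of characters is plain inclusion,
  as Zorn's lemma wants it.\<close>

definition partial_char :: "('a::semifield \<times> 'k::field) set \<Rightarrow> bool" where
  "partial_char G \<longleftrightarrow> (1, 1) \<in> G \<and> (\<forall>a x b y. (a, x) \<in> G \<longrightarrow> (b, y) \<in> G \<longrightarrow> (a * b, x * y) \<in> G) \<and>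
     (\<forall>a x. (a, x) \<in> G \<longrightarrow> (inverse a, inverse x) \<in> G) \<and> (\<forall>x. (1, x) \<in> G \<longrightarrow> x = 1)"

lemma partial_charD:
  assumes "partial_char G"
  shows "(1, 1) \<in> G" "(a, x) \<in> G \<Longrightarrow> (b, y) \<in> G \<Longrightarrow> (a * b, x * y) \<in> G"
    "(a, x) \<in> G \<Longrightarrow> (inverse a, inverse x) \<in> G" "(1, x) \<in> G \<Longrightarrow> x = 1"
  using assms by (auto simp: partial_char_def)

lemma partial_char_nonzero: "partial_char G \<Longrightarrow> (a, x) \<in> G \<Longrightarrow> x \<noteq> 0"
  using partial_charD(2)[of G a x "inverse a" "inverse x"] partial_charD(3)[of G a x]
    partial_charD(4)[of G "x * inverse x"]
  by (auto simp: semifield_right_inverse)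

lemma partial_char_unique:
  assumes "partial_char G" "(a, x) \<in> G" "(a, y) \<in> G" shows "x = y"
proof -
  have "(a * inverse a, x * inverse y) \<in> G" using assms by (metis partial_charD(2,3))
  then have "x * inverse y = 1" using partial_charD(4)[OF assms(1)] by (simp add: semifield_right_inverse)
  then show ?thesis using partial_char_nonzero[OF assms(1,3)] by (simp add: field_simps)
qed

lemma partial_char_power: "partial_char G \<Longrightarrow> (a, x) \<in> G \<Longrightarrow> (a ^ n, x ^ n) \<in> G"
  by (induction n) (auto intro: partial_charD)

text \<open>A value \<open>c\<close> for \<open>g\<close> must agree with all values already given
  to powers of \<open>g\<close>. If \<open>n\<close> is the least positive exponent with
  \<open>g ^ n\<close> in the domain, an n-th root of its value works; if there is none,
  \<open>c = 1\<close> does.\<close>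

lemma partial_char_extend:
  fixes M :: "('a::semifield \<times> 'k::alg_closed_field) set"
  assumes M: "partial_char M"
  shows "\<exists>M'. partial_char M' \<and> M \<subseteq> M' \<and> (\<exists>x. (g, x) \<in> M')"
proof -
  have "\<exists>c. c \<noteq> 0 \<and> (\<forall>k x. (g ^ k, x) \<in> M \<longrightarrow> c ^ k = x)"
  proof (cases "\<exists>n>0. \<exists>y. (g ^ n, y) \<in> M")
    case True
    define n where "n = (LEAST n. n > 0 \<and> (\<exists>y. (g ^ n, y) \<in> M))"
    have n: "n > 0 \<and> (\<exists>y. (g ^ n, y) \<in> M)"
      unfolding n_def by (rule LeastI_ex) (use True in blast)
    then obtain y where y: "(g ^ n, y) \<in> M" by blast
    obtain c where c: "c ^ n = y" using nth_root_exists[of n y] n by auto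
    have "c ^ k = x" if "(g ^ k, x) \<in> M" for k x
    proof -
      \<comment> \<open>The power \<open>g ^ s\<close> with the remainder \<open>s < n\<close> is
        again in the domain, so minimality of \<open>n\<close> forces \<open>s = 0\<close> and
        \<open>n\<close> divides \<open>k\<close>.\<close>
      define q s where "q = k div n" and "s = k mod n"
      have gk: "g ^ k = (g ^ n) ^ q * g ^ s" 
        by (simp add: q_def s_def flip: power_mult power_add)
      have q: "((g ^ n) ^ q, y ^ q) \<in> M" by (rule partial_char_power[OF M y])
      then have "(inverse ((g ^ n) ^ q) * g ^ k, inverse (y ^ q) * x) \<in> M"
        using that by (metis partial_charD(2,3)[OF M])
      moreover have "inverse ((g ^ n) ^ q) * g ^ k = g ^ s"
        unfolding gk by (simp add: semifield_left_inverse flip: mult.assoc)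
      ultimately have s: "(g ^ s, inverse (y ^ q) * x) \<in> M" by simp
      have "s = 0"
      proof (rule ccontr)
        assume "s \<noteq> 0"
        moreover have "s < n" using n by (simp add: s_def)
        ultimately show False using not_less_Least[of s "\<lambda>n. n > 0 \<and> (\<exists>y. (g ^ n, y) \<in> M)"] s
          unfolding n_def[symmetric] by auto
      qed
      then have "k = n * q" using mult_div_mod_eq[of n k] by (simp add: q_def s_def)
      then show ?thesis
        using partial_char_unique[OF M that, of "y ^ q"] q c by (simp add: power_mult)
    qed
    moreover have "c \<noteq> 0" using c n partial_char_nonzero[OF M y] by auto
    ultimately show ?thesis by blast
  next
    case False
    have "x = 1 ^ k" if "(g ^ k, x) \<in> M" for k x
    proof -
      have "k = 0" using that False by auto
      then show ?thesis using that partial_charD(4)[OF M] by simp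
    qed
    then show ?thesis by (intro exI[of _ 1]) auto
  qed
  then obtain c where c: "c \<noteq> 0" "\<And>k x. (g ^ k, x) \<in> M \<Longrightarrow> c ^ k = x" by blast
  \<comment> \<open>The new elements are a g^(j-i). Natural exponents on both sides replace integer
    powers.\<close>
  define M' where "M' = {(b, z). \<exists>i j a x. (a, x) \<in> M \<and> b * g ^ i = a * g ^ j \<and> z * c ^ i = x * c ^ j}"
  have "partial_char M'"
    unfolding partial_char_def
  proof (intro conjI allI impI)
    show "(1, 1) \<in> M'"
      unfolding M'_def using partial_charD(1)[OF M]
      by (auto intro!: exI[of _ "0::nat"] exI[of _ "1::'a"] exI[of _ "1::'k"])
  next
    fix a x b y assume "(a, x) \<in> M'" "(b, y) \<in> M'"
    then obtain i j a' x' i' j' b' y' where *: "(a', x') \<in> M" "a * g ^ i = a' * g ^ j" "x * c ^ i = x' * c ^ j"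
      "(b', y') \<in> M" "b * g ^ i' = b' * g ^ j'" "y * c ^ i' = y' * c ^ j'"
      unfolding M'_def by blast
    have "(a * b) * g ^ (i + i') = (a * g ^ i) * (b * g ^ i')" by (simp only: power_add mult_ac)
    also have "\<dots> = (a' * b') * g ^ (j + j')" unfolding * by (simp only: power_add mult_ac)
    finally have 1: "(a * b) * g ^ (i + i') = (a' * b') * g ^ (j + j')" .
    have "(x * y) * c ^ (i + i') = (x * c ^ i) * (y * c ^ i')" by (simp only: power_add mult_ac)
    also have "\<dots> = (x' * y') * c ^ (j + j')" unfolding * by (simp only: power_add mult_ac)
    finally show "(a * b, x * y) \<in> M'"
      unfolding M'_def using 1 partial_charD(2)[OF M *(1,4)] by blast
  next
    fix a x assume "(a, x) \<in> M'"
    then obtain i j a' x' where *: "(a', x') \<in> M" "a * g ^ i = a' * g ^ j" "x * c ^ i = x' * c ^ j"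
      unfolding M'_def by blast
    have x': "x' \<noteq> 0" by (rule partial_char_nonzero[OF M *(1)])
    then have "x \<noteq> 0" using *(3) c(1) by auto
    then have 1: "inverse x * c ^ j = inverse x' * c ^ i" using *(3) x' by (simp add: field_simps)
    have "inverse a * g ^ j = inverse a * inverse a' * (a' * g ^ j)"
      by (simp only: mult.assoc semifield_cancel_left)
    also have "\<dots> = inverse a' * g ^ i * (inverse a * a)"
      unfolding *(2)[symmetric] by (simp only: mult_ac)
    finally show "(inverse a, inverse x) \<in> M'"
      unfolding M'_def using 1 partial_charD(3)[OF M *(1)] by (auto simp: semifield_left_inverse)
  next
    fix z assume "(1, z) \<in> M'"
    then obtain i j a x where *: "(a, x) \<in> M" "g ^ i = a * g ^ j" "z * c ^ i = x * c ^ j"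
      unfolding M'_def by auto
    \<comment> \<open>After cancelling the smaller power of \<open>g\<close>, a natural power
      \<open>g ^ k\<close> equals \<open>a\<close> or \<open>inverse a\<close>. It thus lies in the
      old domain, where \<open>c\<close> was chosen consistently.\<close>
    show "z = 1"
    proof (cases "j \<le> i")
      case True
      then obtain k where k: "i = k + j" by (metis le_add_diff_inverse2)
      then have "g ^ k = a" using *(2) by (simp add: power_add semifield_mult_cancel)
      then have "c ^ k = x" using c *(1) by metis
      moreover have "x \<noteq> 0" by (rule partial_char_nonzero[OF M *(1)])
      ultimately show ?thesis using *(3) c(1) by (simp add: k power_add)
    next
      case False
      then obtain k where k: "j = k + i" by (metis le_add_diff_inverse2 linear)
      then have "1 * g ^ i = (a * g ^ k) * g ^ i" using *(2) by (simp add: power_add mult.assoc)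
      then have "a * g ^ k = 1" by (simp only: semifield_mult_cancel)
      then have "g ^ k = inverse a" by (metis semifield_inverse_unique)
      then have "c ^ k = inverse x" using c partial_charD(3)[OF M *(1)] by metis
      moreover have "x \<noteq> 0" by (rule partial_char_nonzero[OF M *(1)])
      ultimately show ?thesis using *(3) c(1) by (simp add: k power_add)
    qed
  qed
  moreover have "M \<subseteq> M'"
  proof
    fix p assume "p \<in> M"
    then show "p \<in> M'" unfolding M'_def
      by (cases p) (auto intro!: exI[of _ "0::nat"])
  qed
  moreover have "(g, c) \<in> M'"
  proof -
    have "g * g ^ 0 = 1 * g ^ 1" "c * c ^ 0 = 1 * c ^ 1" by simp_all
    then show ?thesis unfolding M'_def using partial_charD(1)[OF M] by blast
  qed
  ultimately show ?thesis by blast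
qed

text \<open>The multiplicative group of an algebraically closed field is divisible, hence injective.\<close>

lemma partial_char_total:
  fixes G :: "('a::semifield \<times> 'k::alg_closed_field) set"
  assumes G: "partial_char G"
  shows "\<exists>\<theta>. (\<forall>a b. \<theta> (a * b) = \<theta> a * \<theta> b) \<and> \<theta> 1 = 1 \<and> (\<forall>a x. (a, x) \<in> G \<longrightarrow> \<theta> a = x)"
proof -
  have "\<exists>M\<in>{M. partial_char M \<and> G \<subseteq> M}. \<forall>X\<in>{M. partial_char M \<and> G \<subseteq> M}. M \<subseteq> X \<longrightarrow> X = M"
  proof (rule subset_Zorn_nonempty)
    show "{M. partial_char M \<and> G \<subseteq> M} \<noteq> {}" using G by blast
  next
    fix \<C> assume ne: "\<C> \<noteq> {}" and ch: "subset.chain {M. partial_char M \<and> G \<subseteq> M} \<C>"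
    have pc: "partial_char X \<and> G \<subseteq> X" if "X \<in> \<C>" for X
      using ch that by (auto simp: subset_chain_def)
    have both: "\<exists>X\<in>\<C>. a \<in> X \<and> b \<in> X" if "a \<in> \<Union>\<C>" "b \<in> \<Union>\<C>" for a b
      using ch that unfolding subset_chain_def by blast
    have "partial_char (\<Union>\<C>)"
      unfolding partial_char_def
    proof (intro conjI allI impI)
      show "(1, 1) \<in> \<Union>\<C>" using ne pc by (auto intro: partial_charD(1))
      show "(a * b, x * y) \<in> \<Union>\<C>" if "(a, x) \<in> \<Union>\<C>" "(b, y) \<in> \<Union>\<C>" for a b x y
        using both[OF that] pc by (auto intro: partial_charD(2))
      show "(inverse a, inverse x) \<in> \<Union>\<C>" if "(a, x) \<in> \<Union>\<C>" for a x
        using both[OF that that] pc by (auto intro: partial_charD(3))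
      show "x = 1" if "(1, x) \<in> \<Union>\<C>" for x
        using both[OF that that] pc by (auto intro: partial_charD(4))
    qed
    then show "\<Union>\<C> \<in> {M. partial_char M \<and> G \<subseteq> M}" using ne pc by blast
  qed
  then obtain M where M: "partial_char M" "G \<subseteq> M"
    and max: "\<And>X. partial_char X \<Longrightarrow> M \<subseteq> X \<Longrightarrow> X = M"
    by (auto dest: order_trans)
  have "\<exists>x. (g, x) \<in> M" for g
    using partial_char_extend[OF M(1), of g] max by blast
  then obtain \<theta> where \<theta>: "\<And>g. (g, \<theta> g) \<in> M" by metis
  have eq: "\<theta> a = x" if "(a, x) \<in> M" for a x
    using partial_char_unique[OF M(1) \<theta> that] .
  show ?thesis
    using eq partial_charD(2)[OF M(1) \<theta> \<theta>] partial_charD(1)[OF M(1)] M(2)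
    by (intro exI[of _ \<theta>]) auto
qed

section \<open>The character determined by \<psi> and by the roots\<close>

context exchange_data
begin

definition svar_monomial :: "('d \<Rightarrow>\<^sub>0 nat) \<Rightarrow> ('p, 'd) pbar" where
  "svar_monomial a = (\<Prod>d\<in>UNIV. svar d ^ Poly_Mapping.lookup a d)"

lemma svar_monomial_add: "svar_monomial (a + b) = svar_monomial a * svar_monomial b"
  by (simp add: svar_monomial_def lookup_add power_add prod.distrib)

lemma svar_monomial_0 [simp]: "svar_monomial 0 = 1"
  by (simp add: svar_monomial_def)

lemma svar_monomial_single [simp]: "svar_monomial (Poly_Mapping.single d 1) = svar d"
  by (simp add: svar_monomial_def lookup_single when_def if_distrib[of "\<lambda>n. _ ^ n"] prod.delta cong: if_cong)

lemma Rep_svar_monomial: "Rep_pbar (svar_monomial a) = Fract (monomial_eval pvar a) 1"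
  by (simp add: svar_monomial_def Rep_pbar_prod Rep_pbar_power svar.rep_eq Fract_power prod_Fract monomial_eval_finite)

text \<open>A quotient of monomials in the variables \<open>s\<close> that is symmetric in each block is a
  product of powers of top elementary symmetric polynomials.\<close>

lemma svar_monomial_specializes:
  fixes \<rho> :: "'d \<Rightarrow> 'k::field"
  assumes q: "specializes q p" and eq: "svar_monomial a = q * svar_monomial c"
    and \<rho>: "\<And>i. (\<Prod>l\<in>{1..r i}. \<rho> (\<delta> (i, l))) = 1"
  shows "p = 1 \<and> monomial_eval \<rho> a = monomial_eval \<rho> c"
proof -
  obtain f g where f: "f \<in> NPe r \<delta>" "g \<in> NPe r \<delta>" "\<psi>p f \<noteq> 0" "\<psi>p g \<noteq> 0"
    "Rep_pbar q = Fract f g" "p = un_El (\<psi>p f) / un_El (\<psi>p g)"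
    using q by (rule specializesE)
  have "Rep_pbar (svar_monomial a) = Rep_pbar (q * svar_monomial c)" using eq by simp
  then have "g * monomial_eval pvar a = f * monomial_eval pvar c"
    using f by (simp add: times_pbar.rep_eq Rep_svar_monomial eq_fract \<psi>p_nonzero mult.commute)
  note block = symmetric_monomial_quotient[OF f(2) \<psi>p_nonzero[OF f(4)] f(1) \<psi>p_nonzero[OF f(3)] this]
  \<comment> \<open>The exponent difference is constant on each block, so it can be read off at
    index 1; \<open>u\<close> and \<open>v\<close> are its positive and negative parts.\<close>
  define k where "k i = int (Poly_Mapping.lookup a (\<delta> (i, 1))) - int (Poly_Mapping.lookup c (\<delta> (i, 1)))" for i
  define u v where "u i = nat (k i)" and "v i = nat (- k i)" for i
  have uv: "Poly_Mapping.lookup a (\<delta> (i, l)) + v i = Poly_Mapping.lookup c (\<delta> (i, l)) + u i"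
    if "l \<in> {1..r i}" for i l
    using block[OF that, of 1] r_pos[of i] unfolding u_def v_def k_def by auto
  \<comment> \<open>Stated for an arbitrary commutative monoid because it is used twice: for
    \<open>\<rho>\<close> in the field and for the variables \<open>svar\<close> in
    \<open>pbar\<close>.\<close>
  have shift: "(\<Prod>d\<in>UNIV. x d ^ Poly_Mapping.lookup a d) * (\<Prod>i\<in>UNIV. (\<Prod>l\<in>{1..r i}. x (\<delta> (i, l))) ^ v i) =
      (\<Prod>d\<in>UNIV. x d ^ Poly_Mapping.lookup c d) * (\<Prod>i\<in>UNIV. (\<Prod>l\<in>{1..r i}. x (\<delta> (i, l))) ^ u i)"
    for x :: "'d \<Rightarrow> 'c::comm_monoid_mult"
  proof -
    have merge: "(\<Prod>d\<in>UNIV. x d ^ Poly_Mapping.lookup b d) * (\<Prod>i\<in>UNIV. (\<Prod>l\<in>{1..r i}. x (\<delta> (i, l))) ^ w i) =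
        (\<Prod>i\<in>UNIV. \<Prod>l\<in>{1..r i}. x (\<delta> (i, l)) ^ (Poly_Mapping.lookup b (\<delta> (i, l)) + w i))" for b w
      by (simp only: prod_\<delta> power_prod power_add prod.distrib)
    show ?thesis unfolding merge by (intro prod.cong refl) (simp only: uv)
  qed
  have "monomial_eval \<rho> a = monomial_eval \<rho> c"
    using shift[of \<rho>] \<rho> by (simp add: monomial_eval_finite)
  moreover have "p = 1"
  proof -
    \<comment> \<open>Powers of block products lie in S and specialize to 1. By
      \<open>shift\<close>, \<open>q\<close> is a quotient of two of them.\<close>
    define E where "E w = (\<Prod>i\<in>UNIV. (\<Prod>l\<in>{1..r i}. svar (\<delta> (i, l)) :: ('p, 'd) pbar) ^ w i)" for w
    have E: "specializes (E w) 1" for w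
      using specializes_prod[of UNIV "\<lambda>i. (\<Prod>l\<in>{1..r i}. svar (\<delta> (i, l))) ^ w i" "\<lambda>i. 1 ^ w i"]
        specializes_power[OF specializes_svar_prod] unfolding E_def by simp
    have "q * E v * svar_monomial c = E u * svar_monomial c"
      using shift[of "svar :: 'd \<Rightarrow> ('p, 'd) pbar"] unfolding svar_monomial_def[symmetric] eq E_def by (simp only: mult_ac)
    then have "q * E v = E u" by (simp only: semifield_mult_cancel)
    then show ?thesis
      using specializes_mult[OF q E[of v]] E[of u] specializes_unique by auto
  qed
  ultimately show ?thesis by blast
qed

text \<open>The prescriptions on S and on the variables overlap only in quotients of monomials,
  where both give 1. So they define a character on the subgroup generated by S and the variables,
  and this extends to the whole group.\<close>

lemma character_exists:
  fixes \<rho> :: "'d \<Rightarrow> 'k::alg_closed_field" and \<chi> :: "'p \<Rightarrow> 'k"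
  assumes \<rho>: "\<And>i. (\<Prod>l\<in>{1..r i}. \<rho> (\<delta> (i, l))) = 1"
    and \<chi>: "\<chi> 1 = 1" "\<And>a b. \<chi> (a * b) = \<chi> a * \<chi> b"
  shows "\<exists>\<theta>. (\<forall>a b. \<theta> (a * b) = \<theta> a * \<theta> b) \<and> \<theta> 1 = 1 \<and>
    (\<forall>q p. specializes q p \<longrightarrow> \<theta> q = \<chi> p) \<and> (\<forall>d. \<theta> (svar d) = \<rho> d)"
proof -
  have \<chi>inv: "\<chi> (inverse p) = inverse (\<chi> p)" and \<chi>0: "\<chi> p \<noteq> 0" for p
  proof -
    have "\<chi> p * \<chi> (inverse p) = 1" by (simp add: semifield_right_inverse \<chi> flip: \<chi>(2))
    then show "\<chi> (inverse p) = inverse (\<chi> p)" "\<chi> p \<noteq> 0" by (auto simp: inverse_unique)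
  qed
  have \<rho>0: "\<rho> d \<noteq> 0" for d
  proof -
    obtain i l where d: "d = \<delta> (i, l)" "1 \<le> l" "l \<le> r i" by (rule \<delta>_cases)
    then have "l \<in> {1..r i}" by simp
    then show ?thesis using \<rho>[of i] d(1) by (metis finite_atLeastAtMost prod_zero_iff zero_neq_one)
  qed
  have mon_add: "monomial_eval \<rho> (a + b) = monomial_eval \<rho> a * monomial_eval \<rho> b" for a b
    using monoid_map_monomial_eval[of \<rho>] by (simp add: monoid_map_def)
  have mon0: "monomial_eval \<rho> a \<noteq> 0" for a using \<rho>0 by (simp add: monomial_eval_eq_0)
  \<comment> \<open>The generated subgroup consists of the q s^c / s^a with q in S; two natural
    exponent vectors encode an integer one. In the last clause below, 1 = q s^c / s^a is exactly an
    element of the overlap.\<close>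
  define G where "G = {(b, z). \<exists>a c q p. specializes q p \<and> b * svar_monomial a = q * svar_monomial c \<and>
     z * monomial_eval \<rho> a = \<chi> p * monomial_eval \<rho> c}"
  have "partial_char G"
    unfolding partial_char_def
  proof (intro conjI allI impI)
    show "(1, 1) \<in> G" unfolding G_def using specializes_1 \<chi>(1) by fastforce
  next
    fix b z b' z' assume "(b, z) \<in> G" "(b', z') \<in> G"
    then obtain a c q p a' c' q' p' where *: "specializes q p" "b * svar_monomial a = q * svar_monomial c"
      "z * monomial_eval \<rho> a = \<chi> p * monomial_eval \<rho> c" "specializes q' p'"
      "b' * svar_monomial a' = q' * svar_monomial c'" "z' * monomial_eval \<rho> a' = \<chi> p' * monomial_eval \<rho> c'"
      unfolding G_def by blast
    have "(b * b') * svar_monomial (a + a') = (b * svar_monomial a) * (b' * svar_monomial a')"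
      by (simp only: svar_monomial_add mult_ac)
    also have "\<dots> = (q * q') * svar_monomial (c + c')"
      unfolding * by (simp only: svar_monomial_add mult_ac)
    finally have 1: "(b * b') * svar_monomial (a + a') = (q * q') * svar_monomial (c + c')" .
    have "(z * z') * monomial_eval \<rho> (a + a') = (z * monomial_eval \<rho> a) * (z' * monomial_eval \<rho> a')"
      by (simp only: mon_add mult_ac)
    also have "\<dots> = \<chi> (p * p') * monomial_eval \<rho> (c + c')"
      unfolding * by (simp only: mon_add \<chi> mult_ac)
    finally show "(b * b', z * z') \<in> G"
      unfolding G_def using 1 specializes_mult[OF *(1,4)] by blast
  next
    fix b z assume "(b, z) \<in> G"
    then obtain a c q p where *: "specializes q p" "b * svar_monomial a = q * svar_monomial c"
      "z * monomial_eval \<rho> a = \<chi> p * monomial_eval \<rho> c"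
      unfolding G_def by blast
    have "inverse b * svar_monomial c = inverse b * inverse q * (q * svar_monomial c)"
      by (simp only: mult.assoc semifield_cancel_left)
    also have "\<dots> = inverse q * svar_monomial a * (inverse b * b)"
      unfolding *(2)[symmetric] by (simp only: mult_ac)
    finally have 1: "inverse b * svar_monomial c = inverse q * svar_monomial a"
      by (simp add: semifield_left_inverse)
    have "z \<noteq> 0" using *(3) mon0 \<chi>0 by (metis mult_eq_0_iff)
    then have "inverse z * monomial_eval \<rho> c = \<chi> (inverse p) * monomial_eval \<rho> a"
      using *(3) \<chi>0[of p] by (simp add: \<chi>inv field_simps)
    with 1 show "(inverse b, inverse z) \<in> G"
      unfolding G_def using specializes_inverse[OF *(1)] by blast
  next
    fix z assume "(1, z) \<in> G"
    then obtain a c q p where *: "specializes q p" "svar_monomial a = q * svar_monomial c"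
      "z * monomial_eval \<rho> a = \<chi> p * monomial_eval \<rho> c"
      unfolding G_def by auto
    have "p = 1" "monomial_eval \<rho> a = monomial_eval \<rho> c"
      using svar_monomial_specializes[OF *(1,2), of \<rho>] \<rho> by auto
    then show "z = 1" using *(3) mon0 \<chi>(1) by simp
  qed
  then obtain \<theta> where \<theta>: "\<And>a b. \<theta> (a * b) = \<theta> a * \<theta> b" "\<theta> 1 = 1" "\<And>a x. (a, x) \<in> G \<Longrightarrow> \<theta> a = x"
    using partial_char_total by metis
  have "\<theta> q = \<chi> p" if "specializes q p" for q p
    by (rule \<theta>(3)) (use that in \<open>auto simp: G_def\<close>)
  moreover have "\<theta> (svar d) = \<rho> d" for d
  proof (rule \<theta>(3))
    have "svar d * svar_monomial 0 = 1 * svar_monomial (Poly_Mapping.single d 1)"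
      by (simp only: svar_monomial_single svar_monomial_0 mult_1 mult_1_right)
    moreover have "\<rho> d * monomial_eval \<rho> 0 = \<chi> 1 * monomial_eval \<rho> (Poly_Mapping.single d 1)"
      by (simp add: \<chi> monomial_eval_def)
    ultimately show "(svar d, \<rho> d) \<in> G" unfolding G_def using specializes_1 by blast
  qed
  ultimately show ?thesis using \<theta>(1,2) by blast
qed

end

section \<open>Generated subrings and the group ring\<close>

lemma type_ring_simps [simp]:
  "a \<otimes>\<^bsub>type_subring A\<^esub> b = a * b" "a \<oplus>\<^bsub>type_subring A\<^esub> b = a + b"
  "\<one>\<^bsub>type_subring A\<^esub> = 1" "\<zero>\<^bsub>type_subring A\<^esub> = 0"
  "a \<otimes>\<^bsub>ring_of_type_algebra\<^esub> b = a * (b :: 'a::field)" "a \<oplus>\<^bsub>ring_of_type_algebra\<^esub> b = a + b"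
  "\<one>\<^bsub>ring_of_type_algebra\<^esub> = (1 :: 'a)" "\<zero>\<^bsub>ring_of_type_algebra\<^esub> = (0 :: 'a)"
  "carrier (ring_of_type_algebra :: 'a ring) = UNIV"
  by (simp_all add: ring_of_type_algebra_def)

lemma type_ring_a_inv [simp]: "\<ominus>\<^bsub>ring_of_type_algebra\<^esub> a = - (a :: 'a::field)"
proof -
  interpret R: ring "ring_of_type_algebra :: 'a ring" by (rule ring_from_type_algebra)
  show ?thesis by (rule R.minus_equality) auto
qed

lemma generate_ring_type:
  fixes H :: "'a::field set"
  shows "1 \<in> generate_ring ring_of_type_algebra H"
    "0 \<in> generate_ring ring_of_type_algebra H"
    "h \<in> H \<Longrightarrow> h \<in> generate_ring ring_of_type_algebra H"
    "a \<in> generate_ring ring_of_type_algebra H \<Longrightarrow> - a \<in> generate_ring ring_of_type_algebra H"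
    "a \<in> generate_ring ring_of_type_algebra H \<Longrightarrow> b \<in> generate_ring ring_of_type_algebra H \<Longrightarrow>
      a + b \<in> generate_ring ring_of_type_algebra H"
    "a \<in> generate_ring ring_of_type_algebra H \<Longrightarrow> b \<in> generate_ring ring_of_type_algebra H \<Longrightarrow>
      a * b \<in> generate_ring ring_of_type_algebra H"
proof -
  let ?G = "generate_ring ring_of_type_algebra H"
  show 1: "1 \<in> ?G" using generate_ring.one[of ring_of_type_algebra H] by simp
  show "h \<in> H \<Longrightarrow> h \<in> ?G" by (rule generate_ring.incl)
  show m: "- a \<in> ?G" if "a \<in> ?G" for a using generate_ring.a_inv[OF that] by simp
  show p: "a + b \<in> ?G" if "a \<in> ?G" "b \<in> ?G" for a b using generate_ring.eng_add[OF that] by simp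
  show "a * b \<in> ?G" if "a \<in> ?G" "b \<in> ?G" for a b using generate_ring.eng_mult[OF that] by simp
  show "0 \<in> ?G" using p[OF 1 m[OF 1]] by simp
qed

lemma generate_ring_type_induct [consumes 1, case_names one incl uminus add mult]:
  fixes H :: "'a::field set"
  assumes "a \<in> generate_ring ring_of_type_algebra H"
    and "P 1" "\<And>h. h \<in> H \<Longrightarrow> P h" "\<And>a. P a \<Longrightarrow> P (- a)"
    "\<And>a b. P a \<Longrightarrow> P b \<Longrightarrow> P (a + b)" "\<And>a b. P a \<Longrightarrow> P b \<Longrightarrow> P (a * b)"
  shows "P a"
  using assms(1) by (induction rule: generate_ring.induct) (use assms in auto)

lemma gel_mult: "gel (p * q) = gel p * (gel q :: 'p::comm_monoid_mult zp)"
  by (simp add: gel_def mult_single plus_additive_def)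

lemma gel_1: "gel 1 = (1 :: 'p::comm_monoid_mult zp)"
  by (simp add: gel_def zero_additive_def flip: single_one)

lemma frag_cmul_eq_mult: "frag_cmul c a = of_int c * a"
  for a :: "'a::comm_monoid_add \<Rightarrow>\<^sub>0 int"
proof (rule poly_mapping_eqI)
  fix k
  have "of_int c = (Poly_Mapping.single 0 c :: 'a \<Rightarrow>\<^sub>0 int)"
    by (simp flip: single_of_int)
  then have "of_int c * a = Poly_Mapping.map ((*) c) a"
    by (simp add: mult_map_scale_conv_mult)
  then show "Poly_Mapping.lookup (frag_cmul c a) k = Poly_Mapping.lookup (of_int c * a) k"
    by (simp add: map.rep_eq when_def)
qed

lemma group_ring_map_eq:
  "group_ring_map f = pm_eval of_int (\<lambda>p. gel (f (of_additive p)) :: 'q::semifield zp)"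
  by (simp add: fun_eq_iff group_ring_map_def frag_extend_def pm_eval_def frag_cmul_eq_mult)

lemma semiring_map_pm_eval_additive:
  fixes \<theta> :: "'p::comm_monoid_mult \<Rightarrow> 'c::comm_ring_1"
  assumes "\<theta> 1 = 1" "\<And>a b. \<theta> (a * b) = \<theta> a * \<theta> b"
  shows "semiring_map (pm_eval of_int (\<lambda>p. \<theta> (of_additive p)))"
  by (rule semiring_map_pm_eval[OF semiring_map_of_int])
    (simp add: monoid_map_def zero_additive_def plus_additive_def assms)

lemma semiring_map_group_ring_map:
  fixes f :: "'p::comm_monoid_mult \<Rightarrow> 'q::semifield"
  assumes "f 1 = 1" "\<And>a b. f (a * b) = f a * f b"
  shows "semiring_map (group_ring_map f)"
  unfolding group_ring_map_eq by (rule semiring_map_pm_eval_additive) (simp_all add: assms gel_1 gel_mult)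

lemma group_ring_map_gel [simp]: "group_ring_map f (gel p) = gel (f p)"
  by (simp add: group_ring_map_def gel_def)

lemma group_ring_map_comp: "group_ring_map f (group_ring_map g a) = group_ring_map (\<lambda>p. f (g p)) a"
  unfolding group_ring_map_def frag_extend_def[of _ a]
  by (simp add: frag_extend_sum frag_extend_cmul gel_def)

lemma group_ring_on_map: "a \<in> group_ring_on C \<Longrightarrow> group_ring_map f a \<in> group_ring_on (f ` C)"
proof -
  assume "a \<in> group_ring_on C"
  then show ?thesis
    using keys_frag_extend[of "\<lambda>p. gel (f (of_additive p))" a]
    by (fastforce simp: group_ring_on_def group_ring_map_def gel_def)
qed

lemma group_ring_expand: "a = (\<Sum>k\<in>Poly_Mapping.keys a. of_int (Poly_Mapping.lookup a k) * gel (of_additive k))"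
  for a :: "'p::semifield zp"
  using frag_expansion[of a] by (simp add: frag_extend_def frag_cmul_eq_mult gel_def)

lemma pm_eval_gel: "pm_eval of_int (\<lambda>p. \<theta> (of_additive p)) (gel q) = (\<theta> q :: 'c::comm_ring_1)"
  by (simp add: gel_def pm_eval_single)

lemma pbar_of_mult: "pbar_of (p * q) = pbar_of p * pbar_of q"
  by (rule Rep_pbar_inject[THEN iffD1])
    (simp add: pbar_of.rep_eq times_pbar.rep_eq gel_mult semiring_mapD[OF semiring_map_pconst])

lemma pbar_of_1: "pbar_of 1 = 1"
  by (rule Rep_pbar_inject[THEN iffD1])
    (simp add: pbar_of.rep_eq one_pbar.rep_eq gel_1 semiring_mapD[OF semiring_map_pconst] One_fract_def)

lemma pbar_of_inject: "pbar_of p = pbar_of q \<longleftrightarrow> p = q"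
proof
  assume "pbar_of p = (pbar_of q :: ('a, 'b) pbar)"
  then have "Rep_pbar (pbar_of p :: ('a, 'b) pbar) = Rep_pbar (pbar_of q)" by simp
  then have "(pconst (gel p) :: ('a, 'b) zp_poly) = pconst (gel q)"
    by (simp add: pbar_of.rep_eq eq_fract)
  then have "gel p = gel q" unfolding pconst_def by (metis lookup_single_eq)
  then show "p = q" by (simp add: gel_def frag_of_eq)
qed simp

lemma semiring_map_zp_in: "semiring_map \<iota> \<Longrightarrow> semiring_map (zp_in \<iota>)"
  unfolding zp_in_def by (rule semiring_map_comp[OF _ semiring_map_Fract])

lemma zp_in_eq_0: "semiring_map \<iota> \<Longrightarrow> zp_in \<iota> a = 0 \<longleftrightarrow> a = 0"
  by (simp add: zp_in_def semiring_map_field_eq_0 Zero_fract_def eq_fract)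

lemma poly_eq_sum_le:
  "Polynomial.degree p \<le> n \<Longrightarrow> Polynomial.poly p (x::'a::comm_ring_1) = (\<Sum>l\<le>n. Polynomial.coeff p l * x ^ l)"
  unfolding poly_altdef by (rule sum.mono_neutral_left) (auto intro: le_degree)

lemma degree_map_poly_le:
  "f 0 = 0 \<Longrightarrow> Polynomial.degree (map_poly f p) \<le> Polynomial.degree p"
  by (rule degree_le) (simp add: coeff_map_poly coeff_eq_0)

lemma poly_map_poly_eq_sum:
  assumes "semiring_map f" "Polynomial.degree p \<le> n"
  shows "Polynomial.poly (map_poly f p) (x::'a::comm_ring_1) = (\<Sum>l\<le>n. f (Polynomial.coeff p l) * x ^ l)"
proof -
  have "Polynomial.degree (map_poly f p) \<le> n"
    using degree_map_poly_le[of f p, OF semiring_mapD(1)[OF assms(1)]] assms(2) by linarith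
  then show ?thesis
    by (simp add: poly_eq_sum_le coeff_map_poly semiring_mapD(1)[OF assms(1)])
qed

section \<open>The specialization homomorphism\<close>

locale ambient_data = exchange_data r \<delta> Z
  for r :: "'n::finite \<Rightarrow> nat" and \<delta> :: "'n \<times> nat \<Rightarrow> 'd::{finite, linorder}"
    and Z :: "'n \<Rightarrow> 'p::semifield zp poly" +
  fixes \<kappa> :: "('p, 'd) pbar qp \<Rightarrow> 'g::field" and x :: "'d \<Rightarrow> 'g"
  assumes \<kappa>: "semiring_map \<kappa>" and free: "free_generating \<kappa> x"
begin

abbreviation (input) scal :: "('p, 'd) pbar zp \<Rightarrow> 'g" where "scal \<equiv> zp_in \<kappa>"

definition X :: "'n \<Rightarrow> 'g" where "X i = (\<Prod>l\<in>{1..r i}. x (\<delta> (i, l)))"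

text \<open>The copy of the group ring of \<P> inside the ambient field of the composite pattern,
  where the specialization takes its scalar values.\<close>

definition hat_in :: "'p zp \<Rightarrow> 'g" where "hat_in a = scal (group_ring_map pbar_of a)"

lemmas scal = semiring_map_zp_in[OF \<kappa>]

lemma semiring_map_hat_in: "semiring_map hat_in"
  unfolding hat_in_def
  by (intro semiring_map_comp[OF scal] semiring_map_group_ring_map pbar_of_1 pbar_of_mult)

lemma hat_in_gel: "hat_in (gel p) = scal (gel (pbar_of p))"
  by (simp add: hat_in_def)

lemma hat_in_ZPX: "hat_in a \<in> ZPX \<kappa> X"
proof -
  have "group_ring_map pbar_of a \<in> group_ring_on (range (pbar_of :: 'p \<Rightarrow> ('p, 'd) pbar))"
    by (rule group_ring_on_map) (simp add: group_ring_on_def)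
  then show ?thesis unfolding ZPX_def hat_in_def by (intro generate_ring_type(3)) blast
qed

text \<open>The product of the \<open>\<rho> i l\<close> is the top elementary symmetric value,
  hence the leading coefficient 1 of \<open>Z i\<close>. This is precisely the condition under which
  a character with these values exists.\<close>

lemma specialized_roots_exist:
  "\<exists>\<rho>. \<forall>i. (\<Prod>l\<in>{1..r i}. \<rho> i l) = 1 \<and>
    (\<forall>l\<le>r i. elem_sym (r i) (\<rho> i) l = to_ac (hat_in (Polynomial.coeff (Z i) l)))"
proof -
  let ?f = "\<lambda>a. to_ac (hat_in a)"
  have f: "semiring_map ?f" by (rule semiring_map_comp[OF semiring_map_to_ac semiring_map_hat_in])
  have "\<exists>\<rho>. (\<Prod>l\<in>{1..r i}. \<rho> l) = 1 \<and>
    (\<forall>l\<le>r i. elem_sym (r i) \<rho> l = ?f (Polynomial.coeff (Z i) l))" for i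
  proof -
    have cf: "Polynomial.coeff (map_poly ?f (Z i)) l = ?f (Polynomial.coeff (Z i) l)" for l
      by (rule coeff_map_poly) (rule semiring_mapD(1)[OF f])
    have "\<exists>\<rho>. map_poly ?f (Z i) = (\<Prod>l\<in>{1..r i}. [:1, \<rho> l:])"
    proof (rule poly_splits_at_zero)
      show "Polynomial.coeff (map_poly ?f (Z i)) 0 = 1"
        unfolding cf Z_bot by (rule semiring_mapD(2)[OF f])
      show "Polynomial.degree (map_poly ?f (Z i)) \<le> r i"
        using degree_map_poly_le[of ?f "Z i", OF semiring_mapD(1)[OF f]] Z_degree[of i] by linarith
    qed
    then obtain \<rho> where "map_poly ?f (Z i) = (\<Prod>l\<in>{1..r i}. [:1, \<rho> l:])" by blast
    then have 1: "elem_sym (r i) \<rho> l = ?f (Polynomial.coeff (Z i) l)" if "l \<le> r i" for l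
      using coeff_prod_elem_sym[OF that, of \<rho>] cf[of l] by simp
    moreover have "(\<Prod>l\<in>{1..r i}. \<rho> l) = 1"
      using 1[of "r i"] by (simp add: elem_sym_top Z_top semiring_mapD(2)[OF semiring_map_hat_in])
    ultimately show ?thesis by blast
  qed
  then show ?thesis by (intro choice allI)
qed

text \<open>A character on all of \<open>pbar\<close> extends linearly to the group ring with
  nothing to verify. Its values on single variables s are roots in the closure, but those on S and
  on the \<open>ehat\<close> come from the base field.\<close>

lemma base_specialization_exists:
  "\<exists>h. semiring_map h \<and>
    (\<forall>q p. specializes q p \<longrightarrow> h (gel q) = to_ac (hat_in (gel p))) \<and>
    (\<forall>i. \<forall>l\<le>r i. h (ehat r \<delta> i l) = to_ac (hat_in (Polynomial.coeff (Z i) l)))"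
proof -
  obtain \<rho> :: "'n \<Rightarrow> nat \<Rightarrow> 'g alg_closure" where \<rho>: "\<And>i. (\<Prod>l\<in>{1..r i}. \<rho> i l) = 1"
    "\<And>i l. l \<le> r i \<Longrightarrow> elem_sym (r i) (\<rho> i) l = to_ac (hat_in (Polynomial.coeff (Z i) l))"
    using specialized_roots_exist by blast
  define s where "s d = (case unindex d of (i, l) \<Rightarrow> \<rho> i l)" for d
  have s: "s (\<delta> (i, l)) = \<rho> i l" if "l \<in> {1..r i}" for i l using that by (simp add: s_def)
  have s1: "(\<Prod>l\<in>{1..r i}. s (\<delta> (i, l))) = 1" for i
    unfolding \<rho>(1)[of i, symmetric] by (intro prod.cong refl) (rule s)
  obtain \<theta> :: "('p, 'd) pbar \<Rightarrow> 'g alg_closure" where \<theta>: "\<And>a b. \<theta> (a * b) = \<theta> a * \<theta> b" "\<theta> 1 = 1"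
    "\<And>q p. specializes q p \<Longrightarrow> \<theta> q = to_ac (hat_in (gel p))" "\<And>d. \<theta> (svar d) = s d"
    using character_exists[of s "\<lambda>p. to_ac (hat_in (gel p))", OF s1]
    by (auto simp: gel_1 gel_mult semiring_mapD[OF semiring_map_hat_in])
  define h where "h = pm_eval of_int (\<lambda>p. \<theta> (of_additive p))"
  have h: "semiring_map h" unfolding h_def by (rule semiring_map_pm_eval_additive[of \<theta>, OF \<theta>(2,1)])
  have hg: "h (gel q) = \<theta> q" for q unfolding h_def by (rule pm_eval_gel)
  have "h (ehat r \<delta> i l) = to_ac (hat_in (Polynomial.coeff (Z i) l))" if "l \<le> r i" for i l
  proof -
    have "h (ehat r \<delta> i l) = elem_sym (r i) (\<lambda>m. s (\<delta> (i, m))) l"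
      by (simp add: ehat_def semiring_map_elem_sym[OF h] hg \<theta>(4))
    also have "\<dots> = elem_sym (r i) (\<rho> i) l" by (rule elem_sym_cong) (rule s)
    finally show ?thesis using \<rho>(2)[OF that] by simp
  qed
  then show ?thesis using h hg \<theta>(3) by (intro exI[of _ h]) simp
qed

text \<open>Freeness is stated for coefficients in the fraction field; it passes to the group ring
  because that embeds in its fractions.\<close>

lemma poly_eval_inject:
  fixes P Q :: "('d \<Rightarrow>\<^sub>0 nat) \<Rightarrow>\<^sub>0 ('p, 'd) pbar zp"
  assumes "poly_eval scal x P = poly_eval scal x Q" shows "P = Q"
proof -
  have ev: "semiring_map (poly_eval scal x)"
    unfolding poly_eval_eq_pm_eval by (intro semiring_map_pm_eval scal monoid_map_monomial_eval)
  define R where "R = P - Q"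
  have "poly_eval scal x R = 0" unfolding R_def using assms by (simp add: semiring_map_diff[OF ev])
  moreover define F where "F = Poly_Mapping.map (\<lambda>a. Fract a 1) R"
  have F: "Poly_Mapping.lookup F m = Fract (Poly_Mapping.lookup R m) 1" for m
    by (simp add: F_def map.rep_eq when_def Zero_fract_def)
  have "Poly_Mapping.keys F = Poly_Mapping.keys R"
    by (auto simp: in_keys_iff F Zero_fract_def eq_fract)
  then have "poly_eval \<kappa> x F = poly_eval scal x R"
    by (simp add: poly_eval_def F zp_in_def)
  ultimately have "F = 0" using free by (simp add: free_generating_def)
  then have "Fract (Poly_Mapping.lookup R m) 1 = 0" for m using F[of m] by simp
  then have "R = 0" by (intro poly_mapping_eqI) (simp add: Zero_fract_def eq_fract)
  then show ?thesis by (simp add: R_def)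
qed

abbreviation (input) "\<psi>r \<equiv> psihat_ring \<kappa> r \<delta> Z X"
abbreviation (input) "ZSX \<equiv> ZSeX \<kappa> r \<delta> Z X"

lemma group_ring_sum_hat_in:
  assumes h: "semiring_map h" and "\<And>q p. specializes q p \<Longrightarrow> h (gel q) = to_ac (hat_in (gel p))"
    and a: "a \<in> group_ring_on (Ssf r \<delta> Z)"
  shows "h a = to_ac (hat_in (group_ring_map (psi r \<delta> Z) a))"
proof -
  let ?g = "\<lambda>a. to_ac (hat_in a)"
  have g: "semiring_map ?g" by (rule semiring_map_comp[OF semiring_map_to_ac semiring_map_hat_in])
  have "h (gel (of_additive k)) = ?g (gel (psi r \<delta> Z (of_additive k)))" if "k \<in> Poly_Mapping.keys a" for k
    using a that by (intro assms(2) specializes_psi) (auto simp: group_ring_on_def)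
  then show ?thesis
    by (subst group_ring_expand[of a])
      (simp add: group_ring_map_eq pm_eval_def semiring_map_sum[OF h] semiring_map_sum[OF g] semiring_mapD(4)[OF h]
        semiring_mapD(4)[OF g] semiring_map_int[OF h] semiring_map_int[OF g])
qed

text \<open>By freeness an element of the generated ring comes from only one polynomial in
  \<open>x\<close> over the group ring. Specializing the coefficients of that polynomial gives a
  value in the algebraic closure, which descends to the base field because the values of all
  generators do.\<close>

lemma psihat_ring_spec:
  "\<psi>r \<in> ring_hom (type_subring ZSX) (type_subring (ZPX \<kappa> X)) \<and>
   (\<forall>q\<in>Ssf r \<delta> Z. \<psi>r (scal (gel q)) = hat_in (gel (psi r \<delta> Z q))) \<and>
   (\<forall>(i, l)\<in>index_pairs r. \<psi>r (scal (ehat r \<delta> i l)) = hat_in (Polynomial.coeff (Z i) l)) \<and>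
   (\<forall>i. \<psi>r (X i) = X i)"
proof -
  obtain h where h: "semiring_map h"
    and hS: "\<And>q p. specializes q p \<Longrightarrow> h (gel q) = to_ac (hat_in (gel p))"
    and he: "\<And>i l. l \<le> r i \<Longrightarrow> h (ehat r \<delta> i l) = to_ac (hat_in (Polynomial.coeff (Z i) l))"
    using base_specialization_exists by blast
  define ev where "ev = poly_eval scal x"
  define sp where "sp = pm_eval h (monomial_eval (\<lambda>d. to_ac (x d)))"
  have ev: "semiring_map ev"
    unfolding ev_def poly_eval_eq_pm_eval by (intro semiring_map_pm_eval scal monoid_map_monomial_eval)
  have sp: "semiring_map sp"
    unfolding sp_def by (intro semiring_map_pm_eval h monoid_map_monomial_eval)
  have evc: "ev (pconst a) = scal a" and spc: "sp (pconst a) = h a" for a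
    unfolding ev_def sp_def poly_eval_eq_pm_eval pconst_def
    by (simp_all add: pm_eval_single semiring_mapD[OF scal] semiring_mapD[OF h] monomial_eval_def)
  have evv: "ev (pvar d) = x d" and spv: "sp (pvar d) = to_ac (x d)" for d
    unfolding ev_def sp_def poly_eval_eq_pm_eval pvar_def
    by (simp_all add: pm_eval_single semiring_mapD[OF scal] semiring_mapD[OF h])
  \<comment> \<open>\<open>b\<close> is the specialized value of \<open>f\<close>. The relation is
    single-valued because \<open>ev\<close> and \<open>to_ac\<close> are injective.\<close>
  define \<omega> where "\<omega> f b \<longleftrightarrow> (\<exists>P. f = ev P \<and> sp P = to_ac b)" for f b
  have \<omega>_unique: "b = b'" if "\<omega> f b" "\<omega> f b'" for f b b'
    using that poly_eval_inject unfolding \<omega>_def ev_def by (metis to_ac_eq_iff)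
  have \<omega>_add: "\<omega> (f + f') (b + b')" and \<omega>_mult: "\<omega> (f * f') (b * b')" if "\<omega> f b" "\<omega> f' b'" for f b f' b'
    using that unfolding \<omega>_def
    by (metis semiring_mapD(3)[OF ev] semiring_mapD(3)[OF sp] to_ac_add,
        metis semiring_mapD(4)[OF ev] semiring_mapD(4)[OF sp] to_ac_mult)
  have \<omega>_minus: "\<omega> (- f) (- b)" if "\<omega> f b" for f b
    using that unfolding \<omega>_def by (metis semiring_map_uminus[OF ev] semiring_map_uminus[OF sp] to_ac_minus)
  have \<omega>_1: "\<omega> 1 1"
    unfolding \<omega>_def by (intro exI[of _ 1]) (simp add: semiring_mapD[OF ev] semiring_mapD[OF sp])
  have \<omega>_S: "\<omega> (scal a) (hat_in (group_ring_map (psi r \<delta> Z) a))" if "a \<in> group_ring_on (Ssf r \<delta> Z)" for a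
    unfolding \<omega>_def using group_ring_sum_hat_in[OF h hS that]
    by (intro exI[of _ "pconst a"]) (simp add: evc spc)
  have \<omega>_e: "\<omega> (scal (ehat r \<delta> i l)) (hat_in (Polynomial.coeff (Z i) l))" if "l \<le> r i" for i l
    unfolding \<omega>_def by (intro exI[of _ "pconst (ehat r \<delta> i l)"]) (simp add: evc spc he[OF that])
  have \<omega>_X: "\<omega> (X i) (X i)" for i
    unfolding \<omega>_def
    by (intro exI[of _ "\<Prod>l\<in>{1..r i}. pvar (\<delta> (i, l))"])
      (simp add: semiring_map_prod[OF ev] semiring_map_prod[OF sp] evv spv X_def to_ac_prod)
  \<comment> \<open>Induction over generators shows at once that a value exists in the base field
    and that it lies in the polynomial ring \<open>ZPX\<close>.\<close>
  have total: "\<exists>b\<in>ZPX \<kappa> X. \<omega> f b" if "f \<in> ZSX" for f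
    using that unfolding ZSeX_def
  proof (induction rule: generate_ring_type_induct)
    case one
    then show ?case using \<omega>_1 generate_ring_type(1) by (auto simp: ZPX_def)
  next
    case (incl f)
    then consider a where "f = scal a" "a \<in> group_ring_on (Ssf r \<delta> Z)"
      | i l where "f = scal (ehat r \<delta> i l)" "l \<le> r i" | i where "f = X i"
      by (auto simp: index_pairs_def)
    then show ?case
    proof cases
      case 3
      then have "X i \<in> ZPX \<kappa> X" by (auto simp: ZPX_def intro!: generate_ring_type(3))
      then show ?thesis using \<omega>_X 3 by auto
    qed (use \<omega>_S \<omega>_e hat_in_ZPX in blast)+
  next
    case (uminus a)
    then show ?case using \<omega>_minus generate_ring_type(4) unfolding ZPX_def by blast
  next
    case (add a b)
    then show ?case using \<omega>_add generate_ring_type(5) unfolding ZPX_def by blast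
  next
    case (mult a b)
    then show ?case using \<omega>_mult generate_ring_type(6) unfolding ZPX_def by blast
  qed
  define h0 where "h0 f = (THE b. \<omega> f b)" for f
  have h0: "h0 f = b" if "\<omega> f b" for f b
    unfolding h0_def using that \<omega>_unique by blast
  have h0': "\<omega> f (h0 f) \<and> h0 f \<in> ZPX \<kappa> X" if "f \<in> ZSX" for f
    using total[OF that] h0 by metis
  let ?P = "\<lambda>h. h \<in> ring_hom (type_subring ZSX) (type_subring (ZPX \<kappa> X)) \<and>
     (\<forall>q\<in>Ssf r \<delta> Z. h (scal (gel q)) = scal (gel (pbar_of (psi r \<delta> Z q)))) \<and>
     (\<forall>(i, l)\<in>index_pairs r. h (scal (ehat r \<delta> i l)) =
        scal (group_ring_map pbar_of (Polynomial.coeff (Z i) l))) \<and>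
     (\<forall>i. h (X i) = X i)"
  have "?P h0"
  proof (intro conjI ballI allI)
    show "h0 \<in> ring_hom (type_subring ZSX) (type_subring (ZPX \<kappa> X))"
    proof (rule ring_hom_memI)
      fix f assume "f \<in> carrier (type_subring ZSX)"
      then show "h0 f \<in> carrier (type_subring (ZPX \<kappa> X))" using h0' by simp
    qed (use h0 h0' \<omega>_add \<omega>_mult \<omega>_1 in auto)
    show "h0 (scal (gel q)) = scal (gel (pbar_of (psi r \<delta> Z q)))" if "q \<in> Ssf r \<delta> Z" for q
    proof (rule h0)
      have "gel q \<in> group_ring_on (Ssf r \<delta> Z)" using that by (simp add: group_ring_on_def gel_def)
      from \<omega>_S[OF this] show "\<omega> (scal (gel q)) (scal (gel (pbar_of (psi r \<delta> Z q))))"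
        by (simp add: hat_in_gel)
    qed
    show "h0 (X i) = X i" for i by (rule h0) (rule \<omega>_X)
    show "case p of (i, l) \<Rightarrow> h0 (scal (ehat r \<delta> i l)) =
        scal (group_ring_map pbar_of (Polynomial.coeff (Z i) l))" if "p \<in> index_pairs r" for p
      using that \<omega>_e by (auto simp: index_pairs_def hat_in_def intro!: h0)
  qed
  then have "?P \<psi>r" unfolding psihat_ring_def by (rule someI[where P = ?P])
  then show ?thesis by (simp add: hat_in_gel hat_in_def)
qed

section \<open>Specialization of fractions\<close>

lemma \<psi>r_hom:
  assumes "f \<in> ZSX" "g \<in> ZSX"
  shows "\<psi>r (f + g) = \<psi>r f + \<psi>r g" "\<psi>r (f * g) = \<psi>r f * \<psi>r g"
  using psihat_ring_spec assms
  by (auto dest: ring_hom_add[of _ "type_subring ZSX" _ f g] ring_hom_mult[of _ "type_subring ZSX" _ f g])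

lemma ZSX_ring: "1 \<in> ZSX" "0 \<in> ZSX" "f \<in> ZSX \<Longrightarrow> - f \<in> ZSX" "f \<in> ZSX \<Longrightarrow> g \<in> ZSX \<Longrightarrow> f + g \<in> ZSX"
  "f \<in> ZSX \<Longrightarrow> g \<in> ZSX \<Longrightarrow> f * g \<in> ZSX"
  unfolding ZSeX_def by (simp_all add: generate_ring_type)

lemma \<psi>r_1: "\<psi>r 1 = 1"
  using ring_hom_one[OF conjunct1[OF psihat_ring_spec]] by simp

lemma \<psi>r_0: "\<psi>r 0 = 0"
proof -
  have "\<psi>r 0 = \<psi>r 0 + \<psi>r 0" using \<psi>r_hom(1)[OF ZSX_ring(2,2)] by (simp only: add_0_left)
  then show ?thesis unfolding add_cancel_right_right .
qed

lemma \<psi>r_minus: "f \<in> ZSX \<Longrightarrow> \<psi>r (- f) = - \<psi>r f"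
  using \<psi>r_hom(1)[of f "- f"] by (simp add: ZSX_ring \<psi>r_0 add_eq_0_iff)

text \<open>The graph of psi-hat on its algebra of fractions, used like \<open>specializes\<close>:
  a derivation of \<open>hat_specializes a b\<close> proves membership of \<open>a\<close> and
  computes its value.\<close>

definition hat_specializes :: "'g \<Rightarrow> 'g \<Rightarrow> bool" where
  "hat_specializes a b \<longleftrightarrow> (\<exists>f\<in>ZSX. \<exists>g\<in>ZSX. \<psi>r g \<noteq> 0 \<and> a = f / g \<and> b = \<psi>r f / \<psi>r g)"

lemma hat_specializesI:
  "\<lbrakk>f \<in> ZSX; g \<in> ZSX; \<psi>r g \<noteq> 0; a = f / g; b = \<psi>r f / \<psi>r g\<rbrakk> \<Longrightarrow> hat_specializes a b"
  unfolding hat_specializes_def by blast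

lemma hat_specializesE:
  assumes "hat_specializes a b"
  obtains f g where "f \<in> ZSX" "g \<in> ZSX" "\<psi>r g \<noteq> 0" "g \<noteq> 0" "a = f / g" "b = \<psi>r f / \<psi>r g"
  using assms \<psi>r_0 unfolding hat_specializes_def by metis

lemma hat_specializes_unique:
  assumes "hat_specializes a b" "hat_specializes a b'" shows "b = b'"
proof -
  obtain f g where f: "f \<in> ZSX" "g \<in> ZSX" "\<psi>r g \<noteq> 0" "g \<noteq> 0" "a = f / g" "b = \<psi>r f / \<psi>r g"
    using assms(1) by (rule hat_specializesE)
  obtain f' g' where f': "f' \<in> ZSX" "g' \<in> ZSX" "\<psi>r g' \<noteq> 0" "g' \<noteq> 0" "a = f' / g'" "b' = \<psi>r f' / \<psi>r g'"
    using assms(2) by (rule hat_specializesE)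
  have "f * g' = f' * g" using f f' by (simp add: frac_eq_eq)
  then have "\<psi>r f * \<psi>r g' = \<psi>r f' * \<psi>r g" using f f' by (metis \<psi>r_hom(2))
  then show ?thesis using f f' by (simp add: frac_eq_eq)
qed

lemma Scal_iff: "a \<in> Scal \<kappa> r \<delta> Z X \<longleftrightarrow> (\<exists>b. hat_specializes a b)"
  unfolding Scal_def hat_specializes_def by blast

lemma psihat_eq: "hat_specializes a b \<Longrightarrow> psihat \<kappa> r \<delta> Z X a = b"
  unfolding psihat_def hat_specializes_def[symmetric]
  by (rule the_equality) (auto intro: hat_specializes_unique)

lemma hat_specializes_ZSX: "f \<in> ZSX \<Longrightarrow> hat_specializes f (\<psi>r f)"
  by (rule hat_specializesI[where f = f and g = 1]) (simp_all add: ZSX_ring \<psi>r_1)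

lemma hat_specializes_add:
  assumes "hat_specializes a b" "hat_specializes a' b'" shows "hat_specializes (a + a') (b + b')"
proof -
  obtain f g where f: "f \<in> ZSX" "g \<in> ZSX" "\<psi>r g \<noteq> 0" "g \<noteq> 0" "a = f / g" "b = \<psi>r f / \<psi>r g"
    using assms(1) by (rule hat_specializesE)
  obtain f' g' where f': "f' \<in> ZSX" "g' \<in> ZSX" "\<psi>r g' \<noteq> 0" "g' \<noteq> 0" "a' = f' / g'" "b' = \<psi>r f' / \<psi>r g'"
    using assms(2) by (rule hat_specializesE)
  show ?thesis
    by (rule hat_specializesI[where f = "f * g' + f' * g" and g = "g * g'"])
      (use f f' in \<open>simp_all add: ZSX_ring \<psi>r_hom add_frac_eq\<close>)
qed

lemma hat_specializes_mult:
  assumes "hat_specializes a b" "hat_specializes a' b'" shows "hat_specializes (a * a') (b * b')"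
proof -
  obtain f g where f: "f \<in> ZSX" "g \<in> ZSX" "\<psi>r g \<noteq> 0" "g \<noteq> 0" "a = f / g" "b = \<psi>r f / \<psi>r g"
    using assms(1) by (rule hat_specializesE)
  obtain f' g' where f': "f' \<in> ZSX" "g' \<in> ZSX" "\<psi>r g' \<noteq> 0" "g' \<noteq> 0" "a' = f' / g'" "b' = \<psi>r f' / \<psi>r g'"
    using assms(2) by (rule hat_specializesE)
  show ?thesis
    by (rule hat_specializesI[where f = "f * f'" and g = "g * g'"])
      (use f f' in \<open>simp_all add: ZSX_ring \<psi>r_hom\<close>)
qed

lemma hat_specializes_uminus:
  assumes "hat_specializes a b" shows "hat_specializes (- a) (- b)"
proof -
  obtain f g where f: "f \<in> ZSX" "g \<in> ZSX" "\<psi>r g \<noteq> 0" "g \<noteq> 0" "a = f / g" "b = \<psi>r f / \<psi>r g"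
    using assms(1) by (rule hat_specializesE)
  show ?thesis
    by (rule hat_specializesI[where f = "- f" and g = g]) (use f in \<open>simp_all add: ZSX_ring \<psi>r_minus\<close>)
qed

lemma hat_specializes_inverse:
  assumes "hat_specializes a b" "b \<noteq> 0" shows "hat_specializes (inverse a) (inverse b)"
proof -
  obtain f g where f: "f \<in> ZSX" "g \<in> ZSX" "\<psi>r g \<noteq> 0" "g \<noteq> 0" "a = f / g" "b = \<psi>r f / \<psi>r g"
    using assms(1) by (rule hat_specializesE)
  show ?thesis
    by (rule hat_specializesI[where f = g and g = f]) (use f assms(2) in simp_all)
qed

lemma hat_specializes_0: "hat_specializes 0 0" and hat_specializes_1: "hat_specializes 1 1"
  using hat_specializes_ZSX[OF ZSX_ring(2)] hat_specializes_ZSX[OF ZSX_ring(1)]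
  by (simp_all add: \<psi>r_0 \<psi>r_1)

lemma hat_specializes_divide:
  "\<lbrakk>hat_specializes a b; hat_specializes a' b'; b' \<noteq> 0\<rbrakk> \<Longrightarrow> hat_specializes (a / a') (b / b')"
  unfolding divide_inverse by (intro hat_specializes_mult hat_specializes_inverse)

lemma hat_specializes_prod:
  "(\<And>i. i \<in> A \<Longrightarrow> hat_specializes (a i) (b i)) \<Longrightarrow> hat_specializes (prod a A) (prod b A)"
  by (induction A rule: infinite_finite_induct) (auto intro: hat_specializes_1 hat_specializes_mult)

lemma hat_specializes_sum:
  "(\<And>i. i \<in> A \<Longrightarrow> hat_specializes (a i) (b i)) \<Longrightarrow> hat_specializes (sum a A) (sum b A)"
  by (induction A rule: infinite_finite_induct) (auto intro: hat_specializes_0 hat_specializes_add)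

lemma hat_specializes_power: "hat_specializes a b \<Longrightarrow> hat_specializes (a ^ n) (b ^ n)"
  by (induction n) (auto intro: hat_specializes_1 hat_specializes_mult)

lemma hat_specializes_power_int:
  "hat_specializes a b \<Longrightarrow> b \<noteq> 0 \<Longrightarrow> hat_specializes (a powi n) (b powi n)"
  by (simp add: power_int_def hat_specializes_power hat_specializes_inverse)

lemma hat_specializes_of_int: "hat_specializes (of_int n) (of_int n)"
proof (induction n rule: int_induct[of _ 0])
  case (step2 n)
  then show ?case using hat_specializes_add[OF step2(2) hat_specializes_uminus[OF hat_specializes_1]] by simp
qed (auto intro: hat_specializes_0 hat_specializes_1 hat_specializes_add)

lemma hat_specializes_scal:
  assumes "specializes q p" shows "hat_specializes (scal (gel q)) (hat_in (gel p))"
proof -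
  have q: "q \<in> Ssf r \<delta> Z" using assms Ssf_iff by blast
  then have "gel q \<in> group_ring_on (Ssf r \<delta> Z)" by (simp add: group_ring_on_def gel_def)
  then have "scal (gel q) \<in> ZSX" unfolding ZSeX_def by (intro generate_ring_type(3)) blast
  from hat_specializes_ZSX[OF this] show ?thesis
    using psihat_ring_spec q psi_eq[OF assms] by auto
qed

lemma hat_specializes_group_ring:
  assumes "a \<in> group_ring_on (Ssf r \<delta> Z)"
  shows "hat_specializes (scal a) (hat_in (group_ring_map (psi r \<delta> Z) a))"
proof -
  have "scal a = (\<Sum>k\<in>Poly_Mapping.keys a. of_int (Poly_Mapping.lookup a k) * scal (gel (of_additive k)))"
    by (subst group_ring_expand[of a])
      (simp add: semiring_map_sum[OF scal] semiring_mapD(4)[OF scal] semiring_map_int[OF scal])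
  moreover have "hat_in (group_ring_map (psi r \<delta> Z) a) =
      (\<Sum>k\<in>Poly_Mapping.keys a. of_int (Poly_Mapping.lookup a k) * hat_in (gel (psi r \<delta> Z (of_additive k))))"
    by (simp add: group_ring_map_eq pm_eval_def semiring_map_sum[OF semiring_map_hat_in]
        semiring_mapD(4)[OF semiring_map_hat_in] semiring_map_int[OF semiring_map_hat_in])
  moreover have "hat_specializes (scal (gel (of_additive k))) (hat_in (gel (psi r \<delta> Z (of_additive k))))"
    if "k \<in> Poly_Mapping.keys a" for k
    using assms that by (intro hat_specializes_scal specializes_psi) (auto simp: group_ring_on_def)
  ultimately show ?thesis
    by (auto intro!: hat_specializes_sum hat_specializes_mult hat_specializes_of_int)
qed

lemma hat_specializes_X: "hat_specializes (X i) (X i)"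
proof -
  have "X i \<in> ZSX" unfolding ZSeX_def by (intro generate_ring_type(3)) blast
  from hat_specializes_ZSX[OF this] show ?thesis using psihat_ring_spec by auto
qed

lemma hat_specializes_ehat:
  assumes "l \<le> r i"
  shows "hat_specializes (scal (ehat r \<delta> i l)) (hat_in (Polynomial.coeff (Z i) l))"
proof (cases "l = 0")
  case True
  then show ?thesis
    by (simp add: ehat_def Z_bot semiring_mapD[OF scal] semiring_mapD[OF semiring_map_hat_in] hat_specializes_1)
next
  case False
  then have il: "(i, l) \<in> index_pairs r" using assms by (simp add: index_pairs_def)
  then have "scal (ehat r \<delta> i l) \<in> ZSX" unfolding ZSeX_def by (intro generate_ring_type(3)) blast
  from hat_specializes_ZSX[OF this] show ?thesis using psihat_ring_spec il by auto
qed

text \<open>The analogue of \<open>specializes_factor\<close> for the addition of the group ring: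
  here the product expands with the \<open>ehat\<close> as coefficients, and these go to the
  coefficients of \<open>Z i\<close> themselves instead of their projections to the
  semifield.\<close>

lemma hat_specializes_factor:
  assumes "hat_specializes a b"
  shows "hat_specializes (\<Prod>l\<in>{1..r i}. 1 + scal (gel (svar (\<delta> (i, l)))) * a)
    (Polynomial.poly (map_poly hat_in (Z i)) b)"
proof -
  have "(\<Prod>l\<in>{1..r i}. 1 + scal (gel (svar (\<delta> (i, l)))) * a) =
      (\<Sum>l\<le>r i. scal (ehat r \<delta> i l) * a ^ l)"
    by (simp only: prod_1_add_elem_sym[where s = "\<lambda>l. scal (gel (svar (\<delta> (i, l))))"] ehat_def
        semiring_map_elem_sym[OF scal])
  moreover have "Polynomial.poly (map_poly hat_in (Z i)) b =
      (\<Sum>l\<le>r i. hat_in (Polynomial.coeff (Z i) l) * b ^ l)"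
    by (rule poly_map_poly_eq_sum[OF semiring_map_hat_in Z_degree])
  ultimately show ?thesis
    by (auto intro!: hat_specializes_sum hat_specializes_mult hat_specializes_ehat hat_specializes_power assms)
qed

end

section \<open>Composite mutations\<close>

lemma power_int_mult_distrib_semifield: "(a * b) powi n = a powi n * (b powi n :: 'a::semifield)"
  by (simp add: power_int_def power_mult_distrib semifield_inverse_mult)

lemma power_int_one_semifield: "1 powi n = (1 :: 'a::semifield)"
  by (simp add: power_int_def)

lemma power_int_prod_semifield: "prod f A powi n = (\<Prod>a\<in>A. f a powi n :: 'a::semifield)"
  by (induction A rule: infinite_finite_induct)
    (simp_all add: power_int_mult_distrib_semifield power_int_one_semifield)

lemma power_int_prod_field: "prod f A powi n = (\<Prod>a\<in>A. f a powi n :: 'a::field)"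
  by (induction A rule: infinite_finite_induct) (simp_all add: power_int_mult_distrib)

lemma inverse_prod_semifield: "inverse (prod f A) = (\<Prod>a\<in>A. inverse (f a) :: 'a::semifield)"
  by (induction A rule: infinite_finite_induct) (simp_all add: semifield_inverse_mult)

lemma gel_prod: "gel (prod f A) = (\<Prod>a\<in>A. gel (f a) :: 'p::semifield zp)"
  by (induction A rule: infinite_finite_induct) (simp_all add: gel_1 gel_mult)

lemma gel_nonzero: "gel p \<noteq> 0"
  by (simp add: gel_def)

text \<open>As 1 + u is its own reversal, ordinary exchange polynomials persist and can be
  eliminated from the mutation rule.\<close>

lemma mutation_ordinary:
  fixes \<kappa> :: "'q::semifield qp \<Rightarrow> 'g::field" and S :: "('d::finite, 'q, 'g) seed"
  assumes \<kappa>: "semiring_map \<kappa>" and Z: "Zs S = (\<lambda>_. [:1, 1:])"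
  shows "xs (mutation \<kappa> e S) = (\<lambda>i. if i = e
      then inverse (xs S e) * (\<Prod>j\<in>UNIV. xs S j ^ nat (- Bm S j e))
        * (1 + zp_in \<kappa> (gel (ys S e)) * (\<Prod>j\<in>UNIV. xs S j powi Bm S j e)) / zp_in \<kappa> (gel (1 + ys S e))
      else xs S i)"
    and "ys (mutation \<kappa> e S) = (\<lambda>i. if i = e then inverse (ys S e)
      else ys S i * (ys S e ^ nat (Bm S e i) * (1 + ys S e) powi (- Bm S e i)))"
    and "Zs (mutation \<kappa> e S) = (\<lambda>_. [:1, 1:])"
    and "Bm (mutation \<kappa> e S) = (\<lambda>i j. if i = e \<or> j = e then - Bm S i j
      else Bm S i j + (Bm S i e * max (Bm S e j) 0 + max (- Bm S i e) 0 * Bm S e j))"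
proof -
  have "eval_P0 [:1, 1:] y = El (1 + y)" for y :: 'q
    by (simp add: eval_P0_def El_1[symmetric])
  then have e: "un_El (eval_P0 [:1, 1:] y) = 1 + y" for y :: 'q by simp
  have p: "Polynomial.poly (map_poly (zp_in \<kappa>) [:1, 1:]) u = 1 + u" for u
    using semiring_map_zp_in[OF \<kappa>] by (simp add: map_poly_pCons semiring_mapD)
  have rf: "reflect_poly [:1, 1 :: 'q zp:] = [:1, 1:]"
    by (simp add: reflect_poly_def)
  show "xs (mutation \<kappa> e S) = (\<lambda>i. if i = e
      then inverse (xs S e) * (\<Prod>j\<in>UNIV. xs S j ^ nat (- Bm S j e))
        * (1 + zp_in \<kappa> (gel (ys S e)) * (\<Prod>j\<in>UNIV. xs S j powi Bm S j e)) / zp_in \<kappa> (gel (1 + ys S e))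
      else xs S i)"
    "ys (mutation \<kappa> e S) = (\<lambda>i. if i = e then inverse (ys S e)
      else ys S i * (ys S e ^ nat (Bm S e i) * (1 + ys S e) powi (- Bm S e i)))"
    "Zs (mutation \<kappa> e S) = (\<lambda>_. [:1, 1:])"
    "Bm (mutation \<kappa> e S) = (\<lambda>i j. if i = e \<or> j = e then - Bm S i j
      else Bm S i j + (Bm S i e * max (Bm S e j) 0 + max (- Bm S i e) 0 * Bm S e j))"
    by (simp_all add: gen_mutation_def Let_def Z e p rf fun_eq_iff mult.assoc)
qed

context index_data
begin



text \<open>Because \<open>b k k = 0\<close>, mutations inside block \<open>k\<close> do not disturb
  one another: each uses the original x, y and matrix entries of its own direction, while the other
  blocks accumulate one coefficient factor and one matrix correction per mutation.\<close>

lemma fold_mutation: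
  fixes \<kappa> :: "'q::semifield qp \<Rightarrow> 'g::field" and S :: "('d, 'q, 'g) seed" and b :: "'n \<Rightarrow> 'n \<Rightarrow> int"
  assumes \<kappa>: "semiring_map \<kappa>" and Z: "Zs S = (\<lambda>_. [:1, 1:])"
    and B: "\<forall>i j. \<forall>l\<in>{1..r i}. \<forall>m\<in>{1..r j}. Bm S (\<delta> (i, l)) (\<delta> (j, m)) = b i j"
    and b: "b k k = 0" and m: "m \<le> r k"
  defines "x \<equiv> \<lambda>i l. xs S (\<delta> (i, l))" and "y \<equiv> \<lambda>i l. ys S (\<delta> (i, l))"
  defines "S' \<equiv> fold (\<lambda>l. mutation \<kappa> (\<delta> (k, l))) [1..<Suc m] S"
  shows "Zs S' = (\<lambda>_. [:1, 1:]) \<and>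
    (\<forall>i. \<forall>l\<in>{1..r i}. xs S' (\<delta> (i, l)) = (if i = k \<and> l \<le> m
       then inverse (x k l) * (\<Prod>i\<in>UNIV. (\<Prod>l\<in>{1..r i}. x i l) ^ nat (- b i k))
         * (1 + zp_in \<kappa> (gel (y k l)) * (\<Prod>i\<in>UNIV. (\<Prod>l\<in>{1..r i}. x i l) powi b i k))
         / zp_in \<kappa> (gel (1 + y k l))
       else x i l)) \<and>
    (\<forall>i. \<forall>l\<in>{1..r i}. ys S' (\<delta> (i, l)) = (if i = k then if l \<le> m then inverse (y k l) else y k l
       else y i l * (\<Prod>l\<in>{1..m}. y k l ^ nat (b k i) * (1 + y k l) powi (- b k i)))) \<and>
    (\<forall>i j. \<forall>l\<in>{1..r i}. \<forall>l'\<in>{1..r j}. Bm S' (\<delta> (i, l)) (\<delta> (j, l')) =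
       (if i = k \<and> l \<le> m \<or> j = k \<and> l' \<le> m then - b i j
        else b i j + int m * (b i k * max (b k j) 0 + max (- b i k) 0 * b k j)))"
  using m unfolding S'_def
proof (induction m)
  case 0
  then show ?case by (simp add: Z x_def y_def B)
next
  case (Suc m)
  define T where "T = fold (\<lambda>l. mutation \<kappa> (\<delta> (k, l))) [1..<Suc m] S"
  let ?e = "\<delta> (k, Suc m)"
  define M where "M = (\<Prod>i\<in>UNIV. (\<Prod>l\<in>{1..r i}. x i l) ^ nat (- b i k))"
  define V where "V = (\<Prod>i\<in>UNIV. (\<Prod>l\<in>{1..r i}. x i l) powi b i k)"
  define nx where "nx l = inverse (x k l) * M * (1 + zp_in \<kappa> (gel (y k l)) * V) / zp_in \<kappa> (gel (1 + y k l))" for l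
  define c where "c i j = b i k * max (b k j) 0 + max (- b i k) 0 * b k j" for i j
  \<comment> \<open>Corrections vanish in row and column \<open>k\<close>, so the next direction of
    the block still sees the original entries of B.\<close>
  have ck: "c i k = 0" "c k i = 0" for i by (simp_all add: c_def b)
  have Sm: "1 \<le> Suc m" "Suc m \<le> r k" using Suc.prems by auto
  have IH: "Zs T = (\<lambda>_. [:1, 1:])"
    "\<And>i l. l \<in> {1..r i} \<Longrightarrow> xs T (\<delta> (i, l)) = (if i = k \<and> l \<le> m then nx l else x i l)"
    "\<And>i l. l \<in> {1..r i} \<Longrightarrow> ys T (\<delta> (i, l)) = (if i = k then if l \<le> m then inverse (y k l) else y k l
       else y i l * (\<Prod>l\<in>{1..m}. y k l ^ nat (b k i) * (1 + y k l) powi (- b k i)))"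
    "\<And>i j l l'. l \<in> {1..r i} \<Longrightarrow> l' \<in> {1..r j} \<Longrightarrow> Bm T (\<delta> (i, l)) (\<delta> (j, l')) =
       (if i = k \<and> l \<le> m \<or> j = k \<and> l' \<le> m then - b i j else b i j + int m * c i j)"
    using Suc unfolding T_def[symmetric] M_def[symmetric] V_def[symmetric] nx_def[symmetric] c_def[symmetric]
    by (simp_all del: One_nat_def)
  have step: "fold (\<lambda>l. mutation \<kappa> (\<delta> (k, l))) [1..<Suc (Suc m)] S = mutation \<kappa> ?e T"
    by (simp add: T_def)
  note mut = mutation_ordinary[OF \<kappa> IH(1), of ?e]
  have Bcol: "Bm T (\<delta> (i, l)) ?e = b i k" if "l \<in> {1..r i}" for i l
    using IH(4)[OF that, of "Suc m" k] Sm by (auto simp: ck b)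
  have Brow: "Bm T ?e (\<delta> (i, l)) = b k i" if "l \<in> {1..r i}" for i l
    using IH(4)[OF _ that, of "Suc m" k] Sm by (auto simp: ck b)
  have ye: "ys T ?e = y k (Suc m)" and xe: "xs T ?e = x k (Suc m)"
    using IH(2,3)[of "Suc m" k] Sm by auto
  \<comment> \<open>Variables of block \<open>k\<close> that have already been mutated occur with
    exponent \<open>b k k = 0\<close>.\<close>
  have M': "(\<Prod>j\<in>UNIV. xs T j ^ nat (- Bm T j ?e)) = M"
    unfolding prod_\<delta> M_def
  proof (rule prod.cong[OF refl])
    fix i
    have "(\<Prod>l\<in>{1..r i}. xs T (\<delta> (i, l)) ^ nat (- Bm T (\<delta> (i, l)) ?e)) = (\<Prod>l\<in>{1..r i}. x i l ^ nat (- b i k))"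
      by (rule prod.cong[OF refl]) (auto simp: Bcol IH(2) b)
    then show "(\<Prod>l\<in>{1..r i}. xs T (\<delta> (i, l)) ^ nat (- Bm T (\<delta> (i, l)) ?e)) = (\<Prod>l\<in>{1..r i}. x i l) ^ nat (- b i k)"
      by (simp add: power_prod)
  qed
  have V': "(\<Prod>j\<in>UNIV. xs T j powi Bm T j ?e) = V"
    unfolding prod_\<delta> V_def
  proof (rule prod.cong[OF refl])
    fix i
    have "(\<Prod>l\<in>{1..r i}. xs T (\<delta> (i, l)) powi Bm T (\<delta> (i, l)) ?e) = (\<Prod>l\<in>{1..r i}. x i l powi b i k)"
      by (rule prod.cong[OF refl]) (auto simp: Bcol IH(2) b)
    then show "(\<Prod>l\<in>{1..r i}. xs T (\<delta> (i, l)) powi Bm T (\<delta> (i, l)) ?e) = (\<Prod>l\<in>{1..r i}. x i l) powi b i k"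
      by (simp add: power_int_prod_field)
  qed
  have eq_e: "\<delta> (i, l) = ?e \<longleftrightarrow> i = k \<and> l = Suc m" if "l \<in> {1..r i}" for i l
    using that Sm by (simp del: One_nat_def)
  have "xs (mutation \<kappa> ?e T) (\<delta> (i, l)) = (if i = k \<and> l \<le> Suc m then nx l else x i l)"
    if "l \<in> {1..r i}" for i l
    unfolding mut(1) M' V' ye xe using that
    by (auto simp: eq_e IH(2) nx_def le_Suc_eq)
  moreover have "ys (mutation \<kappa> ?e T) (\<delta> (i, l)) = (if i = k then if l \<le> Suc m then inverse (y k l) else y k l
       else y i l * (\<Prod>l\<in>{1..Suc m}. y k l ^ nat (b k i) * (1 + y k l) powi (- b k i)))"
    if "l \<in> {1..r i}" for i l
    unfolding mut(2) ye using that
    by (auto simp: eq_e IH(3) Brow b le_Suc_eq mult.assoc)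
  moreover have "Bm (mutation \<kappa> ?e T) (\<delta> (i, l)) (\<delta> (j, l')) =
       (if i = k \<and> l \<le> Suc m \<or> j = k \<and> l' \<le> Suc m then - b i j else b i j + int (Suc m) * c i j)"
    if l: "l \<in> {1..r i}" "l' \<in> {1..r j}" for i j l l'
  proof -
    have "Bm (mutation \<kappa> ?e T) (\<delta> (i, l)) (\<delta> (j, l')) =
      (if i = k \<and> l = Suc m \<or> j = k \<and> l' = Suc m then - Bm T (\<delta> (i, l)) (\<delta> (j, l'))
       else Bm T (\<delta> (i, l)) (\<delta> (j, l')) + c i j)"
      unfolding mut(4) by (simp add: eq_e[OF l(1)] eq_e[OF l(2)] Bcol[OF l(1)] Brow[OF l(2)] c_def)
    also have "\<dots> = (if i = k \<and> l \<le> Suc m \<or> j = k \<and> l' \<le> Suc m then - b i j else b i j + int (Suc m) * c i j)"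
      unfolding IH(4)[OF l] by (auto simp: ck b le_Suc_eq algebra_simps)
    finally show ?thesis .
  qed
  ultimately show ?case
    unfolding step M_def[symmetric] V_def[symmetric] nx_def[symmetric] c_def[symmetric]
    using mut(3) by blast
qed

text \<open>The exchange relations of one block share the same monomials, and the variables enter
  these only through block products. Multiplying the relations therefore gives a closed recursion
  for the \<open>Xprod\<close>.\<close>

lemma composite_mutation_eq:
  fixes \<kappa> :: "'q::semifield qp \<Rightarrow> 'g::field" and S :: "('d, 'q, 'g) seed" and b :: "'n \<Rightarrow> 'n \<Rightarrow> int"
  assumes \<kappa>: "semiring_map \<kappa>" and Z: "Zs S = (\<lambda>_. [:1, 1:])"
    and B: "\<forall>i j. \<forall>l\<in>{1..r i}. \<forall>m\<in>{1..r j}. Bm S (\<delta> (i, l)) (\<delta> (j, m)) = b i j"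
    and b: "b k k = 0"
  defines "y \<equiv> \<lambda>i l. ys S (\<delta> (i, l))" and "Xs \<equiv> Xprod r \<delta> S" and "S' \<equiv> composite_mutation \<kappa> r \<delta> k S"
  shows "Zs S' = (\<lambda>_. [:1, 1:])"
    and "Xprod r \<delta> S' i = (if i = k
       then inverse (Xs k) * (\<Prod>i\<in>UNIV. Xs i ^ nat (- b i k)) ^ r k
         * (\<Prod>l\<in>{1..r k}. 1 + zp_in \<kappa> (gel (y k l)) * (\<Prod>i\<in>UNIV. Xs i powi b i k))
         / zp_in \<kappa> (gel (\<Prod>l\<in>{1..r k}. 1 + y k l))
       else Xs i)"
    and "l \<in> {1..r i} \<Longrightarrow> ys S' (\<delta> (i, l)) = (if i = k then inverse (y k l)
       else y i l * ((\<Prod>l\<in>{1..r k}. y k l) ^ nat (b k i) * (\<Prod>l\<in>{1..r k}. 1 + y k l) powi (- b k i)))"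
    and "l \<in> {1..r i} \<Longrightarrow> l' \<in> {1..r j} \<Longrightarrow> Bm S' (\<delta> (i, l)) (\<delta> (j, l')) =
       (if i = k \<or> j = k then - b i j
        else b i j + int (r k) * (b i k * max (b k j) 0 + max (- b i k) 0 * b k j))"
proof -
  note fm = fold_mutation[OF \<kappa> Z B b order_refl, folded composite_mutation_def S'_def Xprod_def]
  show "Zs S' = (\<lambda>_. [:1, 1:])" using fm by blast
  show "ys S' (\<delta> (i, l)) = (if i = k then inverse (y k l)
       else y i l * ((\<Prod>l\<in>{1..r k}. y k l) ^ nat (b k i) * (\<Prod>l\<in>{1..r k}. 1 + y k l) powi (- b k i)))"
    if "l \<in> {1..r i}"
    using fm that by (auto simp: y_def power_prod power_int_prod_semifield prod.distrib)
  show "Bm S' (\<delta> (i, l)) (\<delta> (j, l')) =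
       (if i = k \<or> j = k then - b i j
        else b i j + int (r k) * (b i k * max (b k j) 0 + max (- b i k) 0 * b k j))"
    if "l \<in> {1..r i}" "l' \<in> {1..r j}"
    using fm that by auto
  have xs': "xs S' (\<delta> (i, l)) = (if i = k
       then inverse (xs S (\<delta> (k, l))) * (\<Prod>i\<in>UNIV. Xs i ^ nat (- b i k))
         * (1 + zp_in \<kappa> (gel (y k l)) * (\<Prod>i\<in>UNIV. Xs i powi b i k)) / zp_in \<kappa> (gel (1 + y k l))
       else xs S (\<delta> (i, l)))" if "l \<in> {1..r i}" for i l
    using fm that by (auto simp: y_def Xs_def)
  show "Xprod r \<delta> S' i = (if i = k
       then inverse (Xs k) * (\<Prod>i\<in>UNIV. Xs i ^ nat (- b i k)) ^ r k
         * (\<Prod>l\<in>{1..r k}. 1 + zp_in \<kappa> (gel (y k l)) * (\<Prod>i\<in>UNIV. Xs i powi b i k))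
         / zp_in \<kappa> (gel (\<Prod>l\<in>{1..r k}. 1 + y k l))
       else Xs i)"
  proof (cases "i = k")
    case True
    have "Xprod r \<delta> S' k = (\<Prod>l\<in>{1..r k}. inverse (xs S (\<delta> (k, l))) * (\<Prod>i\<in>UNIV. Xs i ^ nat (- b i k))
         * (1 + zp_in \<kappa> (gel (y k l)) * (\<Prod>i\<in>UNIV. Xs i powi b i k)) / zp_in \<kappa> (gel (1 + y k l)))"
      unfolding Xprod_def by (intro prod.cong refl) (simp add: xs' del: One_nat_def)
    also have "\<dots> = inverse (Xs k) * (\<Prod>i\<in>UNIV. Xs i ^ nat (- b i k)) ^ r k
         * (\<Prod>l\<in>{1..r k}. 1 + zp_in \<kappa> (gel (y k l)) * (\<Prod>i\<in>UNIV. Xs i powi b i k))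
         / zp_in \<kappa> (gel (\<Prod>l\<in>{1..r k}. 1 + y k l))"
      unfolding Xs_def Xprod_def prod_dividef prod.distrib prod_constant gel_prod
        semiring_map_prod[OF semiring_map_zp_in[OF \<kappa>]]
      by (simp add: prod_inversef[unfolded o_def])
    finally show ?thesis using True by simp
  next
    case False
    then show ?thesis unfolding Xs_def Xprod_def by (auto intro!: prod.cong simp: xs' simp del: One_nat_def)
  qed
qed

end

section \<open>Embedding the ambient fields\<close>

text \<open>Equal kernels make u P / u Q \<mapsto> v P / v Q well defined. The field need only be
  exhausted by such fractions, so this serves both for the coefficient fields and for the ambient
  fields.\<close>

lemma fraction_hom_extension:
  fixes u :: "'r::comm_ring_1 \<Rightarrow> 'f::field" and v :: "'r \<Rightarrow> 'g::field"
  assumes u: "semiring_map u" and v: "semiring_map v"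
    and uv: "\<And>P. u P = 0 \<longleftrightarrow> v P = 0" and frac: "\<And>a. \<exists>P Q. u Q \<noteq> 0 \<and> a = u P / u Q"
  shows "\<exists>j. semiring_map j \<and> (\<forall>P. j (u P) = v P)"
proof -
  define j where "j a = (SOME b. \<exists>P Q. u Q \<noteq> 0 \<and> a = u P / u Q \<and> b = v P / v Q)" for a
  have j: "j (u P / u Q) = v P / v Q" if Q: "u Q \<noteq> 0" for P Q
  proof -
    have "\<exists>b P' Q'. u Q' \<noteq> 0 \<and> u P / u Q = u P' / u Q' \<and> b = v P' / v Q'" using Q by blast
    then have "\<exists>P' Q'. u Q' \<noteq> 0 \<and> u P / u Q = u P' / u Q' \<and> j (u P / u Q) = v P' / v Q'"
      unfolding j_def by (rule someI_ex)
    then obtain P' Q' where *: "u Q' \<noteq> 0" "u P / u Q = u P' / u Q'" "j (u P / u Q) = v P' / v Q'" by blast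
    have "u (P * Q' - P' * Q) = 0"
      using * Q by (simp add: semiring_map_diff[OF u] semiring_mapD[OF u] frac_eq_eq)
    then have "v P * v Q' = v P' * v Q"
      by (simp add: uv semiring_map_diff[OF v] semiring_mapD[OF v])
    then have "v P' / v Q' = v P / v Q" using *(1) Q uv by (simp add: frac_eq_eq)
    then show ?thesis by (simp only: *(3))
  qed
  have "semiring_map j"
    unfolding semiring_map_def
  proof (intro conjI allI)
    fix a b
    obtain P Q P' Q' where *: "u Q \<noteq> 0" "a = u P / u Q" "u Q' \<noteq> 0" "b = u P' / u Q'" using frac by metis
    have vQ: "v Q \<noteq> 0" "v Q' \<noteq> 0" using * uv by auto
    have QQ: "u (Q * Q') \<noteq> 0" using * by (simp add: semiring_mapD[OF u])
    have "a + b = u (P * Q' + P' * Q) / u (Q * Q')" "a * b = u (P * P') / u (Q * Q')"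
      using * by (simp_all add: semiring_mapD[OF u] add_frac_eq)
    then show "j (a + b) = j a + j b" "j (a * b) = j a * j b"
      using * vQ by (simp_all add: j[OF QQ] j semiring_mapD[OF v] add_frac_eq)
    show "j 0 = 0" "j 1 = 1" using j[of 1 0] j[of 1 1] by (simp_all add: semiring_mapD[OF u] semiring_mapD[OF v])
  qed
  moreover have "j (u P) = v P" for P using j[of 1 P] by (simp add: semiring_mapD[OF u] semiring_mapD[OF v])
  ultimately show ?thesis by blast
qed

lemma group_ring_map_id: "group_ring_map (\<lambda>p. p) a = a"
  by (simp add: group_ring_map_def gel_def flip: frag_expansion)

lemma group_ring_map_inject:
  assumes "inj f" "group_ring_map f a = group_ring_map f b" shows "a = b"
proof -
  have "group_ring_map (inv_into UNIV f) (group_ring_map f c) = c" for c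
    using assms(1) by (simp add: group_ring_map_comp group_ring_map_id)
  then show ?thesis using assms(2) by metis
qed

lemma free_generating_nonzero:
  assumes "semiring_map \<iota>" "free_generating \<iota> x" shows "x i \<noteq> 0"
proof
  assume "x i = 0"
  then have "poly_eval \<iota> x (Poly_Mapping.single (Poly_Mapping.single i 1) 1) = 0"
    by (simp add: poly_eval_eq_pm_eval pm_eval_single semiring_mapD[OF assms(1)])
  then have "Poly_Mapping.single (Poly_Mapping.single i (1::nat)) (1 :: 'a qp) = 0"
    using assms(2) by (simp add: free_generating_def)
  then show False by (metis lookup_single_eq lookup_zero zero_neq_one)
qed

context ambient_data
begin

text \<open>Each monomial in \<open>X\<close> is the monomial in \<open>x\<close> with constant
  exponent on every block, and this assignment is injective since no block is empty. A relation
  among the \<open>X\<close> is thus one among the free variables \<open>x\<close>.\<close>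

lemma X_independent:
  fixes \<mu> :: "'a::comm_ring_1 \<Rightarrow> ('p, 'd) pbar qp"
  assumes \<mu>: "semiring_map \<mu>" "\<And>a. \<mu> a = 0 \<Longrightarrow> a = 0"
    and P: "poly_eval (\<lambda>a. \<kappa> (\<mu> a)) X P = 0"
  shows "P = 0"
proof -
  define blow where "blow m = Abs_poly_mapping (\<lambda>d. Poly_Mapping.lookup m (fst (unindex d)))" for m :: "'n \<Rightarrow>\<^sub>0 nat"
  have blow: "Poly_Mapping.lookup (blow m) (\<delta> (i, l)) = Poly_Mapping.lookup m i" if "l \<in> {1..r i}" for m i l
    using that by (simp add: blow_def)
  have inj: "m = m'" if "blow m = blow m'" for m m'
    by (rule poly_mapping_eqI) (metis blow[of 1] that r_pos atLeastAtMost_iff order_refl)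
  have mon: "monomial_eval x (blow m) = monomial_eval X m" for m
  proof -
    have "monomial_eval x (blow m) = (\<Prod>i\<in>UNIV. \<Prod>l\<in>{1..r i}. x (\<delta> (i, l)) ^ Poly_Mapping.lookup m i)"
      unfolding monomial_eval_finite prod_\<delta> by (intro prod.cong refl) (simp only: blow)
    then show ?thesis by (simp add: monomial_eval_finite X_def power_prod)
  qed
  define F where "F = (\<Sum>m\<in>Poly_Mapping.keys P. Poly_Mapping.single (blow m) (\<mu> (Poly_Mapping.lookup P m)))"
  have ev: "semiring_map (poly_eval \<kappa> x)"
    unfolding poly_eval_eq_pm_eval by (intro semiring_map_pm_eval \<kappa> monoid_map_monomial_eval)
  have evs: "poly_eval \<kappa> x (Poly_Mapping.single m a) = \<kappa> a * monomial_eval x m" for m a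
    unfolding poly_eval_eq_pm_eval by (rule pm_eval_single) (rule semiring_mapD(1)[OF \<kappa>])
  have "poly_eval \<kappa> x F = poly_eval (\<lambda>a. \<kappa> (\<mu> a)) X P"
    unfolding F_def semiring_map_sum[OF ev] evs mon by (simp add: poly_eval_eq_pm_eval pm_eval_def)
  then have "F = 0" using P free by (simp add: free_generating_def)
  have "Poly_Mapping.lookup P m = 0" for m
  proof (cases "m \<in> Poly_Mapping.keys P")
    case True
    have "Poly_Mapping.lookup F (blow m) = (\<Sum>m'\<in>Poly_Mapping.keys P. if m' = m then \<mu> (Poly_Mapping.lookup P m') else 0)"
      unfolding F_def lookup_sum by (intro sum.cong refl) (auto simp: lookup_single when_def dest: inj)
    then show ?thesis using \<open>F = 0\<close> True \<mu>(2) by (simp add: sum.delta)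
  qed (simp add: in_keys_iff)
  then show ?thesis by (intro poly_mapping_eqI) simp
qed

text \<open>First \<open>pbar_of\<close> is extended to the fraction fields of the group rings, then
  the initial cluster is sent to \<open>X\<close>; both evaluations are injective. The resulting
  \<open>j\<close> identifies the generalized ambient field with the copy of \<rat>\<P>(X) in which
  the specialization takes its values.\<close>

lemma field_embedding_exists:
  fixes \<iota> :: "'p qp \<Rightarrow> 'f::field"
  assumes \<iota>: "semiring_map \<iota>" and xg: "free_generating \<iota> xg"
  shows "\<exists>j. semiring_map j \<and> (\<forall>a. j (zp_in \<iota> a) = hat_in a) \<and> (\<forall>i. j (xg i) = X i)"
proof -
  have inj: "inj (pbar_of :: 'p \<Rightarrow> ('p, 'd) pbar)" by (rule injI) (simp add: pbar_of_inject)
  have grm: "semiring_map (group_ring_map (pbar_of :: 'p \<Rightarrow> ('p, 'd) pbar))"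
    by (intro semiring_map_group_ring_map pbar_of_1 pbar_of_mult)
  have "\<exists>\<mu>. semiring_map \<mu> \<and> (\<forall>a. \<mu> (Fract a 1) = (Fract (group_ring_map pbar_of a) 1 :: ('p, 'd) pbar qp))"
  proof (rule fraction_hom_extension)
    show "semiring_map (\<lambda>a :: 'p zp. Fract a 1)" by (rule semiring_map_Fract)
    show "semiring_map (\<lambda>a. Fract (group_ring_map pbar_of a) 1 :: ('p, 'd) pbar qp)"
      by (rule semiring_map_comp[OF semiring_map_Fract grm])
    show "Fract a 1 = 0 \<longleftrightarrow> Fract (group_ring_map pbar_of a) 1 = (0 :: ('p, 'd) pbar qp)" for a
      using group_ring_map_inject[OF inj, of a 0] semiring_mapD(1)[OF grm]
      by (auto simp: Zero_fract_def eq_fract)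
    show "\<exists>P Q. Fract Q 1 \<noteq> 0 \<and> a = Fract P 1 / Fract Q 1" for a :: "'p qp"
      by (cases a) (auto simp: Zero_fract_def eq_fract)
  qed
  then obtain \<mu> :: "'p qp \<Rightarrow> ('p, 'd) pbar qp" where \<mu>: "semiring_map \<mu>"
    "\<And>a. \<mu> (Fract a 1) = Fract (group_ring_map pbar_of a) 1" by blast
  have \<kappa>\<mu>: "semiring_map (\<lambda>a. \<kappa> (\<mu> a))" by (rule semiring_map_comp[OF \<kappa> \<mu>(1)])
  have "\<exists>j. semiring_map j \<and> (\<forall>P. j (poly_eval \<iota> xg P) = poly_eval (\<lambda>a. \<kappa> (\<mu> a)) X P)"
  proof (rule fraction_hom_extension)
    show "semiring_map (poly_eval \<iota> xg)" "semiring_map (poly_eval (\<lambda>a. \<kappa> (\<mu> a)) X)"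
      unfolding poly_eval_eq_pm_eval by (intro semiring_map_pm_eval \<iota> \<kappa>\<mu> monoid_map_monomial_eval)+
    have 1: "P = 0" if "poly_eval \<iota> xg P = 0" for P using xg that by (simp add: free_generating_def)
    have 2: "P = 0" if "poly_eval (\<lambda>a. \<kappa> (\<mu> a)) X P = 0" for P
      by (rule X_independent[OF \<mu>(1) _ that]) (simp add: semiring_map_field_eq_0[OF \<mu>(1)])
    show "poly_eval \<iota> xg P = 0 \<longleftrightarrow> poly_eval (\<lambda>a. \<kappa> (\<mu> a)) X P = 0" for P
      using 1[of P] 2[of P] by (auto simp: poly_eval_def)
    show "\<exists>P Q. poly_eval \<iota> xg Q \<noteq> 0 \<and> a = poly_eval \<iota> xg P / poly_eval \<iota> xg Q" for a
      using xg unfolding free_generating_def by blast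
  qed
  then obtain j where j: "semiring_map j" "\<And>P. j (poly_eval \<iota> xg P) = poly_eval (\<lambda>a. \<kappa> (\<mu> a)) X P" by blast
  have "j (zp_in \<iota> a) = hat_in a" for a
  proof -
    have "poly_eval \<iota> xg (Poly_Mapping.single 0 (Fract a 1)) = zp_in \<iota> a"
      by (simp add: poly_eval_eq_pm_eval pm_eval_single semiring_mapD[OF \<iota>] zp_in_def monomial_eval_def)
    moreover have "poly_eval (\<lambda>a. \<kappa> (\<mu> a)) X (Poly_Mapping.single 0 (Fract a 1)) = hat_in a"
      by (simp add: poly_eval_eq_pm_eval pm_eval_single semiring_mapD[OF \<kappa>\<mu>] zp_in_def hat_in_def \<mu>(2) monomial_eval_def)
    ultimately show ?thesis using j(2) by metis
  qed
  moreover have "j (xg i) = X i" for i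
  proof -
    have "poly_eval \<iota> xg (Poly_Mapping.single (Poly_Mapping.single i 1) 1) = xg i"
      by (simp add: poly_eval_eq_pm_eval pm_eval_single semiring_mapD[OF \<iota>])
    moreover have "poly_eval (\<lambda>a. \<kappa> (\<mu> a)) X (Poly_Mapping.single (Poly_Mapping.single i 1) 1) = X i"
      by (simp add: poly_eval_eq_pm_eval pm_eval_single semiring_mapD[OF \<kappa>\<mu>])
    ultimately show ?thesis using j(2) by metis
  qed
  ultimately show ?thesis using j(1) by blast
qed

end

section \<open>The composite pattern specializes to the generalized pattern\<close>

lemma tree_ConsD: "k # t \<in> tree \<Longrightarrow> t \<in> tree \<and> adjacent k t (k # t) \<and> adjacent k (k # t) t"
  by (cases t) (auto simp: tree_def adjacent_def)

text \<open>Deleting letters joins every vertex to the empty word, and adjacency is symmetric; so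
  walk from \<open>t0\<close> down to the empty word and then up to \<open>t\<close>.\<close>

lemma tree_connected:
  assumes t0: "t0 \<in> tree" "P t0" and step: "\<And>k t t'. adjacent k t t' \<Longrightarrow> P t \<Longrightarrow> P t'" and t: "t \<in> tree"
  shows "P t"
proof -
  have down: "w \<in> tree \<Longrightarrow> P w \<Longrightarrow> P []" for w
  proof (induction w)
    case (Cons k w)
    then show ?case using tree_ConsD[of k w] step[of k "k # w" w] by simp
  qed
  have up: "w \<in> tree \<Longrightarrow> P [] \<Longrightarrow> P w" for w
  proof (induction w)
    case (Cons k w)
    then show ?case using tree_ConsD[of k w] step[of k w "k # w"] by simp
  qed
  show ?thesis using down[OF t0] up[OF t] by blast
qed

lemma adjacent_exists:
  assumes "t \<in> tree" shows "\<exists>t'. adjacent k t t'"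
proof (cases "t \<noteq> [] \<and> hd t = k")
  case True
  then have "t = k # tl t" by (metis list.collapse)
  then show ?thesis using tree_ConsD[of k "tl t"] assms by metis
next
  case False
  then have "k # t \<in> tree" using assms by (cases t) (auto simp: tree_def)
  then show ?thesis using assms by (auto simp: adjacent_def)
qed

text \<open>Reversing coefficients corresponds to y^n P(1/y). Together with its counterpart over a
  field, this handles directions mutated an odd number of times.\<close>

lemma eval_P0_reflect:
  assumes "Polynomial.degree P = n" "Polynomial.coeff P 0 \<noteq> 0"
  shows "eval_P0 (reflect_poly P) y = El y ^ n * eval_P0 P (inverse y)"
proof -
  have "eval_P0 (reflect_poly P) y = (\<Sum>l\<le>n. \<pi>\<^sub>0 (Polynomial.coeff P (n - l)) * El y ^ l)"
    using assms by (simp add: eval_P0_def degree_reflect_poly_eq coeff_reflect_poly El_power)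
  also have "\<dots> = (\<Sum>l\<le>n. \<pi>\<^sub>0 (Polynomial.coeff P l) * El y ^ (n - l))"
    by (rule sum.reindex_bij_witness[of _ "\<lambda>l. n - l" "\<lambda>l. n - l"]) auto
  also have "\<dots> = (\<Sum>l\<le>n. El y ^ n * (\<pi>\<^sub>0 (Polynomial.coeff P l) * El (inverse y) ^ l))"
  proof (rule sum.cong[OF refl])
    fix l assume "l \<in> {..n}"
    then have "El y ^ n = El y ^ (n - l) * El y ^ l" by (simp flip: power_add)
    moreover have "El y ^ l * El (inverse y) ^ l = 1"
      by (simp add: semifield_right_inverse El_1 flip: power_mult_distrib)
    ultimately have "El y ^ n * El (inverse y) ^ l = El y ^ (n - l)" by (simp add: mult.assoc)
    then show "\<pi>\<^sub>0 (Polynomial.coeff P l) * El y ^ (n - l) =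
        El y ^ n * (\<pi>\<^sub>0 (Polynomial.coeff P l) * El (inverse y) ^ l)"
      by (simp add: mult.left_commute)
  qed
  finally show ?thesis using assms by (simp add: eval_P0_def El_power sum_distrib_left)
qed

lemma poly_map_reflect:
  fixes f :: "'a::comm_ring_1 \<Rightarrow> 'b::field"
  assumes f: "semiring_map f" and "Polynomial.degree P = n" "Polynomial.coeff P 0 \<noteq> 0" "b \<noteq> 0"
  shows "Polynomial.poly (map_poly f (reflect_poly P)) b = b ^ n * Polynomial.poly (map_poly f P) (inverse b)"
proof -
  have "Polynomial.poly (map_poly f (reflect_poly P)) b = (\<Sum>l\<le>n. f (Polynomial.coeff P (n - l)) * b ^ l)"
    using assms by (subst poly_map_poly_eq_sum[OF f, of _ n]) (simp_all add: degree_reflect_poly_eq coeff_reflect_poly)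
  also have "\<dots> = (\<Sum>l\<le>n. f (Polynomial.coeff P l) * b ^ (n - l))"
    by (rule sum.reindex_bij_witness[of _ "\<lambda>l. n - l" "\<lambda>l. n - l"]) auto
  also have "\<dots> = (\<Sum>l\<le>n. b ^ n * (f (Polynomial.coeff P l) * inverse b ^ l))"
    using assms(4) by (intro sum.cong refl) (simp add: power_diff field_simps)
  also have "\<dots> = b ^ n * Polynomial.poly (map_poly f P) (inverse b)"
    using assms(2) by (simp add: poly_map_poly_eq_sum[OF f, of P n] sum_distrib_left)
  finally show ?thesis .
qed

section \<open>Comparison of the two patterns, seed by seed\<close>

locale pattern_data = ambient_data r \<delta> Z \<kappa> x
  for r :: "'n::finite \<Rightarrow> nat" and \<delta> :: "'n \<times> nat \<Rightarrow> 'd::{finite, linorder}"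
    and Z :: "'n \<Rightarrow> 'p::semifield zp poly" and \<kappa> :: "('p, 'd) pbar qp \<Rightarrow> 'g::field" and x +
  fixes \<iota> :: "'p qp \<Rightarrow> 'f::field" and \<Sigma>g :: "'n list \<Rightarrow> ('n, 'p, 'f) seed" and t0 :: "'n list"
    and \<Sigma>c :: "'n list \<Rightarrow> ('d, ('p, 'd) pbar, 'g) seed" and j :: "'f \<Rightarrow> 'g"
  assumes \<iota>: "semiring_map \<iota>" and \<Sigma>g: "gen_cluster_pattern \<iota> r \<Sigma>g" and t0: "t0 \<in> tree"
    and \<Sigma>c: "composite_pattern \<kappa> r \<delta> (\<Sigma>g t0) t0 \<Sigma>c"
    and Z: "Z = Zs (\<Sigma>g t0)" and x: "x = xs (\<Sigma>c t0)"
    and j: "semiring_map j" and j_scalar: "\<And>a. j (zp_in \<iota> a) = hat_in a"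
    and j_initial: "\<And>i. j (xs (\<Sigma>g t0) i) = X i"
begin

definition inverse_if :: "bool \<Rightarrow> ('p, 'd) pbar \<Rightarrow> ('p, 'd) pbar" where
  "inverse_if e s = (if e then s else inverse s)"

text \<open>Below, \<open>e i\<close> says that the number of mutations in direction \<open>i\<close> since the initial
  vertex is even.\<close>

definition matches :: "('n, 'p, 'f) seed \<Rightarrow> ('d, ('p, 'd) pbar, 'g) seed \<Rightarrow> bool" where
  "matches S T \<longleftrightarrow> (\<exists>e q.
     (\<forall>i. \<forall>l\<in>{1..r i}. ys T (\<delta> (i, l)) = inverse_if (e i) (svar (\<delta> (i, l))) * q i) \<and>
     (\<forall>i. specializes (q i) (ys S i)) \<and>
     (\<forall>i. Zs S i = (if e i then Z i else reflect_poly (Z i))) \<and>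
     (\<forall>i j. \<forall>l\<in>{1..r i}. \<forall>m\<in>{1..r j}. Bm T (\<delta> (i, l)) (\<delta> (j, m)) = Bm S i j) \<and>
     Zs T = (\<lambda>_. [:1, 1:]) \<and>
     (\<forall>i. hat_specializes (Xprod r \<delta> T i) (j (xs S i))))"

lemma Xprod_initial: "Xprod r \<delta> (\<Sigma>c t0) = X"
  by (rule ext) (simp only: Xprod_def X_def, simp only: x)

lemma matches_initial: "matches (\<Sigma>g t0) (\<Sigma>c t0)"
  unfolding matches_def
proof (intro exI conjI allI ballI)
  fix i
  show "ys (\<Sigma>c t0) (\<delta> (i, l)) = inverse_if True (svar (\<delta> (i, l))) * pbar_of (ys (\<Sigma>g t0) i)"
    if "l \<in> {1..r i}" for l
    using \<Sigma>c that unfolding composite_pattern_def inverse_if_def index_pairs_def by auto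
  show "specializes (pbar_of (ys (\<Sigma>g t0) i)) (ys (\<Sigma>g t0) i)" by (rule specializes_pbar_of)
  show "Zs (\<Sigma>g t0) i = (if True then Z i else reflect_poly (Z i))" by (simp add: Z)
  show "Bm (\<Sigma>c t0) (\<delta> (i, l)) (\<delta> (j, m)) = Bm (\<Sigma>g t0) i j" if "l \<in> {1..r i}" "m \<in> {1..r j}" for j l m
    using \<Sigma>c that unfolding composite_pattern_def index_pairs_def by auto
  show "Zs (\<Sigma>c t0) = (\<lambda>_. [:1, 1:])"
    using \<Sigma>c unfolding composite_pattern_def ordinary_seed_def by auto
  show "hat_specializes (Xprod r \<delta> (\<Sigma>c t0) i) (j (xs (\<Sigma>g t0) i))"
    unfolding j_initial Xprod_initial by (rule hat_specializes_X)
qed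

lemma j_eq_0: "j a = 0 \<longleftrightarrow> a = 0"
  by (rule semiring_map_field_eq_0[OF j])

lemma hat_in_eq_0: "hat_in a = 0 \<longleftrightarrow> a = 0"
  by (simp add: j_eq_0 zp_in_eq_0[OF \<iota>] flip: j_scalar)

lemma specializes_inverse_if_prod: "specializes (\<Prod>l\<in>{1..r i}. inverse_if e (svar (\<delta> (i, l)))) 1"
  using specializes_svar_prod[of i] specializes_inverse[OF specializes_svar_prod[of i]]
  by (cases e) (simp_all add: inverse_if_def inverse_prod_semifield)

text \<open>For inverted s each factor is rewritten as 1 + q/s = (q/s)(1 + s/q). The product of the
  1/s specializes to 1, and the remaining factor q^r times the product in 1/q is the reversed
  polynomial.\<close>

lemma specializes_factor_if:
  assumes q: "specializes q p"
  shows "specializes (\<Prod>l\<in>{1..r i}. 1 + inverse_if e (svar (\<delta> (i, l))) * q)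
    (un_El (eval_P0 (if e then Z i else reflect_poly (Z i)) p))"
proof (cases e)
  case True
  then show ?thesis using specializes_factor[OF q, of i] by (simp add: inverse_if_def)
next
  case False
  have "1 + inverse s * q = q * inverse s * (1 + s * inverse q)" for s
  proof -
    have "q * inverse s * (1 + s * inverse q) = q * inverse s + (q * inverse q) * (inverse s * s)"
      by (simp only: distrib_left mult_1_left mult_1_right mult_ac)
    then show ?thesis by (simp add: semifield_right_inverse semifield_left_inverse mult.commute add.commute)
  qed
  then have "(\<Prod>l\<in>{1..r i}. 1 + inverse_if e (svar (\<delta> (i, l))) * q) =
      q ^ r i * inverse (\<Prod>l\<in>{1..r i}. svar (\<delta> (i, l))) * (\<Prod>l\<in>{1..r i}. 1 + svar (\<delta> (i, l)) * inverse q)"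
    using False by (simp add: inverse_if_def prod.distrib inverse_prod_semifield)
  moreover have "specializes \<dots> (p ^ r i * inverse 1 * un_El (eval_P0 (Z i) (inverse p)))"
    by (intro specializes_mult specializes_power specializes_inverse specializes_svar_prod specializes_factor q)
  moreover have "un_El (eval_P0 (reflect_poly (Z i)) p) = p ^ r i * un_El (eval_P0 (Z i) (inverse p))"
    using eval_P0_nonzero[of i "inverse p"]
    by (simp add: eval_P0_reflect[OF Z_degree_eq] Z_bot un_El_mult flip: El_power)
  ultimately show ?thesis using False by simp
qed

lemma hat_specializes_factor_if:
  assumes ab: "hat_specializes a b" and b: "b \<noteq> 0"
  shows "hat_specializes (\<Prod>l\<in>{1..r i}. 1 + zp_in \<kappa> (gel (inverse_if e (svar (\<delta> (i, l))))) * a)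
    (Polynomial.poly (map_poly hat_in (if e then Z i else reflect_poly (Z i))) b)"
proof (cases e)
  case True
  then show ?thesis using hat_specializes_factor[OF ab, of i] by (simp add: inverse_if_def)
next
  case False
  let ?s = "\<lambda>l. zp_in \<kappa> (gel (svar (\<delta> (i, l))))"
  \<comment> \<open>Zero specializes only to zero, so the nonzero value \<open>b\<close> rules it
    out.\<close>
  have "a \<noteq> 0" using b ab hat_specializes_0 hat_specializes_unique by blast
  have s: "?s l \<noteq> 0" for l by (simp add: zp_in_eq_0[OF \<kappa>] gel_nonzero)
  have sinv: "zp_in \<kappa> (gel (inverse q)) = inverse (zp_in \<kappa> (gel q))" for q
  proof -
    have "zp_in \<kappa> (gel q) * zp_in \<kappa> (gel (inverse q)) = 1"
      by (simp add: semifield_right_inverse gel_1 semiring_mapD(2)[OF scal] flip: semiring_mapD(4)[OF scal] gel_mult)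
    then show ?thesis by (metis inverse_unique)
  qed
  have "1 + zp_in \<kappa> (gel (inverse (svar (\<delta> (i, l))))) * a = a * inverse (?s l) * (1 + ?s l * inverse a)" for l
    using \<open>a \<noteq> 0\<close> s[of l] by (simp add: sinv field_simps)
  then have "(\<Prod>l\<in>{1..r i}. 1 + zp_in \<kappa> (gel (inverse_if e (svar (\<delta> (i, l))))) * a) =
      a ^ r i * inverse (zp_in \<kappa> (gel (\<Prod>l\<in>{1..r i}. svar (\<delta> (i, l))))) * (\<Prod>l\<in>{1..r i}. 1 + ?s l * inverse a)"
    using False
    by (simp add: inverse_if_def prod.distrib gel_prod semiring_map_prod[OF scal] prod_inversef[unfolded o_def])
  moreover have "hat_specializes \<dots> (b ^ r i * inverse (hat_in (gel 1)) * Polynomial.poly (map_poly hat_in (Z i)) (inverse b))"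
    by (intro hat_specializes_mult hat_specializes_power hat_specializes_inverse hat_specializes_factor
        hat_specializes_scal specializes_svar_prod ab b) (simp add: hat_in_eq_0 gel_nonzero)
  moreover have "Polynomial.poly (map_poly hat_in (reflect_poly (Z i))) b =
      b ^ r i * Polynomial.poly (map_poly hat_in (Z i)) (inverse b)"
    using b by (intro poly_map_reflect semiring_map_hat_in Z_degree_eq) (simp_all add: Z_bot)
  ultimately show ?thesis using False by (simp add: gel_1 semiring_mapD(2)[OF semiring_map_hat_in])
qed

text \<open>Both mutations act by parallel formulas once the s-factors are split off. The block
  product then gives \<open>Zs S k\<close> in its current orientation, with the semifield addition
  in the denominator and that of the group ring in the numerator.\<close>

lemma matches_mutation:
  assumes ST: "matches S T" and bkk: "Bm S k k = 0" and xs: "\<And>i. xs S i \<noteq> 0"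
  shows "matches (gen_mutation \<iota> r k S) (composite_mutation \<kappa> r \<delta> k T)"
proof -
  obtain e q where
    y: "\<And>i l. l \<in> {1..r i} \<Longrightarrow> ys T (\<delta> (i, l)) = inverse_if (e i) (svar (\<delta> (i, l))) * q i"
    and q: "\<And>i. specializes (q i) (ys S i)"
    and ZS: "\<And>i. Zs S i = (if e i then Z i else reflect_poly (Z i))"
    and B: "\<forall>i j. \<forall>l\<in>{1..r i}. \<forall>m\<in>{1..r j}. Bm T (\<delta> (i, l)) (\<delta> (j, m)) = Bm S i j"
    and ZT: "Zs T = (\<lambda>_. [:1, 1:])"
    and X: "\<And>i. hat_specializes (Xprod r \<delta> T i) (j (xs S i))"
    using ST unfolding matches_def by blast
  note cm = composite_mutation_eq[OF \<kappa> ZT B bkk]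
  define zk where "zk = un_El (eval_P0 (Zs S k) (ys S k))"
  define Y where "Y = (\<Prod>l\<in>{1..r k}. ys T (\<delta> (k, l)))"
  define W where "W = (\<Prod>l\<in>{1..r k}. 1 + ys T (\<delta> (k, l)))"
  have "Y = (\<Prod>l\<in>{1..r k}. inverse_if (e k) (svar (\<delta> (k, l))) * q k)"
    unfolding Y_def by (intro prod.cong refl y)
  then have Y: "specializes Y (ys S k ^ r k)"
    using specializes_mult[OF specializes_inverse_if_prod[where i = k and e = "e k"] specializes_power[OF q[of k], of "r k"]]
    by (simp add: prod.distrib)
  have "W = (\<Prod>l\<in>{1..r k}. 1 + inverse_if (e k) (svar (\<delta> (k, l))) * q k)"
    unfolding W_def by (intro prod.cong refl) (simp only: y)
  then have W: "specializes W zk"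
    unfolding zk_def ZS by (simp only:) (rule specializes_factor_if[OF q])
  define e' where "e' = e(k := \<not> e k)"
  \<comment> \<open>Mutation changes the s-factors only by inversion in block \<open>k\<close>;
    \<open>q'\<close> is what remains. It stays in S because \<open>Y\<close> and \<open>W\<close>
    are products over the whole block.\<close>
  define q' where "q' i = (if i = k then inverse (q k)
    else q i * (Y ^ nat (Bm S k i) * W powi (- Bm S k i)))" for i
  define yhat where "yhat = zp_in \<iota> (gel (ys S k)) * (\<Prod>i\<in>UNIV. xs S i powi Bm S i k)"
  have gm: "xs (gen_mutation \<iota> r k S) = (\<lambda>i. if i = k
      then inverse (xs S k) * (\<Prod>i\<in>UNIV. xs S i ^ nat (- Bm S i k)) ^ r k
        * Polynomial.poly (map_poly (zp_in \<iota>) (Zs S k)) yhat / zp_in \<iota> (gel zk) else xs S i)"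
    "ys (gen_mutation \<iota> r k S) = (\<lambda>i. if i = k then inverse (ys S k)
      else ys S i * (ys S k ^ nat (Bm S k i)) ^ r k * zk powi (- Bm S k i))"
    "Zs (gen_mutation \<iota> r k S) = (\<lambda>i. if i = k then reflect_poly (Zs S k) else Zs S i)"
    "Bm (gen_mutation \<iota> r k S) = (\<lambda>i j. if i = k \<or> j = k then - Bm S i j
       else Bm S i j + int (r k) * (Bm S i k * max (Bm S k j) 0 + max (- Bm S i k) 0 * Bm S k j))"
    by (simp_all add: gen_mutation_def Let_def zk_def yhat_def fun_eq_iff)
  have "(\<forall>i. \<forall>l\<in>{1..r i}. ys (composite_mutation \<kappa> r \<delta> k T) (\<delta> (i, l)) =
      inverse_if (e' i) (svar (\<delta> (i, l))) * q' i)"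
  proof (intro allI ballI)
    fix i l assume l: "l \<in> {1..r i}"
    show "ys (composite_mutation \<kappa> r \<delta> k T) (\<delta> (i, l)) = inverse_if (e' i) (svar (\<delta> (i, l))) * q' i"
    proof (cases "i = k")
      case True
      then show ?thesis using l y[of l k] cm(3)[OF l]
        by (simp add: e'_def q'_def inverse_if_def semifield_inverse_mult)
    next
      case False
      then have "ys (composite_mutation \<kappa> r \<delta> k T) (\<delta> (i, l)) =
          ys T (\<delta> (i, l)) * (Y ^ nat (Bm S k i) * W powi (- Bm S k i))"
        using cm(3)[OF l] unfolding Y_def W_def by simp
      then show ?thesis using False by (simp only: y[OF l]) (simp add: e'_def q'_def mult.assoc)
    qed
  qed
  moreover have "specializes (q' i) (ys (gen_mutation \<iota> r k S) i)" for i
  proof (cases "i = k")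
    case True
    then show ?thesis using specializes_inverse[OF q] by (simp add: q'_def gm)
  next
    case False
    have "specializes (q i * (Y ^ nat (Bm S k i) * W powi (- Bm S k i)))
        (ys S i * ((ys S k ^ r k) ^ nat (Bm S k i) * zk powi (- Bm S k i)))"
      by (intro specializes_mult specializes_power specializes_power_int q Y W)
    moreover have "(ys S k ^ r k) ^ nat (Bm S k i) = (ys S k ^ nat (Bm S k i)) ^ r k"
      by (simp flip: power_mult add: mult.commute)
    ultimately show ?thesis using False by (simp add: q'_def gm mult.assoc)
  qed
  moreover have "Zs (gen_mutation \<iota> r k S) i = (if e' i then Z i else reflect_poly (Z i))" for i
    using Z_bot[of k] by (auto simp: gm ZS e'_def)
  moreover have "Bm (composite_mutation \<kappa> r \<delta> k T) (\<delta> (i, l)) (\<delta> (j, m)) = Bm (gen_mutation \<iota> r k S) i j"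
    if "l \<in> {1..r i}" "m \<in> {1..r j}" for i j l m
    using cm(4)[OF that] by (simp add: gm)
  moreover have "hat_specializes (Xprod r \<delta> (composite_mutation \<kappa> r \<delta> k T) i) (j (xs (gen_mutation \<iota> r k S) i))" for i
  proof (cases "i = k")
    case True
    define V where "V = (\<Prod>i\<in>UNIV. Xprod r \<delta> T i powi Bm S i k)"
    \<comment> \<open>The part of the composite y-hat that is common to the block, with the s-factor
      removed; it specializes to \<open>j yhat\<close>.\<close>
    define a where "a = zp_in \<kappa> (gel (q k)) * V"
    have jx: "j (xs S i) \<noteq> 0" for i using xs by (simp add: j_eq_0)
    have jyhat: "j yhat = hat_in (gel (ys S k)) * (\<Prod>i\<in>UNIV. j (xs S i) powi Bm S i k)"
      by (simp add: yhat_def semiring_mapD(4)[OF j] j_scalar semiring_map_prod[OF j] semiring_map_power_int[OF j])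
    have a: "hat_specializes a (j yhat)"
      unfolding jyhat a_def V_def
      by (intro hat_specializes_mult hat_specializes_scal q hat_specializes_prod hat_specializes_power_int X jx)
    have "j yhat \<noteq> 0"
      unfolding jyhat using jx by (simp add: hat_in_eq_0 gel_nonzero power_int_not_zero)
    note factor = hat_specializes_factor_if[OF a this, where i = k and e = "e k"]
    have "(\<Prod>l\<in>{1..r k}. 1 + zp_in \<kappa> (gel (ys T (\<delta> (k, l)))) * V) =
        (\<Prod>l\<in>{1..r k}. 1 + zp_in \<kappa> (gel (inverse_if (e k) (svar (\<delta> (k, l))))) * a)"
      by (intro prod.cong refl) (simp only: y a_def gel_mult semiring_mapD(4)[OF scal] mult.assoc)
    then have "Xprod r \<delta> (composite_mutation \<kappa> r \<delta> k T) k =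
        inverse (Xprod r \<delta> T k) * (\<Prod>i\<in>UNIV. Xprod r \<delta> T i ^ nat (- Bm S i k)) ^ r k
         * (\<Prod>l\<in>{1..r k}. 1 + zp_in \<kappa> (gel (inverse_if (e k) (svar (\<delta> (k, l))))) * a)
         / zp_in \<kappa> (gel W)"
      using cm(2)[where i = k] unfolding V_def W_def by simp
    moreover have "j (xs (gen_mutation \<iota> r k S) k) =
        inverse (j (xs S k)) * (\<Prod>i\<in>UNIV. j (xs S i) ^ nat (- Bm S i k)) ^ r k
        * Polynomial.poly (map_poly hat_in (Zs S k)) (j yhat) / hat_in (gel zk)"
    proof -
      have "j (Polynomial.poly (map_poly (zp_in \<iota>) P) u) = Polynomial.poly (map_poly hat_in P) (j u)" for P u
        by (simp add: poly_map_poly_eq_sum[OF semiring_map_zp_in[OF \<iota>] order_refl] semiring_map_sum[OF j]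
            poly_map_poly_eq_sum[OF semiring_map_hat_in order_refl] semiring_mapD(4)[OF j] j_scalar semiring_map_power[OF j])
      then show ?thesis
        by (simp add: gm semiring_mapD(4)[OF j] semiring_map_divide[OF j] semiring_map_inverse[OF j]
            semiring_map_prod[OF j] semiring_map_power[OF j] j_scalar)
    qed
    ultimately show ?thesis
      using True factor
      by (simp only: flip: ZS)
        (intro hat_specializes_divide hat_specializes_mult hat_specializes_inverse hat_specializes_power
          hat_specializes_prod hat_specializes_scal X W jx, simp_all add: hat_in_eq_0 gel_nonzero)
  next
    case False
    then show ?thesis using X[of i] cm(2)[where i = i] by (simp add: gm)
  qed
  ultimately show ?thesis
    unfolding matches_def using cm(1) by blast
qed

lemma matches_all: "t \<in> tree \<Longrightarrow> matches (\<Sigma>g t) (\<Sigma>c t)"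
proof (rule tree_connected[where P = "\<lambda>t. matches (\<Sigma>g t) (\<Sigma>c t)", OF t0 matches_initial])
  fix k t t' assume adj: "adjacent k t t'" and m: "matches (\<Sigma>g t) (\<Sigma>c t)"
  then have "t \<in> tree" by (simp add: adjacent_def)
  then have seed: "gen_seed \<iota> r (\<Sigma>g t)" using \<Sigma>g by (simp add: gen_cluster_pattern_def)
  then obtain d :: "'n \<Rightarrow> int" where "\<And>i. d i > 0" "\<And>i j. d i * Bm (\<Sigma>g t) i j = - (d j * Bm (\<Sigma>g t) j i)"
    unfolding gen_seed_def skew_symmetrizable_def by blast
  \<comment> \<open>Skew-symmetrizability makes the diagonal vanish, which is what decouples the
    mutations within a block.\<close>
  then have "d k \<noteq> 0" "d k * Bm (\<Sigma>g t) k k = - (d k * Bm (\<Sigma>g t) k k)" by (metis less_irrefl, blast)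
  then have "Bm (\<Sigma>g t) k k = 0" by simp
  moreover have "xs (\<Sigma>g t) i \<noteq> 0" for i
    using seed by (intro free_generating_nonzero[OF \<iota>]) (simp add: gen_seed_def)
  moreover have "\<Sigma>g t' = gen_mutation \<iota> r k (\<Sigma>g t)" "\<Sigma>c t' = composite_mutation \<kappa> r \<delta> k (\<Sigma>c t)"
    using adj \<Sigma>g \<Sigma>c by (auto simp: gen_cluster_pattern_def composite_pattern_def)
  ultimately show "matches (\<Sigma>g t') (\<Sigma>c t')" using matches_mutation[OF m] by simp
qed

lemma hat_specializes_Xprod: "t \<in> tree \<Longrightarrow> hat_specializes (Xprod r \<delta> (\<Sigma>c t) i) (j (xs (\<Sigma>g t) i))"
  using matches_all unfolding matches_def by blast

end

section \<open>The isomorphism\<close>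

lemma ring_type_subring: "ring (type_subring (generate_ring ring_of_type_algebra H))"
  by (rule ring.generate_ring_is_ring[OF ring_from_type_algebra]) simp

lemma type_subring_a_inv:
  assumes "ring (type_subring A)" "a \<in> A" "- a \<in> A"
  shows "\<ominus>\<^bsub>type_subring A\<^esub> a = - a"
proof -
  interpret ring "type_subring A" by fact
  show ?thesis by (rule minus_equality) (use assms in simp_all)
qed

lemma generate_ring_subring:
  assumes A: "A = generate_ring ring_of_type_algebra H" and B: "B = generate_ring ring_of_type_algebra H'"
    and "B \<subseteq> A"
  shows "subring B (type_subring A)"
proof -
  interpret A: ring "type_subring A" unfolding A by (rule ring_type_subring)
  show ?thesis
  proof (rule A.subringI)
    fix h assume h: "h \<in> B"
    then have "- h \<in> B" unfolding B by (rule generate_ring_type)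
    moreover have "\<ominus>\<^bsub>type_subring A\<^esub> h = - h"
      by (rule type_subring_a_inv[OF A.ring_axioms]) (use h calculation assms(3) in auto)
    ultimately show "\<ominus>\<^bsub>type_subring A\<^esub> h \<in> B" by simp
  qed (use assms(3) in \<open>auto simp: B generate_ring_type\<close>)
qed

lemma ring_hom_generate_ring_unique:
  assumes A: "A = generate_ring ring_of_type_algebra H" and S: "ring S"
    and \<Phi>: "\<Phi> \<in> ring_hom (type_subring A) S" and \<Psi>: "\<Psi> \<in> ring_hom (type_subring A) S"
    and H: "\<And>h. h \<in> H \<Longrightarrow> \<Phi> h = \<Psi> h" and a: "a \<in> A"
  shows "\<Phi> a = \<Psi> a"
proof -
  have R: "ring (type_subring A)" unfolding A by (rule ring_type_subring)
  interpret \<Phi>: ring_hom_ring "type_subring A" S \<Phi> by (rule ring_hom_ringI2[OF R S \<Phi>])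
  interpret \<Psi>: ring_hom_ring "type_subring A" S \<Psi> by (rule ring_hom_ringI2[OF R S \<Psi>])
  have "a \<in> A \<and> \<Phi> a = \<Psi> a"
    using a unfolding A
  proof (induction rule: generate_ring_type_induct)
    case one
    then show ?case using ring_hom_one[OF \<Phi>] ring_hom_one[OF \<Psi>] by (simp add: generate_ring_type)
  next
    case (incl h)
    then show ?case using H by (simp add: generate_ring_type)
  next
    case (uminus a)
    then have a: "a \<in> A" "\<Phi> a = \<Psi> a" by (simp_all add: A)
    then have m: "- a \<in> A" unfolding A by (intro generate_ring_type(4))
    then show ?case
      using \<Phi>.hom_a_inv[of a] \<Psi>.hom_a_inv[of a] type_subring_a_inv[OF R a(1) m] a by (simp add: A)
  next
    case (add a b)
    then show ?case
      using ring_hom_add[OF \<Phi>, of a b] ring_hom_add[OF \<Psi>, of a b] by (simp add: A generate_ring_type)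
  next
    case (mult a b)
    then show ?case
      using ring_hom_mult[OF \<Phi>, of a b] ring_hom_mult[OF \<Psi>, of a b] by (simp add: A generate_ring_type)
  qed
  then show ?thesis by simp
qed

lemma zp_in_generated_by_gel:
  assumes \<iota>: "semiring_map \<iota>"
  shows "zp_in \<iota> a \<in> generate_ring ring_of_type_algebra (range (\<lambda>p. zp_in \<iota> (gel p)))"
    (is "_ \<in> ?G")
proof -
  note z = semiring_map_zp_in[OF \<iota>]
  have "Poly_Mapping.keys a \<subseteq> UNIV" by simp
  then show ?thesis
  proof (induction rule: frag_induction)
    case zero
    then show ?case by (simp add: semiring_mapD(1)[OF z] generate_ring_type)
  next
    case (one k)
    have "frag_of k = gel (of_additive k)" by (simp add: gel_def)
    then show ?case by (auto intro!: generate_ring_type(3))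
  next
    case (diff a b)
    then have "zp_in \<iota> a + - zp_in \<iota> b \<in> ?G" by (intro generate_ring_type(4,5))
    then show ?case by (simp add: semiring_map_diff[OF z])
  qed
qed

text \<open>Integer combinations come for free in a generated ring, so group elements replace the
  whole group ring. A homomorphism is then determined by its values on \<P> and on the cluster
  variables.\<close>

lemma cluster_algebra_generators:
  assumes \<iota>: "semiring_map \<iota>"
  shows "cluster_algebra \<iota> \<Sigma> = generate_ring ring_of_type_algebra
    (range (\<lambda>p. zp_in \<iota> (gel p)) \<union> {xs (\<Sigma> t) i | t i. t \<in> tree})" (is "_ = ?G")
proof
  show "cluster_algebra \<iota> \<Sigma> \<subseteq> ?G"
  proof
    fix a assume "a \<in> cluster_algebra \<iota> \<Sigma>"
    then show "a \<in> ?G"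
      unfolding cluster_algebra_def
    proof (induction rule: generate_ring_type_induct)
      case (incl h)
      have "generate_ring ring_of_type_algebra (range (\<lambda>p. zp_in \<iota> (gel p))) \<subseteq> ?G"
        by (rule ring.mono_generate_ring[OF ring_from_type_algebra]) auto
      then have scalar: "zp_in \<iota> b \<in> ?G" for b using zp_in_generated_by_gel[OF \<iota>] by (rule subsetD)
      show ?case
      proof (cases "h \<in> range (zp_in \<iota>)")
        case True
        then show ?thesis using scalar by auto
      next
        case False
        then show ?thesis using incl by (intro generate_ring_type(3)) blast
      qed
    qed (auto intro: generate_ring_type(1,4,5,6))
  qed
  show "?G \<subseteq> cluster_algebra \<iota> \<Sigma>"
    unfolding cluster_algebra_def
    by (rule ring.mono_generate_ring[OF ring_from_type_algebra]) (auto simp del: Un_insert_left)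
qed

lemma generate_ring_prod:
  fixes f :: "'i \<Rightarrow> 'a::field"
  shows "(\<And>i. i \<in> A \<Longrightarrow> f i \<in> generate_ring ring_of_type_algebra H) \<Longrightarrow>
    prod f A \<in> generate_ring ring_of_type_algebra H"
  by (induction A rule: infinite_finite_induct) (auto intro: generate_ring_type(1,6))

text \<open>Every vertex has an edge with each label, so any sequence of mutations is a walk in the
  tree.\<close>

lemma cluster_pattern_fold_mutation:
  assumes \<Sigma>: "cluster_pattern \<kappa> \<Sigma>" and v: "v \<in> tree" "\<Sigma> v = S"
  shows "\<exists>v'\<in>tree. \<Sigma> v' = fold (\<lambda>l. mutation \<kappa> (f l)) ls S"
  using v
proof (induction ls arbitrary: v S)
  case (Cons l ls)
  obtain w where "adjacent (f l) v w" using adjacent_exists[OF Cons.prems(1)] by blast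
  then have "w \<in> tree" "\<Sigma> w = mutation \<kappa> (f l) S"
    using \<Sigma> Cons.prems(2) by (auto simp: adjacent_def cluster_pattern_def)
  from Cons.IH[OF this] show ?case by simp
qed auto

section \<open>The specialization as a surjection onto the generalized cluster algebra\<close>

context pattern_data
begin

lemma Acomp_subset_cluster_algebra:
  assumes \<Sigma>: "cluster_pattern \<kappa> \<Sigma>" and v0: "v0 \<in> tree" "\<Sigma> v0 = \<Sigma>c t0"
  shows "Acomp \<kappa> r \<delta> Z \<Sigma>c \<subseteq> cluster_algebra \<kappa> \<Sigma>"
proof
  have vertex: "\<exists>v\<in>tree. \<Sigma> v = \<Sigma>c t" if "t \<in> tree" for t
  proof (rule tree_connected[where P = "\<lambda>t. \<exists>v\<in>tree. \<Sigma> v = \<Sigma>c t", OF t0 _ _ that])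
    show "\<exists>v\<in>tree. \<Sigma> v = \<Sigma>c t0" using v0 by blast
  next
    fix k t t' assume "adjacent k t t'" "\<exists>v\<in>tree. \<Sigma> v = \<Sigma>c t"
    moreover have "\<Sigma>c t' = composite_mutation \<kappa> r \<delta> k (\<Sigma>c t)"
      using \<Sigma>c calculation(1) by (auto simp: composite_pattern_def)
    ultimately show "\<exists>v\<in>tree. \<Sigma> v = \<Sigma>c t'"
      using cluster_pattern_fold_mutation[OF \<Sigma>] unfolding composite_mutation_def by metis
  qed
  fix a assume "a \<in> Acomp \<kappa> r \<delta> Z \<Sigma>c"
  then show "a \<in> cluster_algebra \<kappa> \<Sigma>"
    unfolding Acomp_def
  proof (induction rule: generate_ring_type_induct)
    case (incl h)
    show ?case
    proof (cases "h \<in> range (zp_in \<kappa>)")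
      case True
      then show ?thesis unfolding cluster_algebra_def by (auto intro: generate_ring_type)
    next
      case False
      then obtain t i where h: "h = Xprod r \<delta> (\<Sigma>c t) i" "t \<in> tree" using incl by blast
      then obtain v where "v \<in> tree" "\<Sigma> v = \<Sigma>c t" using vertex by blast
      then have "xs (\<Sigma>c t) d \<in> cluster_algebra \<kappa> \<Sigma>" for d
        unfolding cluster_algebra_def by (intro generate_ring_type(3)) (auto, metis)
      then show ?thesis unfolding h Xprod_def cluster_algebra_def by (intro generate_ring_prod)
    qed
  qed (auto simp: cluster_algebra_def intro: generate_ring_type(1,4,5,6))
qed

abbreviation (input) "Ac \<equiv> Acomp \<kappa> r \<delta> Z \<Sigma>c"
abbreviation (input) "Ag \<equiv> cluster_algebra \<iota> \<Sigma>g"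

lemma hat_in_comp_psi: "hat_specializes (zp_in \<kappa> a) (j (zp_in \<iota> (group_ring_map (psi r \<delta> Z) a)))"
  if "a \<in> group_ring_on (Ssf r \<delta> Z)"
  using hat_specializes_group_ring[OF that] by (simp add: j_scalar)

text \<open>\<psi> is the identity on \<P>, so a scalar of the generalized algebra is lifted by its
  own image under \<open>pbar_of\<close>.\<close>

lemma scalar_in_Ac:
  "zp_in \<kappa> (group_ring_map pbar_of a) \<in> Ac \<and>
   hat_specializes (zp_in \<kappa> (group_ring_map pbar_of a)) (j (zp_in \<iota> a))"
proof -
  have "range pbar_of \<subseteq> Ssf r \<delta> Z" using specializes_pbar_of Ssf_iff by blast
  moreover have "group_ring_map pbar_of a \<in> group_ring_on (range (pbar_of :: 'p \<Rightarrow> ('p, 'd) pbar))"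
    by (rule group_ring_on_map) (simp add: group_ring_on_def)
  ultimately have in_S: "group_ring_map pbar_of a \<in> group_ring_on (Ssf r \<delta> Z)"
    unfolding group_ring_on_def by blast
  then have "zp_in \<kappa> (group_ring_map pbar_of a) \<in> Ac"
    unfolding Acomp_def by (intro generate_ring_type(3)) blast
  moreover have "group_ring_map (psi r \<delta> Z) (group_ring_map pbar_of a) = a"
    by (simp add: group_ring_map_comp psi_eq[OF specializes_pbar_of] group_ring_map_id)
  ultimately show ?thesis using hat_in_comp_psi[OF in_S] by simp
qed

lemma Xprod_in_Ac: "t \<in> tree \<Longrightarrow> Xprod r \<delta> (\<Sigma>c t) i \<in> Ac"
  unfolding Acomp_def by (intro generate_ring_type(3)) blast

lemma x_in_Ag: "t \<in> tree \<Longrightarrow> xs (\<Sigma>g t) i \<in> Ag"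
  unfolding cluster_algebra_def by (intro generate_ring_type(3)) blast

text \<open>One induction gives both facts needed about psi-hat on \<open>Ac\<close>: it is defined
  there, and its values lie in the copy of \<open>Ag\<close> under \<open>j\<close>.\<close>

lemma Ac_specializes: "a \<in> Ac \<Longrightarrow> \<exists>b\<in>Ag. hat_specializes a (j b)"
  unfolding Acomp_def
proof (induction rule: generate_ring_type_induct)
  case one
  show ?case
    using hat_specializes_1 by (intro bexI[of _ 1]) (simp_all add: semiring_mapD[OF j] cluster_algebra_def generate_ring_type)
next
  case (incl h)
  then consider a where "h = zp_in \<kappa> a" "a \<in> group_ring_on (Ssf r \<delta> Z)"
    | t i where "h = Xprod r \<delta> (\<Sigma>c t) i" "t \<in> tree" by blast
  then show ?case
  proof cases
    case (1 a)
    have "zp_in \<iota> (group_ring_map (psi r \<delta> Z) a) \<in> Ag"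
      unfolding cluster_algebra_def by (intro generate_ring_type(3)) blast
    then show ?thesis using hat_in_comp_psi[OF 1(2)] 1(1) by blast
  next
    case (2 t i)
    then show ?thesis using hat_specializes_Xprod x_in_Ag by blast
  qed
next
  case (uminus a)
  then obtain b where "b \<in> Ag" "hat_specializes a (j b)" by blast
  then show ?case
    using hat_specializes_uminus generate_ring_type(4)
    by (intro bexI[of _ "- b"]) (auto simp: semiring_map_uminus[OF j] cluster_algebra_def)
next
  case (add a a')
  then obtain b b' where "b \<in> Ag" "hat_specializes a (j b)" "b' \<in> Ag" "hat_specializes a' (j b')" by blast
  then show ?case
    using hat_specializes_add generate_ring_type(5)
    by (intro bexI[of _ "b + b'"]) (auto simp: semiring_mapD[OF j] cluster_algebra_def)
next
  case (mult a a')
  then obtain b b' where "b \<in> Ag" "hat_specializes a (j b)" "b' \<in> Ag" "hat_specializes a' (j b')" by blast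
  then show ?case
    using hat_specializes_mult generate_ring_type(6)
    by (intro bexI[of _ "b * b'"]) (auto simp: semiring_mapD[OF j] cluster_algebra_def)
qed

text \<open>Surjectivity. Lifts of generators are known and lifts can be added, multiplied and
  negated.\<close>

lemma Ag_lifts: "b \<in> Ag \<Longrightarrow> \<exists>a\<in>Ac. hat_specializes a (j b)"
  unfolding cluster_algebra_def
proof (induction rule: generate_ring_type_induct)
  case one
  show ?case
    using hat_specializes_1 by (intro bexI[of _ 1]) (simp_all add: semiring_mapD[OF j] Acomp_def generate_ring_type)
next
  case (incl h)
  then show ?case using scalar_in_Ac hat_specializes_Xprod Xprod_in_Ac by blast
next
  case (uminus b)
  then obtain a where "a \<in> Ac" "hat_specializes a (j b)" by blast
  then show ?case
    using hat_specializes_uminus generate_ring_type(4)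
    by (intro bexI[of _ "- a"]) (auto simp: semiring_map_uminus[OF j] Acomp_def)
next
  case (add b b')
  then obtain a a' where "a \<in> Ac" "hat_specializes a (j b)" "a' \<in> Ac" "hat_specializes a' (j b')" by blast
  then show ?case
    using hat_specializes_add generate_ring_type(5)
    by (intro bexI[of _ "a + a'"]) (auto simp: semiring_mapD[OF j] Acomp_def)
next
  case (mult b b')
  then obtain a a' where "a \<in> Ac" "hat_specializes a (j b)" "a' \<in> Ac" "hat_specializes a' (j b')" by blast
  then show ?case
    using hat_specializes_mult generate_ring_type(6)
    by (intro bexI[of _ "a * a'"]) (auto simp: semiring_mapD[OF j] Acomp_def)
qed

text \<open>psi-hat on \<open>Ac\<close>, read back through the embedding \<open>j\<close> in the
  ambient field of the generalized pattern.\<close>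

definition \<eta> :: "'g \<Rightarrow> 'f" where
  "\<eta> a = (THE b. hat_specializes a (j b))"

lemma \<eta>_eq: "hat_specializes a (j b) \<Longrightarrow> \<eta> a = b"
  unfolding \<eta>_def
  by (rule the_equality) (auto dest: hat_specializes_unique intro: semiring_map_inj[OF j] simp: j_eq_0)

lemma \<eta>_Ac: "a \<in> Ac \<Longrightarrow> \<eta> a \<in> Ag \<and> hat_specializes a (j (\<eta> a))"
  using Ac_specializes \<eta>_eq by metis

lemma \<eta>_ring_hom: "ring_hom_ring (type_subring Ac) (type_subring Ag) \<eta>"
proof (rule ring_hom_ringI2)
  show "ring (type_subring Ac)" "ring (type_subring Ag)"
    unfolding Acomp_def cluster_algebra_def by (rule ring_type_subring)+
  show "\<eta> \<in> ring_hom (type_subring Ac) (type_subring Ag)"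
  proof (rule ring_hom_memI)
    fix a b assume ab: "a \<in> carrier (type_subring Ac)" "b \<in> carrier (type_subring Ac)"
    then have "hat_specializes (a + b) (j (\<eta> a + \<eta> b))" "hat_specializes (a * b) (j (\<eta> a * \<eta> b))"
      using \<eta>_Ac hat_specializes_add hat_specializes_mult by (simp_all add: semiring_mapD[OF j])
    then show "\<eta> (a \<otimes>\<^bsub>type_subring Ac\<^esub> b) = \<eta> a \<otimes>\<^bsub>type_subring Ag\<^esub> \<eta> b"
      "\<eta> (a \<oplus>\<^bsub>type_subring Ac\<^esub> b) = \<eta> a \<oplus>\<^bsub>type_subring Ag\<^esub> \<eta> b"
      by (simp_all add: \<eta>_eq)
  next
    have "hat_specializes 1 (j 1)" using hat_specializes_1 by (simp add: semiring_mapD[OF j])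
    then show "\<eta> \<one>\<^bsub>type_subring Ac\<^esub> = \<one>\<^bsub>type_subring Ag\<^esub>" by (simp add: \<eta>_eq)
  qed (use \<eta>_Ac in simp)
qed

lemma \<eta>_image: "\<eta> ` carrier (type_subring Ac) = carrier (type_subring Ag)"
proof
  show "\<eta> ` carrier (type_subring Ac) \<subseteq> carrier (type_subring Ag)" using \<eta>_Ac by auto
  show "carrier (type_subring Ag) \<subseteq> \<eta> ` carrier (type_subring Ac)"
  proof
    fix b assume "b \<in> carrier (type_subring Ag)"
    then obtain a where "a \<in> Ac" "hat_specializes a (j b)" using Ag_lifts[of b] by auto
    then show "b \<in> \<eta> ` carrier (type_subring Ac)" using \<eta>_eq by force
  qed
qed

text \<open>\<open>j\<close> is injective, so \<open>\<eta>\<close> vanishes exactly where psi-hat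
  does.\<close>

lemma Iker_eq: "Iker \<kappa> r \<delta> Z t0 \<Sigma>c = a_kernel (type_subring Ac) (type_subring Ag) \<eta>"
proof -
  have "a \<in> Scal \<kappa> r \<delta> Z X \<and> (psihat \<kappa> r \<delta> Z X a = 0 \<longleftrightarrow> \<eta> a = 0)" if "a \<in> Ac" for a
    using \<eta>_Ac[OF that] psihat_eq j_eq_0 Scal_iff by metis
  then show ?thesis by (auto simp: Iker_def Xprod_initial a_kernel_def')
qed

text \<open>\<open>\<Psi>\<close> is obtained as the inverse of the isomorphism induced by
  \<open>\<eta>\<close> on the quotient. It could not be defined by its values on generators
  directly, as the relations in \<open>Ag\<close> are unknown; the prescribed values are verified
  afterwards.\<close>

lemma composite_quotient_iso:
  assumes \<Sigma>: "cluster_pattern \<kappa> \<Sigma>" and v0: "v0 \<in> tree" "\<Sigma> v0 = \<Sigma>c t0"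
  defines "I \<equiv> Iker \<kappa> r \<delta> Z t0 \<Sigma>c"
  shows "subring Ac (type_subring (cluster_algebra \<kappa> \<Sigma>)) \<and> ideal I (type_subring Ac) \<and>
    (\<exists>\<Psi> \<in> ring_hom (type_subring Ag) (type_subring Ac Quot I).
       (\<forall>a. \<Psi> (zp_in \<iota> a) = I +>\<^bsub>type_subring Ac\<^esub> zp_in \<kappa> (group_ring_map pbar_of a)) \<and>
       (\<forall>i. \<forall>t\<in>tree. \<Psi> (xs (\<Sigma>g t) i) = I +>\<^bsub>type_subring Ac\<^esub> Xprod r \<delta> (\<Sigma>c t) i) \<and>
       (\<forall>p. \<Psi> (zp_in \<iota> (gel p)) = I +>\<^bsub>type_subring Ac\<^esub> zp_in \<kappa> (gel (pbar_of p))) \<and>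
       (\<forall>\<Phi> \<in> ring_hom (type_subring Ag) (type_subring Ac Quot I).
          (\<forall>i. \<forall>t\<in>tree. \<Phi> (xs (\<Sigma>g t) i) = I +>\<^bsub>type_subring Ac\<^esub> Xprod r \<delta> (\<Sigma>c t) i) \<longrightarrow>
          (\<forall>p. \<Phi> (zp_in \<iota> (gel p)) = I +>\<^bsub>type_subring Ac\<^esub> zp_in \<kappa> (gel (pbar_of p))) \<longrightarrow>
          (\<forall>a\<in>Ag. \<Phi> a = \<Psi> a)) \<and>
       \<Psi> \<in> ring_iso (type_subring Ag) (type_subring Ac Quot I))"
proof -
  interpret \<eta>: ring_hom_ring "type_subring Ac" "type_subring Ag" \<eta> by (rule \<eta>_ring_hom)
  have I: "I = a_kernel (type_subring Ac) (type_subring Ag) \<eta>" unfolding I_def by (rule Iker_eq)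
  have ideal: "ideal I (type_subring Ac)" unfolding I by (rule \<eta>.kernel_is_ideal)
  have quot: "ring (type_subring Ac Quot I)" by (rule ideal.quotient_is_ring[OF ideal])
  define \<phi> where "\<phi> X = the_elem (\<eta> ` X)" for X
  have \<phi>: "\<phi> \<in> ring_iso (type_subring Ac Quot I) (type_subring Ag)"
    unfolding I \<phi>_def by (rule \<eta>.FactRing_iso_set[OF \<eta>_image])
  define \<Psi> where "\<Psi> = inv_into (carrier (type_subring Ac Quot I)) \<phi>"
  have \<Psi>: "\<Psi> \<in> ring_iso (type_subring Ag) (type_subring Ac Quot I)"
    unfolding \<Psi>_def by (rule ring_iso_set_sym[OF quot \<phi>])
  then have \<Psi>hom: "\<Psi> \<in> ring_hom (type_subring Ag) (type_subring Ac Quot I)" by (simp add: ring_iso_def)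
  \<comment> \<open>Any lift of \<open>b\<close> represents \<open>\<Psi> b\<close>, so the values
    on generators can be read off from their known lifts.\<close>
  have \<Psi>_eq: "\<Psi> b = I +>\<^bsub>type_subring Ac\<^esub> a" if "a \<in> Ac" "hat_specializes a (j b)" for a b
  proof -
    have "\<phi> (I +>\<^bsub>type_subring Ac\<^esub> a) = b"
      unfolding I \<phi>_def using that \<eta>_eq \<eta>.the_elem_simp[of a] by simp
    moreover have "I +>\<^bsub>type_subring Ac\<^esub> a \<in> carrier (type_subring Ac Quot I)"
      using that by (auto simp: FactRing_def A_RCOSETS_def')
    moreover have "inj_on \<phi> (carrier (type_subring Ac Quot I))"
      using \<phi> by (auto simp: ring_iso_def bij_betw_def)
    ultimately show ?thesis unfolding \<Psi>_def by (metis inv_into_f_f)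
  qed
  have 1: "\<Psi> (zp_in \<iota> a) = I +>\<^bsub>type_subring Ac\<^esub> zp_in \<kappa> (group_ring_map pbar_of a)" for a
    using \<Psi>_eq scalar_in_Ac by blast
  have 2: "\<Psi> (xs (\<Sigma>g t) i) = I +>\<^bsub>type_subring Ac\<^esub> Xprod r \<delta> (\<Sigma>c t) i" if "t \<in> tree" for i t
    using \<Psi>_eq Xprod_in_Ac[OF that] hat_specializes_Xprod[OF that] by blast
  have 3: "\<Psi> (zp_in \<iota> (gel p)) = I +>\<^bsub>type_subring Ac\<^esub> zp_in \<kappa> (gel (pbar_of p))" for p
    using 1[of "gel p"] by simp
  have unique: "\<Phi> a = \<Psi> a"
    if \<Phi>: "\<Phi> \<in> ring_hom (type_subring Ag) (type_subring Ac Quot I)"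
      "\<forall>i. \<forall>t\<in>tree. \<Phi> (xs (\<Sigma>g t) i) = I +>\<^bsub>type_subring Ac\<^esub> Xprod r \<delta> (\<Sigma>c t) i"
      "\<forall>p. \<Phi> (zp_in \<iota> (gel p)) = I +>\<^bsub>type_subring Ac\<^esub> zp_in \<kappa> (gel (pbar_of p))"
      and a: "a \<in> Ag" for \<Phi> a
    by (rule ring_hom_generate_ring_unique[OF cluster_algebra_generators[OF \<iota>] quot \<Phi>(1) \<Psi>hom _ a])
      (use \<Phi>(2,3) 2 3 in auto)
  have sub: "subring Ac (type_subring (cluster_algebra \<kappa> \<Sigma>))"
    by (rule generate_ring_subring[OF cluster_algebra_def Acomp_def Acomp_subset_cluster_algebra[OF assms(1-3)]])
  have uniq: "\<forall>\<Phi> \<in> ring_hom (type_subring Ag) (type_subring Ac Quot I).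
      (\<forall>i. \<forall>t\<in>tree. \<Phi> (xs (\<Sigma>g t) i) = I +>\<^bsub>type_subring Ac\<^esub> Xprod r \<delta> (\<Sigma>c t) i) \<longrightarrow>
      (\<forall>p. \<Phi> (zp_in \<iota> (gel p)) = I +>\<^bsub>type_subring Ac\<^esub> zp_in \<kappa> (gel (pbar_of p))) \<longrightarrow>
      (\<forall>a\<in>Ag. \<Phi> a = \<Psi> a)"
    by (intro ballI impI) (rule unique)
  show ?thesis
    by (intro conjI bexI[OF _ \<Psi>hom] sub ideal uniq \<Psi>) (simp_all add: 1 2 3)
qed

end

theorem theorem5p5:
  fixes r :: "'n :: finite \<Rightarrow> nat"
    and \<iota> :: "'p :: semifield qp \<Rightarrow> 'f :: field"
    and \<Sigma>g :: "'n list \<Rightarrow> ('n, 'p, 'f) seed"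
    and t0 :: "'n list"
    and \<delta> :: "'n \<times> nat \<Rightarrow> 'd :: {finite, linorder}"
    and \<kappa> :: "('p, 'd) pbar qp \<Rightarrow> 'g :: field"
    and \<Sigma>c :: "'n list \<Rightarrow> ('d, ('p, 'd) pbar, 'g) seed"
    and \<Sigma> :: "'d list \<Rightarrow> ('d, ('p, 'd) pbar, 'g) seed"
    and v0 :: "'d list"
  defines "Z \<equiv> Zs (\<Sigma>g t0)"
  defines "Ag \<equiv> cluster_algebra \<iota> \<Sigma>g"
    and "A \<equiv> cluster_algebra \<kappa> \<Sigma>"
    and "Ac \<equiv> Acomp \<kappa> r \<delta> Z \<Sigma>c"
    and "I \<equiv> Iker \<kappa> r \<delta> Z t0 \<Sigma>c"
  assumes r: "\<forall>i. r i \<ge> 1"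
    and \<iota>: "\<iota> \<in> ring_hom ring_of_type_algebra ring_of_type_algebra"
    and \<Sigma>g: "gen_cluster_pattern \<iota> r \<Sigma>g"
    and t0: "t0 \<in> tree"
    and \<delta>: "bij_betw \<delta> (index_pairs r) UNIV"
    and \<kappa>: "\<kappa> \<in> ring_hom ring_of_type_algebra ring_of_type_algebra"
    and \<Sigma>c: "composite_pattern \<kappa> r \<delta> (\<Sigma>g t0) t0 \<Sigma>c"
    and \<Sigma>: "cluster_pattern \<kappa> \<Sigma>" and "v0 \<in> tree" and "\<Sigma> v0 = \<Sigma>c t0"
  shows "subring Ac (type_subring A) \<and> ideal I (type_subring Ac) \<and>
    (\<exists>\<Psi> \<in> ring_hom (type_subring Ag) (type_subring Ac Quot I).
       (\<forall>a. \<Psi> (zp_in \<iota> a) = I +>\<^bsub>type_subring Ac\<^esub> zp_in \<kappa> (group_ring_map pbar_of a)) \<and>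
       (\<forall>i. \<forall>t\<in>tree. \<Psi> (xs (\<Sigma>g t) i) = I +>\<^bsub>type_subring Ac\<^esub> Xprod r \<delta> (\<Sigma>c t) i) \<and>
       (\<forall>p. \<Psi> (zp_in \<iota> (gel p)) = I +>\<^bsub>type_subring Ac\<^esub> zp_in \<kappa> (gel (pbar_of p))) \<and>
       (\<forall>\<Phi> \<in> ring_hom (type_subring Ag) (type_subring Ac Quot I).
          (\<forall>i. \<forall>t\<in>tree. \<Phi> (xs (\<Sigma>g t) i) = I +>\<^bsub>type_subring Ac\<^esub> Xprod r \<delta> (\<Sigma>c t) i) \<longrightarrow>
          (\<forall>p. \<Phi> (zp_in \<iota> (gel p)) = I +>\<^bsub>type_subring Ac\<^esub> zp_in \<kappa> (gel (pbar_of p))) \<longrightarrow>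
          (\<forall>a\<in>Ag. \<Phi> a = \<Psi> a)) \<and>
       \<Psi> \<in> ring_iso (type_subring Ag) (type_subring Ac Quot I))"
proof -
  note \<iota>' = ring_hom_type_algebraD[OF \<iota>] and \<kappa>' = ring_hom_type_algebraD[OF \<kappa>]
  have seed: "gen_seed \<iota> r (\<Sigma>g t0)" using \<Sigma>g t0 by (simp add: gen_cluster_pattern_def)
  have "gen_seed \<kappa> (\<lambda>_. 1) (\<Sigma>c t0)"
    using \<Sigma>c by (simp add: composite_pattern_def ordinary_seed_def)
  then have free: "free_generating \<kappa> (xs (\<Sigma>c t0))" by (simp add: gen_seed_def)
  interpret amb: ambient_data r \<delta> Z \<kappa> "xs (\<Sigma>c t0)"
    by unfold_locales (use r \<delta> \<kappa>' free seed in \<open>auto simp: gen_seed_def Z_def\<close>)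
  have "free_generating \<iota> (xs (\<Sigma>g t0))" using seed by (simp add: gen_seed_def)
  \<comment> \<open>The embedding refers to \<open>hat_in\<close> and \<open>X\<close> of the
    interpreted ambient locale and is itself a parameter of the pattern locale, so it has to be
    chosen between the two interpretations.\<close>
  from amb.field_embedding_exists[OF \<iota>' this] obtain j where j: "semiring_map j"
    "\<And>a. j (zp_in \<iota> a) = amb.hat_in a" "\<And>i. j (xs (\<Sigma>g t0) i) = amb.X i"
    by blast
  interpret pattern_data r \<delta> Z \<kappa> "xs (\<Sigma>c t0)" \<iota> \<Sigma>g t0 \<Sigma>c j
    by unfold_locales (use \<iota>' \<Sigma>g t0 \<Sigma>c j in \<open>auto simp: Z_def\<close>)
  show ?thesis
    using composite_quotient_iso[OF \<Sigma> \<open>v0 \<in> tree\<close> \<open>\<Sigma> v0 = \<Sigma>c t0\<close>]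
    unfolding Ag_def A_def Ac_def I_def .
qed

end
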